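(* For all $P_1,P_2,N>0$ and every $2\times2$ positive semidefinite $\mathsf K_W$, $$\mathcal C_{\mathrm{NoisyFBSI}}(P_1,P_2,N,\mathsf K_W)\supseteq\mathcal R_{\mathrm{SI}}(P_1,P_2,N,\mathsf K_W).$$
   Context: Channel model (noisy feedback with receiver side-information). Fix $P_1,P_2,N>0$ and a $2\times 2$ positive semidefinite matrix $\mathsf{K}_W=\begin{pmatrix}\sigma_1^2&\varrho\sigma_1\sigma_2\\ \varrho\sigma_1\sigma_2&\sigma_2^2\end{pmatrix}$. Messages $M_1,M_2$ are independent and uniform on finite sets $\mathcal{M}_1,\mathcal{M}_2$. $\{Z_t\}$ is IID $\mathcal{N}(0,N)$, $\{(W_{1,t},W_{2,t})\}$ is IID zero-mean bivariate Gaussian with covariance $\mathsf{K}_W$, all mutually independent and independent of the messages. The output is $Y_t=X_{1,t}+X_{2,t}+Z_t$, Transmitter $\nu$ observes causally $V_{\nu,t}=Y_t+W_{\nu,t}$ and uses encoders $X_{\nu,t}=\varphi_{\nu,t}(M_\nu,V_{\nu,1},\dots,V_{\nu,t-1})$ with $\frac1n\sum_t\mathbb E[X_{\nu,t}^2]\le P_\nu$. The decoder observes both the outputs and the feedback-noise sequences: $\phi:\mathbb R^n\times\mathbb R^n\times\mathbb R^n\to\mathcal M_1\times\mathcal M_2$, $(Y^n,W_1^n,W_2^n)\mapsto(\hat M_1,\hat M_2)$. $(R_1,R_2)$ is achievable if for every $\delta>0$ and all large $n$ there is a blocklength-$n$ code with $\frac1n\log|\mathcal M_\nu|>R_\nu-\delta$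 and error probability tending to $0$. $\mathcal C_{\mathrm{NoisyFBSI}}(P_1,P_2,N,\mathsf K_W)$ is the set of achievable pairs. Region $\mathcal R_{\mathrm{SI}}$. For a positive integer $\eta$, $\mathbf a_1,\mathbf a_2\in\mathbb R^\eta$, strictly lower-triangular $\mathsf B_1,\mathsf B_2\in\mathbb R^{\eta\times\eta}$ and $\mathsf C\in\mathbb R^{2\times\eta}$, let $\mathsf A=(\mathbf a_1\ \mathbf a_2)$. If $\mathsf C\mathsf C^{\mathsf T}$ is nonsingular, the region for these parameters is the set of nonnegative $(R_1,R_2)$ with $R_1\le\frac1{2\eta}\log\frac{\det(\mathsf C(\mathbf a_1\mathbf a_1^{\mathsf T}+N\mathsf I_\eta)\mathsf C^{\mathsf T})}{\det(N\mathsf C\mathsf C^{\mathsf T})}$, $R_2\le\frac1{2\eta}\log\frac{\det(\mathsf C(\mathbf a_2\mathbf a_2^{\mathsf T}+N\mathsf I_\eta)\mathsf C^{\mathsf T})}{\det(N\mathsf C\mathsf C^{\mathsf T})}$, $R_1+R_2\le\frac1{2\eta}\log\frac{\det(\mathsf C(\mathsf A\mathsf A^{\mathsf T}+N\mathsf I_\eta)\mathsf C^{\mathsf T})}{\det(N\mathsf C\mathsf C^{\mathsf T})}$; if $\mathsf C\mathsf C^{\mathsf T}$ is singular but $\mathsf C\ne0$, the same with $\mathsf C$ replaced by any nonzero row; if $\mathsf C=0$, $\{(0,0)\}$. Power constraints: let $\mathbb B=\begin{pmatrix}\mathsf B_1&\mathsf B_1\\ \mathsf B_2&\mathsf B_2\end{pmatrix}$,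 $\mathsf A_d=\begin{pmatrix}\mathbf a_1&\mathbf 0\\ \mathbf 0&\mathbf a_2\end{pmatrix}$, $\mathsf B_t=\begin{pmatrix}\mathsf B_1\\ \mathsf B_2\end{pmatrix}$, $\mathsf B_d=\begin{pmatrix}\mathsf B_1&0\\0&\mathsf B_2\end{pmatrix}$, $\mathsf K_W\otimes\mathsf I_\eta=\begin{pmatrix}\sigma_1^2\mathsf I_\eta&\varrho\sigma_1\sigma_2\mathsf I_\eta\\ \varrho\sigma_1\sigma_2\mathsf I_\eta&\sigma_2^2\mathsf I_\eta\end{pmatrix}$, $\Sigma=(\mathsf I_{2\eta}-\mathbb B)^{-1}(\mathsf A_d\mathsf A_d^{\mathsf T}+N\mathsf B_t\mathsf B_t^{\mathsf T}+\mathsf B_d(\mathsf K_W\otimes\mathsf I_\eta)\mathsf B_d^{\mathsf T})(\mathsf I_{2\eta}-\mathbb B)^{-\mathsf T}$; require the trace of the upper-left $\eta\times\eta$ block of $\Sigma$ to be $\le\eta P_1$ and of the lower-right block to be $\le\eta P_2$. $\mathcal R_{\mathrm{SI}}(P_1,P_2,N,\mathsf K_W)$ is the closure of the union of these regions over all $(\eta,\mathbf a_1,\mathbf a_2,\mathsf B_1,\mathsf B_2,\mathsf C)$ satisfying the power constraints. *)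

theory Defs
  imports "HOL-Probability.Probability"
          "Jordan_Normal_Form.Gauss_Jordan_Elimination"
          "Jordan_Normal_Form.Determinant"
begin

definition KW_mat :: "real \<Rightarrow> real \<Rightarrow> real \<Rightarrow> real mat" where
  "KW_mat s1 s2 rho = mat 2 2 (\<lambda>(i,j).
      if i = 0 \<and> j = 0 then s1^2 else if i = 1 \<and> j = 1 then s2^2 else rho * s1 * s2)"

definition psd_mat :: "real mat \<Rightarrow> bool" where
  "psd_mat K \<longleftrightarrow> K \<in> carrier_mat (dim_row K) (dim_row K) \<and> K\<^sup>T = K \<and>
     (\<forall>x \<in> carrier_vec (dim_row K). 0 \<le> x \<bullet> (K *\<^sub>v x))"

text \<open>Per time step we draw three IID standard Gaussians (z, u1, u2).
  Z = sqrt N * z ~ N(0,N); (W1,W2) = L (u1,u2) with L the (lower-triangular)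
  Cholesky factor of K_W, so (W1,W2) is zero-mean Gaussian with covariance K_W.\<close>

definition std_normal_measure :: "real measure" where
  "std_normal_measure = density lborel (\<lambda>x. ennreal (std_normal_density x))"

definition noise_letter :: "(real \<times> real \<times> real) measure" where
  "noise_letter = std_normal_measure \<Otimes>\<^sub>M (std_normal_measure \<Otimes>\<^sub>M std_normal_measure)"

definition noise_space :: "nat \<Rightarrow> (nat \<Rightarrow> real \<times> real \<times> real) measure" where
  "noise_space n = PiM {..<n} (\<lambda>_. noise_letter)"

definition Zs :: "real \<Rightarrow> (nat \<Rightarrow> real \<times> real \<times> real) \<Rightarrow> nat \<Rightarrow> real" where
  "Zs N \<omega> t = sqrt N * fst (\<omega> t)"

definition chol11 :: "real mat \<Rightarrow> real" where
  "chol11 K = sqrt (K $$ (0,0))"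

definition chol21 :: "real mat \<Rightarrow> real" where
  "chol21 K = (if K $$ (0,0) = 0 then 0 else K $$ (1,0) / sqrt (K $$ (0,0)))"

definition chol22 :: "real mat \<Rightarrow> real" where
  "chol22 K = sqrt (K $$ (1,1) - (chol21 K)^2)"

definition W1s :: "real mat \<Rightarrow> (nat \<Rightarrow> real \<times> real \<times> real) \<Rightarrow> nat \<Rightarrow> real" where
  "W1s K \<omega> t = chol11 K * fst (snd (\<omega> t))"

definition W2s :: "real mat \<Rightarrow> (nat \<Rightarrow> real \<times> real \<times> real) \<Rightarrow> nat \<Rightarrow> real" where
  "W2s K \<omega> t = chol21 K * fst (snd (\<omega> t)) + chol22 K * snd (snd (\<omega> t))"

text \<open>An encoder is f t m v: time t, message m, and the past feedback
  v = (V_1,...,V_{t-1}) given as a function on {..<t} (restricted).\<close>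

type_synonym encoder = "nat \<Rightarrow> nat \<Rightarrow> (nat \<Rightarrow> real) \<Rightarrow> real"
type_synonym decoder = "(nat \<Rightarrow> real \<times> real \<times> real) \<Rightarrow> nat \<times> nat"

text \<open>hist ... t s = (X_{1,s}, X_{2,s}) for s < t.\<close>
primrec hist :: "real \<Rightarrow> real mat \<Rightarrow> encoder \<Rightarrow> encoder \<Rightarrow> nat \<Rightarrow> nat \<Rightarrow>
    (nat \<Rightarrow> real \<times> real \<times> real) \<Rightarrow> nat \<Rightarrow> (nat \<Rightarrow> real \<times> real)" where
  "hist N K f1 f2 m1 m2 \<omega> 0 = (\<lambda>_. (0, 0))"
| "hist N K f1 f2 m1 m2 \<omega> (Suc t) =
     (let h = hist N K f1 f2 m1 m2 \<omega> t;
          V1 = (\<lambda>s. fst (h s) + snd (h s) + Zs N \<omega> s + W1s K \<omega> s);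
          V2 = (\<lambda>s. fst (h s) + snd (h s) + Zs N \<omega> s + W2s K \<omega> s)
      in h(t := (f1 t m1 (restrict V1 {..<t}), f2 t m2 (restrict V2 {..<t}))))"

definition chX :: "real \<Rightarrow> real mat \<Rightarrow> encoder \<Rightarrow> encoder \<Rightarrow> nat \<Rightarrow> nat \<Rightarrow>
    (nat \<Rightarrow> real \<times> real \<times> real) \<Rightarrow> nat \<Rightarrow> real \<times> real" where
  "chX N K f1 f2 m1 m2 \<omega> t = hist N K f1 f2 m1 m2 \<omega> (Suc t) t"

definition chY :: "real \<Rightarrow> real mat \<Rightarrow> encoder \<Rightarrow> encoder \<Rightarrow> nat \<Rightarrow> nat \<Rightarrow>
    (nat \<Rightarrow> real \<times> real \<times> real) \<Rightarrow> nat \<Rightarrow> real" where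
  "chY N K f1 f2 m1 m2 \<omega> t =
     fst (chX N K f1 f2 m1 m2 \<omega> t) + snd (chX N K f1 f2 m1 m2 \<omega> t) + Zs N \<omega> t"

text \<open>Message sets are {..<k1} and {..<k2}; messages are uniform, so
  expectations/probabilities are averages over messages of noise integrals.\<close>

definition is_code :: "real \<Rightarrow> real mat \<Rightarrow> real \<Rightarrow> real \<Rightarrow> nat \<Rightarrow> nat \<Rightarrow> nat \<Rightarrow>
    encoder \<Rightarrow> encoder \<Rightarrow> decoder \<Rightarrow> bool" where
  "is_code N K P1 P2 n k1 k2 f1 f2 g \<longleftrightarrow>
     0 < k1 \<and> 0 < k2 \<and>
     (\<forall>t<n. \<forall>m<k1. f1 t m \<in> borel_measurable (PiM {..<t} (\<lambda>_. borel))) \<and>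
     (\<forall>t<n. \<forall>m<k2. f2 t m \<in> borel_measurable (PiM {..<t} (\<lambda>_. borel))) \<and>
     g \<in> measurable (PiM {..<n} (\<lambda>_. borel)) (count_space UNIV) \<and>
     ennreal (1 / real n) * (\<Sum>t<n. ennreal (1 / (real k1 * real k2)) *
        (\<Sum>m1<k1. \<Sum>m2<k2. \<integral>\<^sup>+ \<omega>. ennreal ((fst (chX N K f1 f2 m1 m2 \<omega> t))^2) \<partial>noise_space n))
       \<le> ennreal P1 \<and>
     ennreal (1 / real n) * (\<Sum>t<n. ennreal (1 / (real k1 * real k2)) *
        (\<Sum>m1<k1. \<Sum>m2<k2. \<integral>\<^sup>+ \<omega>. ennreal ((snd (chX N K f1 f2 m1 m2 \<omega> t))^2) \<partial>noise_space n))
       \<le> ennreal P2"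

definition err_prob :: "real \<Rightarrow> real mat \<Rightarrow> nat \<Rightarrow> nat \<Rightarrow> nat \<Rightarrow>
    encoder \<Rightarrow> encoder \<Rightarrow> decoder \<Rightarrow> real" where
  "err_prob N K n k1 k2 f1 f2 g =
     1 / (real k1 * real k2) * (\<Sum>m1<k1. \<Sum>m2<k2.
        measure (noise_space n)
          {\<omega> \<in> space (noise_space n).
             g (restrict (\<lambda>t. (chY N K f1 f2 m1 m2 \<omega> t, W1s K \<omega> t, W2s K \<omega> t)) {..<n})
               \<noteq> (m1, m2)})"

definition achievable :: "real \<Rightarrow> real \<Rightarrow> real \<Rightarrow> real mat \<Rightarrow> real \<Rightarrow> real \<Rightarrow> bool" where
  "achievable P1 P2 N K R1 R2 \<longleftrightarrow>
     (\<forall>\<delta>>0. \<exists>(k1 :: nat \<Rightarrow> nat) (k2 :: nat \<Rightarrow> nat) (f1 :: nat \<Rightarrow> encoder)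
                (f2 :: nat \<Rightarrow> encoder) (g :: nat \<Rightarrow> decoder).
        (\<forall>\<^sub>F n in sequentially.
            is_code N K P1 P2 n (k1 n) (k2 n) (f1 n) (f2 n) (g n) \<and>
            ln (real (k1 n)) / real n > R1 - \<delta> \<and>
            ln (real (k2 n)) / real n > R2 - \<delta>) \<and>
        (\<lambda>n. err_prob N K n (k1 n) (k2 n) (f1 n) (f2 n) (g n)) \<longlonglongrightarrow> 0)"

definition C_NoisyFBSI :: "real \<Rightarrow> real \<Rightarrow> real \<Rightarrow> real mat \<Rightarrow> (real \<times> real) set" where
  "C_NoisyFBSI P1 P2 N K = {(R1, R2). achievable P1 P2 N K R1 R2}"

definition strictly_lower :: "nat \<Rightarrow> real mat \<Rightarrow> bool" where
  "strictly_lower \<eta> B \<longleftrightarrow> B \<in> carrier_mat \<eta> \<eta> \<and> (\<forall>i<\<eta>. \<forall>j<\<eta>. i \<le> j \<longrightarrow> B $$ (i,j) = 0)"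

definition rate_expr :: "real \<Rightarrow> nat \<Rightarrow> real mat \<Rightarrow> real mat \<Rightarrow> real" where
  "rate_expr N \<eta> Ce S =
     ln (det (Ce * (S + N \<cdot>\<^sub>m 1\<^sub>m \<eta>) * Ce\<^sup>T) / det (N \<cdot>\<^sub>m (Ce * Ce\<^sup>T))) / (2 * real \<eta>)"

definition eff_C :: "nat \<Rightarrow> real mat \<Rightarrow> real mat" where
  "eff_C \<eta> C = (if det (C * C\<^sup>T) \<noteq> 0 then C
                 else if row C 0 \<noteq> 0\<^sub>v \<eta> then mat_of_rows \<eta> [row C 0]
                 else mat_of_rows \<eta> [row C 1])"

definition region_params :: "real \<Rightarrow> nat \<Rightarrow> real vec \<Rightarrow> real vec \<Rightarrow> real mat \<Rightarrow> (real \<times> real) set" where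
  "region_params N \<eta> a1 a2 C =
     (if C = 0\<^sub>m 2 \<eta> then {(0, 0)}
      else (let Ce = eff_C \<eta> C;
                A1 = mat_of_cols \<eta> [a1]; A2 = mat_of_cols \<eta> [a2];
                A = mat_of_cols \<eta> [a1, a2]
            in {(R1, R2). 0 \<le> R1 \<and> 0 \<le> R2 \<and>
                  R1 \<le> rate_expr N \<eta> Ce (A1 * A1\<^sup>T) \<and>
                  R2 \<le> rate_expr N \<eta> Ce (A2 * A2\<^sup>T) \<and>
                  R1 + R2 \<le> rate_expr N \<eta> Ce (A * A\<^sup>T)}))"

definition Sigma_mat :: "real \<Rightarrow> real mat \<Rightarrow> nat \<Rightarrow> real vec \<Rightarrow> real vec \<Rightarrow> real mat \<Rightarrow> real mat \<Rightarrow> real mat" where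
  "Sigma_mat N K \<eta> a1 a2 B1 B2 =
     (let BB = four_block_mat B1 B1 B2 B2;
          Ad = four_block_mat (mat_of_cols \<eta> [a1]) (0\<^sub>m \<eta> 1) (0\<^sub>m \<eta> 1) (mat_of_cols \<eta> [a2]);
          Bt = B1 @\<^sub>r B2;
          Bd = four_block_mat B1 (0\<^sub>m \<eta> \<eta>) (0\<^sub>m \<eta> \<eta>) B2;
          KI = four_block_mat (K $$ (0,0) \<cdot>\<^sub>m 1\<^sub>m \<eta>) (K $$ (0,1) \<cdot>\<^sub>m 1\<^sub>m \<eta>)
                              (K $$ (1,0) \<cdot>\<^sub>m 1\<^sub>m \<eta>) (K $$ (1,1) \<cdot>\<^sub>m 1\<^sub>m \<eta>);
          Minv = the (mat_inverse (1\<^sub>m (2 * \<eta>) - BB))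
      in Minv * (Ad * Ad\<^sup>T + N \<cdot>\<^sub>m (Bt * Bt\<^sup>T) + Bd * KI * Bd\<^sup>T) * Minv\<^sup>T)"

definition power_ok :: "real \<Rightarrow> real mat \<Rightarrow> real \<Rightarrow> real \<Rightarrow> nat \<Rightarrow> real vec \<Rightarrow> real vec \<Rightarrow> real mat \<Rightarrow> real mat \<Rightarrow> bool" where
  "power_ok N K P1 P2 \<eta> a1 a2 B1 B2 \<longleftrightarrow>
     (let S = Sigma_mat N K \<eta> a1 a2 B1 B2
      in (\<Sum>i<\<eta>. S $$ (i,i)) \<le> real \<eta> * P1 \<and>
         (\<Sum>i\<in>{\<eta>..<2*\<eta>}. S $$ (i,i)) \<le> real \<eta> * P2)"

definition R_SI :: "real \<Rightarrow> real \<Rightarrow> real \<Rightarrow> real mat \<Rightarrow> (real \<times> real) set" where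
  "R_SI P1 P2 N K = closure (\<Union> {region_params N \<eta> a1 a2 C | \<eta> a1 a2 B1 B2 C.
       0 < \<eta> \<and> a1 \<in> carrier_vec \<eta> \<and> a2 \<in> carrier_vec \<eta> \<and>
       strictly_lower \<eta> B1 \<and> strictly_lower \<eta> B2 \<and> C \<in> carrier_mat 2 \<eta> \<and>
       power_ok N K P1 P2 \<eta> a1 a2 B1 B2})"

end

theory Submission
  imports Defs
begin

text \<open>
  Time is cut into blocks of length \<open>\<eta>\<close>; in each block a transmitter sends \<open>a x + B v\<close>, where \<open>x\<close> is the
  codeword symbol of the block and \<open>v\<close> the past feedback of the block. Knowing the outputs and the
  feedback noise, the receiver subtracts the feedback terms and is left with the memoryless vector channel
  \<open>a1 x1 + a2 x2 + Z\<close>. The matrix \<open>C\<close> is not needed: the rate bounds for \<open>C\<close> are those of the orthogonal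
  projections of \<open>a1\<close>, \<open>a2\<close> to the row space of \<open>C\<close>, and the bounds for \<open>a1\<close>, \<open>a2\<close> themselves are larger.

  The codewords are independent standard Gaussian and decoding is by thresholds. The threshold tests compare
  the Gaussian posterior density of the codeword symbols, given the observation, with the prior density; the
  posterior has total mass one, so a wrong codeword passes a test at level \<open>g\<close> with probability at
  most \<open>exp (- g)\<close>, and no output density is ever needed. For the true codewords the logarithm of the
  ratio is the mutual information per block plus averages of squared unit-variance Gaussian forms, which
  concentrate by a second-moment computation. The same concentration gives the power
  constraint once the codewords are scaled by a factor slightly less than one.
\<close>

unbundle no vec_syntax and no inner_syntax

section \<open>Independent standard Gaussian families\<close>

text \<open>Through the feedback, the input of each transmitter contains the symbols of both
  codewords, so its power involves their empirical correlation as well as their powers. Error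
  probability and squared deviations from the ideal second moments are therefore added and averaged
  over one random pair of codebooks; a pair with a small sum is good for both purposes. Only the
  symbols are scaled, by \<open>sqrt \<tau>\<close>: the noise part of the input power stays what
  the region allows, and the margin gained on the symbol part absorbs the deviations, even if the
  trace condition holds with equality. For two wrong codewords the posterior factors by the chain
  rule: the first codeword given the observation, then the second given both. The sum-rate
  determinant arises as the product of the two factors. Every estimation error, divided by its
  deviation, is a form of norm one in independent standard Gaussians. The feedback noise enters
  through a Cholesky factor, so a singular covariance is treated like any other. There are
  \<open>n div \<eta>\<close> blocks; the silent tail costs only a constant in the
  exponents.\<close>

lemma prob_space_std_normal_measure: "prob_space std_normal_measure"
  unfolding std_normal_measure_def by (rule prob_space_normal_density) simp

lemma sets_std_normal_measure [simp, measurable_cong]: "sets std_normal_measure = sets borel"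
  by (simp add: std_normal_measure_def)

lemma space_std_normal_measure [simp]: "space std_normal_measure = UNIV"
  by (simp add: std_normal_measure_def)

lemma sets_Collect_vimage:
  assumes "f \<in> measurable M N" "A \<in> sets N"
  shows "{p \<in> space M. f p \<in> A} \<in> sets M"
  using measurable_sets[OF assms] by (simp add: vimage_def Int_def conj_commute)

text \<open>Independence and standard normality are encoded together by the probabilities of boxes.
  Boxes factor directly under products and finite powers, so codewords and noise can be merged into
  one family over a sum index type; laws and independence are recovered from this one
  equation.\<close>

definition iid_std :: "'a measure \<Rightarrow> 'i set \<Rightarrow> ('i \<Rightarrow> 'a \<Rightarrow> real) \<Rightarrow> bool" where
  "iid_std M J X \<longleftrightarrow> prob_space M \<and> finite J \<and> (\<forall>j\<in>J. X j \<in> borel_measurable M) \<and>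
     (\<forall>A. (\<forall>j\<in>J. A j \<in> sets borel) \<longrightarrow>
        emeasure M {p \<in> space M. \<forall>j\<in>J. X j p \<in> A j} = (\<Prod>j\<in>J. emeasure std_normal_measure (A j)))"

lemma iid_std_single: "iid_std std_normal_measure {()} (\<lambda>_ x. x)"
  using prob_space_std_normal_measure by (auto simp: iid_std_def)

text \<open>A box over the disjoint sum of the index sets is a rectangle with one box in each
  factor.\<close>

lemma iid_std_pair:
  assumes "iid_std M I X" "iid_std M' J Y"
  shows "iid_std (M \<Otimes>\<^sub>M M') (I <+> J) (\<lambda>k p. case k of Inl i \<Rightarrow> X i (fst p) | Inr j \<Rightarrow> Y j (snd p))"
proof -
  interpret M: prob_space M using assms by (simp add: iid_std_def)
  interpret M': prob_space M' using assms by (simp add: iid_std_def)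
  interpret P: pair_prob_space M M' ..
  have fin: "finite I" "finite J" using assms by (auto simp: iid_std_def)
  have mX [measurable]: "i \<in> I \<Longrightarrow> X i \<in> borel_measurable M" for i
    using assms by (auto simp: iid_std_def)
  have mY [measurable]: "i \<in> J \<Longrightarrow> Y i \<in> borel_measurable M'" for i
    using assms by (auto simp: iid_std_def)
  have box: "emeasure (M \<Otimes>\<^sub>M M')
      {p \<in> space (M \<Otimes>\<^sub>M M'). \<forall>k\<in>I <+> J. (case k of Inl i \<Rightarrow> X i (fst p) | Inr j \<Rightarrow> Y j (snd p)) \<in> A k}
      = (\<Prod>k\<in>I <+> J. emeasure std_normal_measure (A k))"
    if A: "\<forall>k\<in>I <+> J. A k \<in> sets borel" for A :: "_ \<Rightarrow> real set"
  proof -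
    let ?S = "{p \<in> space M. \<forall>i\<in>I. X i p \<in> A (Inl i)}"
    let ?T = "{p \<in> space M'. \<forall>i\<in>J. Y i p \<in> A (Inr i)}"
    have [measurable]: "?S \<in> sets M"
      using fin A by (intro sets.sets_Collect_finite_All sets_Collect_vimage[OF mX]) auto
    have [measurable]: "?T \<in> sets M'"
      using fin A by (intro sets.sets_Collect_finite_All sets_Collect_vimage[OF mY]) auto
    have "{p \<in> space (M \<Otimes>\<^sub>M M'). \<forall>k\<in>I <+> J. (case k of Inl i \<Rightarrow> X i (fst p) | Inr j \<Rightarrow> Y j (snd p)) \<in> A k} = ?S \<times> ?T"
      by (auto simp: space_pair_measure Plus_def ball_Un)
    then have "emeasure (M \<Otimes>\<^sub>M M') {p \<in> space (M \<Otimes>\<^sub>M M'). \<forall>k\<in>I <+> J. (case k of Inl i \<Rightarrow> X i (fst p) | Inr j \<Rightarrow> Y j (snd p)) \<in> A k}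
       = emeasure M ?S * emeasure M' ?T"
      by (simp add: M'.emeasure_pair_measure_Times)
    also have "emeasure M ?S = (\<Prod>i\<in>I. emeasure std_normal_measure (A (Inl i)))"
      using assms(1) A unfolding iid_std_def by (auto elim!: allE[of _ "\<lambda>i. A (Inl i)"])
    also have "emeasure M' ?T = (\<Prod>i\<in>J. emeasure std_normal_measure (A (Inr i)))"
      using assms(2) A unfolding iid_std_def by (auto elim!: allE[of _ "\<lambda>i. A (Inr i)"])
    also have "(\<Prod>i\<in>I. emeasure std_normal_measure (A (Inl i))) * (\<Prod>i\<in>J. emeasure std_normal_measure (A (Inr i)))
       = (\<Prod>k\<in>I <+> J. emeasure std_normal_measure (A k))"
      using fin by (simp add: prod.Plus)
    finally show ?thesis .
  qed
  show ?thesis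
    unfolding iid_std_def using box fin P.prob_space_axioms by (auto intro: measurable_compose[OF measurable_fst mX] measurable_compose[OF measurable_snd mY])
qed

lemma iid_std_PiM:
  assumes "iid_std M J X" "finite I"
  shows "iid_std (PiM I (\<lambda>_. M)) (I \<times> J) (\<lambda>(i, j) \<omega>. X j (\<omega> i))"
proof -
  interpret M: prob_space M using assms by (simp add: iid_std_def)
  interpret P: product_prob_space "\<lambda>_. M" I ..
  have fin: "finite J" using assms by (auto simp: iid_std_def)
  have mX [measurable]: "i \<in> J \<Longrightarrow> X i \<in> borel_measurable M" for i
    using assms by (auto simp: iid_std_def)
  have mc: "i \<in> I \<Longrightarrow> (\<lambda>\<omega>. \<omega> i) \<in> measurable (PiM I (\<lambda>_. M)) M" for i
    by (rule measurable_component_singleton)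
  have box: "emeasure (PiM I (\<lambda>_. M))
      {\<omega> \<in> space (PiM I (\<lambda>_. M)). \<forall>k\<in>I \<times> J. (case k of (i, j) \<Rightarrow> \<lambda>\<omega>. X j (\<omega> i)) \<omega> \<in> A k}
      = (\<Prod>k\<in>I \<times> J. emeasure std_normal_measure (A k))"
    if A: "\<forall>k\<in>I \<times> J. A k \<in> sets borel" for A :: "_ \<Rightarrow> real set"
  proof -
    let ?S = "\<lambda>i. {p \<in> space M. \<forall>j\<in>J. X j p \<in> A (i, j)}"
    have m [measurable]: "?S i \<in> sets M" if "i \<in> I" for i
      using fin A that by (intro sets.sets_Collect_finite_All sets_Collect_vimage[OF mX]) auto
    have "{\<omega> \<in> space (PiM I (\<lambda>_. M)). \<forall>k\<in>I \<times> J. (case k of (i, j) \<Rightarrow> \<lambda>\<omega>. X j (\<omega> i)) \<omega> \<in> A k} = Pi\<^sub>E I ?S"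
      by (auto simp: space_PiM PiE_iff extensional_def)
    then have "emeasure (PiM I (\<lambda>_. M)) {\<omega> \<in> space (PiM I (\<lambda>_. M)). \<forall>k\<in>I \<times> J. (case k of (i, j) \<Rightarrow> \<lambda>\<omega>. X j (\<omega> i)) \<omega> \<in> A k}
       = (\<Prod>i\<in>I. emeasure M (?S i))"
      using m by (simp add: P.emeasure_PiM assms(2))
    also have "\<dots> = (\<Prod>i\<in>I. \<Prod>j\<in>J. emeasure std_normal_measure (A (i, j)))"
    proof (rule prod.cong[OF refl])
      fix i assume "i \<in> I"
      then show "emeasure M (?S i) = (\<Prod>j\<in>J. emeasure std_normal_measure (A (i, j)))"
        using assms(1) A unfolding iid_std_def by (auto elim!: allE[of _ "\<lambda>j. A (i, j)"])
    qed
    also have "\<dots> = (\<Prod>k\<in>I \<times> J. emeasure std_normal_measure (A k))"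
      by (simp add: prod.cartesian_product)
    finally show ?thesis .
  qed
  show ?thesis
    unfolding iid_std_def using box fin assms(2) P.prob_space_axioms
    by (auto intro!: measurable_compose[OF mc mX])
qed

lemma iid_std_distr:
  assumes "iid_std M J X" "j \<in> J"
  shows "distr M borel (X j) = std_normal_measure"
proof (rule measure_eqI)
  interpret M: prob_space M using assms by (simp add: iid_std_def)
  interpret S: prob_space std_normal_measure by (rule prob_space_std_normal_measure)
  fix B :: "real set" assume "B \<in> sets (distr M borel (X j))"
  then have B: "B \<in> sets borel" by simp
  have m: "X j \<in> borel_measurable M" and J: "finite J" using assms by (auto simp: iid_std_def)
  \<comment> \<open>Leaving all other coordinates unrestricted reduces the box equation to the law
    of coordinate \<open>j\<close>.\<close>
  let ?A = "\<lambda>k. if k = j then B else UNIV"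
  have "emeasure (distr M borel (X j)) B = emeasure M {p \<in> space M. \<forall>k\<in>J. X k p \<in> ?A k}"
    using m B assms(2) by (auto simp: emeasure_distr intro!: arg_cong[where f="emeasure M"] split: if_splits)
  also have "\<dots> = (\<Prod>k\<in>J. emeasure std_normal_measure (?A k))"
    using assms(1) B unfolding iid_std_def by (auto elim!: allE[of _ ?A])
  also have "\<dots> = (\<Prod>k\<in>J. if k = j then emeasure std_normal_measure B else 1)"
    using S.emeasure_space_1 by (intro prod.cong) auto
  also have "\<dots> = emeasure std_normal_measure B" using J assms(2) by (simp add: prod.delta)
  finally show "emeasure (distr M borel (X j)) B = emeasure std_normal_measure B" .
qed simp

text \<open>Boxes determine a finite product measure, so the joint law is the product of standard
  normal laws. The empty family is split off because the criterion by joint laws asks for a nonempty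
  index set.\<close>

lemma iid_std_indep_vars:
  assumes "iid_std M J X"
  shows "prob_space.indep_vars M (\<lambda>_. borel) X J"
proof (cases "J = {}")
  case True
  interpret M: prob_space M using assms by (simp add: iid_std_def)
  show ?thesis using True by (simp add: M.indep_vars_def M.indep_sets_def)
next
  case False
  interpret M: prob_space M using assms by (simp add: iid_std_def)
  interpret S: prob_space std_normal_measure by (rule prob_space_std_normal_measure)
  interpret P: product_prob_space "\<lambda>_. std_normal_measure" J ..
  have J: "finite J" and mX: "j \<in> J \<Longrightarrow> X j \<in> borel_measurable M" for j
    using assms by (auto simp: iid_std_def)
  have "distr M (PiM J (\<lambda>_. borel)) (\<lambda>x. \<lambda>i\<in>J. X i x) = PiM J (\<lambda>_. std_normal_measure)"
  proof (rule P.PiM_eqI[OF J])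
    show "sets (distr M (PiM J (\<lambda>_. borel)) (\<lambda>x. \<lambda>i\<in>J. X i x)) = sets (PiM J (\<lambda>_. std_normal_measure))"
      by (auto intro!: sets_PiM_cong)
    fix A assume A: "\<And>i. i \<in> J \<Longrightarrow> A i \<in> sets std_normal_measure"
    have "emeasure (distr M (PiM J (\<lambda>_. borel)) (\<lambda>x. \<lambda>i\<in>J. X i x)) (Pi\<^sub>E J A)
      = emeasure M {p \<in> space M. \<forall>k\<in>J. X k p \<in> A k}"
      using A mX J by (subst emeasure_distr) (auto intro!: measurable_restrict sets_PiM_I_finite arg_cong[where f="emeasure M"])
    then show "emeasure (distr M (PiM J (\<lambda>_. borel)) (\<lambda>x. \<lambda>i\<in>J. X i x)) (Pi\<^sub>E J A) = (\<Prod>i\<in>J. emeasure std_normal_measure (A i))"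
      using assms A unfolding iid_std_def by auto
  qed
  also have "\<dots> = PiM J (\<lambda>i. distr M borel (X i))"
    using assms by (intro PiM_cong) (auto simp: iid_std_distr)
  finally show ?thesis using mX False by (subst M.indep_vars_iff_distr_eq_PiM') auto
qed

lemma iid_std_linear:
  assumes "iid_std M J X" "I \<subseteq> J" "(\<Sum>i\<in>I. (c i)\<^sup>2) = 1"
  shows "distr M borel (\<lambda>p. \<Sum>i\<in>I. c i * X i p) = std_normal_measure"
proof -
  interpret M: prob_space M using assms by (simp add: iid_std_def)
  have J: "finite J" and mX: "j \<in> J \<Longrightarrow> X j \<in> borel_measurable M" for j
    using assms by (auto simp: iid_std_def)
  \<comment> \<open>The sum rule for independent normals asks for positive deviations, so vanishing
    coefficients are dropped; norm one leaves at least one index.\<close>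
  define I' where "I' = {i \<in> I. c i \<noteq> 0}"
  have I': "finite I'" "I' \<subseteq> J" "finite I" using J assms(2) finite_subset[of _ J] by (auto simp: I'_def)
  have s: "(\<Sum>i\<in>I'. (c i)\<^sup>2) = 1"
    unfolding assms(3)[symmetric] using I' by (intro sum.mono_neutral_left) (auto simp: I'_def)
  then have ne: "I' \<noteq> {}" by auto
  have "M.indep_vars (\<lambda>_. borel) X I'"
    by (rule M.indep_vars_subset[OF iid_std_indep_vars[OF assms(1)] I'(2)])
  then have ind: "M.indep_vars (\<lambda>_. borel) (\<lambda>i p. c i * X i p) I'"
    by (rule M.indep_vars_compose2[where Y="\<lambda>i x. c i * x"]) auto
  have "distributed M lborel (\<lambda>p. \<Sum>i\<in>I'. c i * X i p)
     (normal_density (\<Sum>i\<in>I'. 0) (sqrt (\<Sum>i\<in>I'. \<bar>c i\<bar>\<^sup>2)))"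
  proof (rule M.sum_indep_normal[OF I'(1) ne ind])
    fix i assume i: "i \<in> I'"
    show "0 < \<bar>c i\<bar>" using i by (simp add: I'_def)
    have "distributed M lborel (X i) std_normal_density"
      using iid_std_distr[OF assms(1), of i] i I' mX
      by (auto simp: distributed_def std_normal_measure_def cong: distr_cong)
    from M.normal_density_affine[OF this, of "c i" 0]
    show "distributed M lborel (\<lambda>p. c i * X i p) (normal_density 0 \<bar>c i\<bar>)"
      using i by (simp add: I'_def)
  qed
  then have "distributed M lborel (\<lambda>p. \<Sum>i\<in>I'. c i * X i p) std_normal_density"
    using s by simp
  then have "distr M lborel (\<lambda>p. \<Sum>i\<in>I'. c i * X i p) = std_normal_measure"
    by (simp add: distributed_def std_normal_measure_def)
  moreover have "(\<Sum>i\<in>I'. c i * X i p) = (\<Sum>i\<in>I. c i * X i p)" for p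
    using I' by (intro sum.mono_neutral_left) (auto simp: I'_def)
  ultimately show ?thesis by (simp cong: distr_cong)
qed

section \<open>Moments of Gaussian forms\<close>

lemma integrable_std_normal_measure_power: "integrable std_normal_measure (\<lambda>x. x ^ k)"
  unfolding std_normal_measure_def
  by (subst integrable_density) (auto simp: integrable_std_normal_moment)

lemma integral_std_normal_measure_id: "(\<integral>x. x \<partial>std_normal_measure) = 0"
  unfolding std_normal_measure_def using integral_std_normal_moment_odd[of 0]
  by (subst integral_density) auto

lemma integral_std_normal_measure_square: "(\<integral>x. x\<^sup>2 \<partial>std_normal_measure) = 1"
  unfolding std_normal_measure_def using integral_std_normal_moment_even[of 1]
  by (subst integral_density) (auto simp: fact_numeral)

lemma integral_std_normal_measure_fourth: "(\<integral>x. x ^ 4 \<partial>std_normal_measure) = 3"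
  unfolding std_normal_measure_def using integral_std_normal_moment_even[of 2]
  by (subst integral_density) (auto simp: fact_numeral)

lemma integral_std_normal_distributed:
  fixes h :: "real \<Rightarrow> real"
  assumes [measurable]: "X \<in> borel_measurable M" and d: "distr M borel X = std_normal_measure"
    and h: "integrable std_normal_measure h"
  shows "integrable M (\<lambda>p. h (X p))" "(\<integral>p. h (X p) \<partial>M) = (\<integral>x. h x \<partial>std_normal_measure)"
proof -
  have [measurable]: "h \<in> borel_measurable borel"
    using borel_measurable_integrable[OF h] by (simp cong: measurable_cong_sets)
  show "integrable M (\<lambda>p. h (X p))"
    using h unfolding d[symmetric] by (simp add: integrable_distr_eq)
  show "(\<integral>p. h (X p) \<partial>M) = (\<integral>x. h x \<partial>std_normal_measure)"
    unfolding d[symmetric] by (simp add: integral_distr)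
qed

text \<open>The value 2 is \<open>3 - 2 + 1\<close>, from the fourth and second moments.\<close>

lemma centered_square_std_normal:
  "integrable std_normal_measure (\<lambda>x. x\<^sup>2 - 1)"
  "(\<integral>x. (x\<^sup>2 - 1) \<partial>std_normal_measure) = 0"
  "integrable std_normal_measure (\<lambda>x. (x\<^sup>2 - 1)\<^sup>2)"
  "(\<integral>x. (x\<^sup>2 - 1)\<^sup>2 \<partial>std_normal_measure) = 2"
proof -
  interpret S: prob_space std_normal_measure by (rule prob_space_std_normal_measure)
  note [simp] = integrable_std_normal_measure_power integral_std_normal_measure_square integral_std_normal_measure_fourth
  have S1: "measure std_normal_measure UNIV = 1" using S.prob_space by simp
  have eq: "(x\<^sup>2 - 1)\<^sup>2 = x ^ 4 - 2 * x\<^sup>2 + 1" for x :: real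
    by (simp add: power2_eq_square eval_nat_numeral algebra_simps)
  show "integrable std_normal_measure (\<lambda>x. x\<^sup>2 - 1)" by simp
  show "(\<integral>x. (x\<^sup>2 - 1) \<partial>std_normal_measure) = 0" using S1 by simp
  show "integrable std_normal_measure (\<lambda>x. (x\<^sup>2 - 1)\<^sup>2)" unfolding eq by simp
  show "(\<integral>x. (x\<^sup>2 - 1)\<^sup>2 \<partial>std_normal_measure) = 2" unfolding eq using S1 by simp
qed

lemma integral_square_sum_orthogonal:
  fixes Y :: "'i \<Rightarrow> 'a \<Rightarrow> real"
  assumes "finite I"
    and int: "\<And>i j. i \<in> I \<Longrightarrow> j \<in> I \<Longrightarrow> integrable M (\<lambda>p. Y i p * Y j p)"
    and orth: "\<And>i j. i \<in> I \<Longrightarrow> j \<in> I \<Longrightarrow> i \<noteq> j \<Longrightarrow> (\<integral>p. Y i p * Y j p \<partial>M) = 0"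
  shows "integrable M (\<lambda>p. (\<Sum>i\<in>I. Y i p)\<^sup>2)"
    and "(\<integral>p. (\<Sum>i\<in>I. Y i p)\<^sup>2 \<partial>M) = (\<Sum>i\<in>I. \<integral>p. (Y i p)\<^sup>2 \<partial>M)"
proof -
  have eq: "(\<Sum>i\<in>I. Y i p)\<^sup>2 = (\<Sum>i\<in>I. \<Sum>j\<in>I. Y i p * Y j p)" for p
    by (simp add: power2_eq_square sum_product)
  show "integrable M (\<lambda>p. (\<Sum>i\<in>I. Y i p)\<^sup>2)"
    unfolding eq by (intro Bochner_Integration.integrable_sum int)
  have "(\<integral>p. (\<Sum>i\<in>I. Y i p)\<^sup>2 \<partial>M) = (\<Sum>i\<in>I. \<Sum>j\<in>I. \<integral>p. Y i p * Y j p \<partial>M)"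
    unfolding eq by (simp add: int Bochner_Integration.integral_sum)
  also have "\<dots> = (\<Sum>i\<in>I. \<Sum>j\<in>I. if i = j then \<integral>p. (Y i p)\<^sup>2 \<partial>M else 0)"
    by (intro sum.cong refl) (auto simp: orth power2_eq_square)
  finally show "(\<integral>p. (\<Sum>i\<in>I. Y i p)\<^sup>2 \<partial>M) = (\<Sum>i\<in>I. \<integral>p. (Y i p)\<^sup>2 \<partial>M)"
    using assms(1) by simp
qed

lemma (in prob_space) indep_vars_expectation_mult:
  fixes Y :: "'i \<Rightarrow> 'a \<Rightarrow> real"
  assumes "indep_vars (\<lambda>_. borel) Y I" "i \<in> I" "j \<in> I" "i \<noteq> j"
    and "integrable M (Y i)" "integrable M (Y j)"
  shows "integrable M (\<lambda>p. Y i p * Y j p)" "expectation (\<lambda>p. Y i p * Y j p) = expectation (Y i) * expectation (Y j)"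
proof -
  have ind: "indep_vars (\<lambda>_. borel) Y {i, j}"
    by (rule indep_vars_subset[OF assms(1)]) (use assms in auto)
  have int: "\<And>k. k \<in> {i, j} \<Longrightarrow> integrable M (Y k)" using assms by auto
  show "integrable M (\<lambda>p. Y i p * Y j p)"
    using indep_vars_integrable[OF _ ind int] assms(4) by simp
  show "expectation (\<lambda>p. Y i p * Y j p) = expectation (Y i) * expectation (Y j)"
    using indep_vars_lebesgue_integral[OF _ ind int] assms(4) by simp
qed

text \<open>Forms of norm one on disjoint index sets are independent standard normals. Their
  \<open>L\<close> centred squares are orthogonal with second moment 2, so the average has second
  moment \<open>2 / L\<close>. This is the law of large numbers behind every threshold and power
  estimate; the quantitative form can be inserted into averages over codebooks.\<close>

lemma iid_std_square_mean:
  assumes iid: "iid_std M J X" and K: "\<And>b. b < L \<Longrightarrow> K b \<subseteq> J" "disjoint_family_on K {..<L}"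
    and c: "\<And>b. b < L \<Longrightarrow> (\<Sum>i\<in>K b. (c i)\<^sup>2) = 1" and L: "0 < L"
  shows "(\<integral>\<^sup>+p. ennreal (((\<Sum>b<L. (\<Sum>i\<in>K b. c i * X i p)\<^sup>2) / real L - 1)\<^sup>2) \<partial>M) = ennreal (2 / real L)"
proof -
  interpret M: prob_space M using iid by (simp add: iid_std_def)
  have J: "finite J" and mX: "j \<in> J \<Longrightarrow> X j \<in> borel_measurable M" for j
    using iid by (auto simp: iid_std_def)
  define e where "e b p = (\<Sum>i\<in>K b. c i * X i p)" for b p
  define Y where "Y b p = (e b p)\<^sup>2 - 1" for b p
  have me [measurable]: "e b \<in> borel_measurable M" if "b < L" for b
    unfolding e_def using mX K(1)[OF that] by (intro borel_measurable_sum borel_measurable_times) auto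
  have d: "distr M borel (e b) = std_normal_measure" if "b < L" for b
    unfolding e_def by (rule iid_std_linear[OF iid K(1)[OF that] c[OF that]])
  have int: "integrable M (\<lambda>p. h (e b p))" "(\<integral>p. h (e b p) \<partial>M) = (\<integral>x. h x \<partial>std_normal_measure)"
    if "b < L" "integrable std_normal_measure h" for b and h :: "real \<Rightarrow> real"
    using integral_std_normal_distributed[OF me d] that by blast+
  have Y: "integrable M (Y b)" "(\<integral>p. Y b p \<partial>M) = 0" "integrable M (\<lambda>p. (Y b p)\<^sup>2)" "(\<integral>p. (Y b p)\<^sup>2 \<partial>M) = 2"
    if "b < L" for b
    unfolding Y_def
    using int(1)[OF that centered_square_std_normal(1)]
      int(2)[OF that centered_square_std_normal(1), unfolded centered_square_std_normal(2)]
      int(1)[OF that centered_square_std_normal(3)]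
      int(2)[OF that centered_square_std_normal(3), unfolded centered_square_std_normal(4)]
    by - assumption+
  \<comment> \<open>Each form is a function of its own group of coordinates, and grouping along
    disjoint sets preserves independence.\<close>
  have "M.indep_vars (\<lambda>b. PiM (K b) (\<lambda>_. borel)) (\<lambda>b p. restrict (\<lambda>i. X i p) (K b)) {..<L}"
    by (rule M.indep_vars_restrict[OF iid_std_indep_vars[OF iid] _ K(2)]) (use K(1) in auto)
  then have "M.indep_vars (\<lambda>_. borel) (\<lambda>b p. (\<lambda>x. (\<Sum>i\<in>K b. c i * x i)\<^sup>2 - 1) (restrict (\<lambda>i. X i p) (K b))) {..<L}"
    by (rule M.indep_vars_compose2) measurable
  then have ind: "M.indep_vars (\<lambda>_. borel) Y {..<L}"
    by (simp add: Y_def[abs_def] e_def[abs_def] cong: sum.cong)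
  have o1: "integrable M (\<lambda>p. Y i p * Y j p)" if "i \<in> {..<L}" "j \<in> {..<L}" for i j
  proof (cases "i = j")
    case True then show ?thesis using Y(3)[of i] that by (simp add: power2_eq_square)
  next
    case False then show ?thesis using M.indep_vars_expectation_mult(1)[OF ind that False] Y that by auto
  qed
  have o2: "(\<integral>p. Y i p * Y j p \<partial>M) = 0" if "i \<in> {..<L}" "j \<in> {..<L}" "i \<noteq> j" for i j
    using M.indep_vars_expectation_mult(2)[OF ind that] Y that by auto
  have eq: "((\<Sum>b<L. (\<Sum>i\<in>K b. c i * X i p)\<^sup>2) / real L - 1)\<^sup>2 = (\<Sum>b<L. Y b p)\<^sup>2 / (real L)\<^sup>2" for p
  proof -
    have "(\<Sum>b<L. Y b p) = (\<Sum>b<L. (\<Sum>i\<in>K b. c i * X i p)\<^sup>2) - real L"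
      by (simp add: Y_def e_def sum_subtractf)
    moreover have "(\<Sum>b<L. (\<Sum>i\<in>K b. c i * X i p)\<^sup>2) / real L - 1 = ((\<Sum>b<L. (\<Sum>i\<in>K b. c i * X i p)\<^sup>2) - real L) / real L"
      using L by (simp add: diff_divide_distrib)
    ultimately show ?thesis by (simp only: power_divide)
  qed
  have "(\<integral>\<^sup>+p. ennreal ((\<Sum>b<L. Y b p)\<^sup>2 / (real L)\<^sup>2) \<partial>M) = ennreal (\<integral>p. (\<Sum>b<L. Y b p)\<^sup>2 / (real L)\<^sup>2 \<partial>M)"
    using integral_square_sum_orthogonal(1)[of "{..<L}" M Y, OF _ o1 o2]
    by (intro nn_integral_eq_integral) auto
  also have "(\<integral>p. (\<Sum>b<L. Y b p)\<^sup>2 / (real L)\<^sup>2 \<partial>M) = 2 / real L"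
    using integral_square_sum_orthogonal(2)[of "{..<L}" M Y, OF _ o1 o2] Y(4) L
    by (simp add: power2_eq_square)
  finally show ?thesis unfolding eq .
qed

lemma iid_std_affine_second_moment:
  assumes iid: "iid_std M J X" and K: "K \<subseteq> J"
  shows "(\<integral>\<^sup>+p. ennreal ((m + (\<Sum>i\<in>K. c i * X i p))\<^sup>2) \<partial>M) = ennreal (m\<^sup>2 + (\<Sum>i\<in>K. (c i)\<^sup>2))"
proof -
  interpret M: prob_space M using iid by (simp add: iid_std_def)
  have J: "finite J" and mX: "j \<in> J \<Longrightarrow> X j \<in> borel_measurable M" for j
    using iid by (auto simp: iid_std_def)
  have fK: "finite K" using J K finite_subset by auto
  have int: "integrable M (\<lambda>p. h (X i p))" "(\<integral>p. h (X i p) \<partial>M) = (\<integral>x. h x \<partial>std_normal_measure)"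
    if "i \<in> K" "integrable std_normal_measure h" for i and h :: "real \<Rightarrow> real"
    using integral_std_normal_distributed[OF mX iid_std_distr[OF iid]] that K by blast+
  have i1: "integrable M (X i)" "(\<integral>p. X i p \<partial>M) = 0" "integrable M (\<lambda>p. (X i p)\<^sup>2)" "(\<integral>p. (X i p)\<^sup>2 \<partial>M) = 1"
    if "i \<in> K" for i
    using int[OF that, of "\<lambda>x. x"] int[OF that, of "\<lambda>x. x\<^sup>2"] integrable_std_normal_measure_power[of 1]
      integrable_std_normal_measure_power[of 2] integral_std_normal_measure_id integral_std_normal_measure_square by auto
  have ind: "M.indep_vars (\<lambda>_. borel) X K"
    by (rule M.indep_vars_subset[OF iid_std_indep_vars[OF iid] K])
  \<comment> \<open>The constant \<open>m\<close> joins the family as an extra member with index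
    \<open>None\<close>. It is orthogonal to the others because they have mean zero, so Pythagoras
    covers the affine case.\<close>
  define Y where "Y i p = (case i of None \<Rightarrow> m | Some j \<Rightarrow> c j * X j p)" for i p
  let ?I = "insert None (Some ` K)"
  have ii: "integrable M (\<lambda>p. X i p * X j p)" if "i \<in> K" "j \<in> K" for i j
  proof (cases "i = j")
    case True then show ?thesis using i1(3)[of i] that by (simp add: power2_eq_square)
  next
    case False then show ?thesis using M.indep_vars_expectation_mult(1)[OF ind that False] i1 that by auto
  qed
  have ij: "(\<integral>p. X i p * X j p \<partial>M) = 0" if "i \<in> K" "j \<in> K" "i \<noteq> j" for i j
    using M.indep_vars_expectation_mult(2)[OF ind that] i1 that by auto
  have cc: "c i * x * (c j * y) = (c i * c j) * (x * y)" for i j and x y :: real by simp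
  have o1: "integrable M (\<lambda>p. Y i p * Y j p)" if "i \<in> ?I" "j \<in> ?I" for i j
    using that i1 ii by (auto simp: Y_def cc simp del: mult.assoc)
  have o2: "(\<integral>p. Y i p * Y j p \<partial>M) = 0" if "i \<in> ?I" "j \<in> ?I" "i \<noteq> j" for i j
    using that i1 ij ii by (cases i; cases j) (auto simp: Y_def cc simp del: mult.assoc)
  have eq: "m + (\<Sum>i\<in>K. c i * X i p) = (\<Sum>i\<in>?I. Y i p)" for p
    using fK by (simp add: Y_def sum.reindex)
  have "(\<integral>\<^sup>+p. ennreal ((\<Sum>i\<in>?I. Y i p)\<^sup>2) \<partial>M) = ennreal (\<integral>p. (\<Sum>i\<in>?I. Y i p)\<^sup>2 \<partial>M)"
    using integral_square_sum_orthogonal(1)[of ?I M Y, OF _ o1 o2] fK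
    by (intro nn_integral_eq_integral) auto
  also have "(\<integral>p. (\<Sum>i\<in>?I. Y i p)\<^sup>2 \<partial>M) = (\<Sum>i\<in>?I. \<integral>p. (Y i p)\<^sup>2 \<partial>M)"
    using integral_square_sum_orthogonal(2)[of ?I M Y, OF _ o1 o2] fK by blast
  also have "\<dots> = m\<^sup>2 + (\<Sum>i\<in>K. (c i)\<^sup>2)"
    using fK i1 by (simp add: Y_def sum.reindex power_mult_distrib M.prob_space)
  finally show ?thesis unfolding eq .
qed

section \<open>Random coding for a two-user channel\<close>

lemma nn_integral_PiM_component:
  assumes "\<And>i. i \<in> I \<Longrightarrow> prob_space (M i)" "m \<in> I" and [measurable]: "f \<in> borel_measurable (M m)"
  shows "(\<integral>\<^sup>+c. f (c m) \<partial>PiM I M) = (\<integral>\<^sup>+x. f x \<partial>M m)"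
proof -
  have "(\<integral>\<^sup>+x. f x \<partial>M m) = (\<integral>\<^sup>+x. f x \<partial>distr (PiM I M) (M m) (\<lambda>c. c m))"
    using assms by (subst distr_PiM_component) auto
  also have "\<dots> = (\<integral>\<^sup>+c. f (c m) \<partial>PiM I M)"
    using assms(2) by (intro nn_integral_distr) auto
  finally show ?thesis by simp
qed

text \<open>Distinct entries of a random codebook are independent; this is what separates a wrong
  codeword from the observation caused by the true one.\<close>

lemma nn_integral_PiM_two_components:
  assumes M: "prob_space M" and I: "finite I" "m \<in> I" "m' \<in> I" "m \<noteq> m'"
    and f [measurable]: "f \<in> borel_measurable (M \<Otimes>\<^sub>M M)"
  shows "(\<integral>\<^sup>+c. f (c m, c m') \<partial>PiM I (\<lambda>_. M)) = (\<integral>\<^sup>+x. \<integral>\<^sup>+x'. f (x, x') \<partial>M \<partial>M)"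
proof -
  interpret M: prob_space M by fact
  interpret P: product_prob_space "\<lambda>_. M" I ..
  define I' where "I' = I - {m'}"
  have I': "finite I'" "m' \<notin> I'" "I = insert m' I'" "m \<in> I'" using I by (auto simp: I'_def)
  have [measurable]: "(\<lambda>c. c m) \<in> measurable (PiM (insert m' I') (\<lambda>_. M)) M"
      "(\<lambda>c. c m') \<in> measurable (PiM (insert m' I') (\<lambda>_. M)) M"
    using I' by (auto intro!: measurable_component_singleton)
  have "(\<integral>\<^sup>+c. f (c m, c m') \<partial>PiM I (\<lambda>_. M)) = (\<integral>\<^sup>+c. \<integral>\<^sup>+x'. f ((c(m' := x')) m, (c(m' := x')) m') \<partial>M \<partial>PiM I' (\<lambda>_. M))"
    unfolding I'(3) using I' by (subst P.product_nn_integral_insert) auto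
  also have "\<dots> = (\<integral>\<^sup>+c. (\<lambda>x. \<integral>\<^sup>+x'. f (x, x') \<partial>M) (c m) \<partial>PiM I' (\<lambda>_. M))"
    using I by simp
  also have "\<dots> = (\<integral>\<^sup>+x. \<integral>\<^sup>+x'. f (x, x') \<partial>M \<partial>M)"
    using I' by (intro nn_integral_PiM_component) (auto simp: M)
  finally show ?thesis .
qed

text \<open>Moves the noise integral outermost, so that codewords can be averaged with the noise
  frozen.\<close>

lemma nn_integral_rotate3:
  assumes "sigma_finite_measure A" "sigma_finite_measure B" "sigma_finite_measure C"
    and f [measurable]: "f \<in> borel_measurable (A \<Otimes>\<^sub>M (B \<Otimes>\<^sub>M C))"
  shows "(\<integral>\<^sup>+a. \<integral>\<^sup>+b. \<integral>\<^sup>+c. f (a, b, c) \<partial>C \<partial>B \<partial>A) = (\<integral>\<^sup>+c. \<integral>\<^sup>+a. \<integral>\<^sup>+b. f (a, b, c) \<partial>B \<partial>A \<partial>C)"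
proof -
  interpret A: sigma_finite_measure A by fact
  interpret B: sigma_finite_measure B by fact
  interpret C: sigma_finite_measure C by fact
  interpret BC: pair_sigma_finite B C ..
  interpret AC: pair_sigma_finite A C ..
  have "(\<integral>\<^sup>+a. \<integral>\<^sup>+b. \<integral>\<^sup>+c. f (a, b, c) \<partial>C \<partial>B \<partial>A) = (\<integral>\<^sup>+a. \<integral>\<^sup>+c. \<integral>\<^sup>+b. f (a, b, c) \<partial>B \<partial>C \<partial>A)"
    by (intro nn_integral_cong BC.Fubini'[symmetric]) measurable
  also have "\<dots> = (\<integral>\<^sup>+c. \<integral>\<^sup>+a. \<integral>\<^sup>+b. f (a, b, c) \<partial>B \<partial>A \<partial>C)"
    by (intro AC.Fubini'[symmetric]) measurable
  finally show ?thesis .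
qed

lemma nn_integral_double_sum:
  assumes "\<And>i j. i \<in> I \<Longrightarrow> j \<in> J \<Longrightarrow> f i j \<in> borel_measurable M"
  shows "(\<integral>\<^sup>+x. (\<Sum>i\<in>I. \<Sum>j\<in>J. f i j x) \<partial>M) = (\<Sum>i\<in>I. \<Sum>j\<in>J. integral\<^sup>N M (f i j))"
  using assms by (subst nn_integral_sum) (auto intro!: borel_measurable_sum sum.cong nn_integral_sum)

lemma nn_integral_pair3:
  assumes "sigma_finite_measure B" "sigma_finite_measure C"
    and f [measurable]: "f \<in> borel_measurable (A \<Otimes>\<^sub>M (B \<Otimes>\<^sub>M C))"
  shows "integral\<^sup>N (A \<Otimes>\<^sub>M (B \<Otimes>\<^sub>M C)) f = (\<integral>\<^sup>+a. \<integral>\<^sup>+b. \<integral>\<^sup>+c. f (a, b, c) \<partial>C \<partial>B \<partial>A)"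
proof -
  interpret B: sigma_finite_measure B by fact
  interpret C: sigma_finite_measure C by fact
  interpret BC: pair_sigma_finite B C ..
  have "integral\<^sup>N (A \<Otimes>\<^sub>M (B \<Otimes>\<^sub>M C)) f = (\<integral>\<^sup>+a. \<integral>\<^sup>+p. f (a, p) \<partial>(B \<Otimes>\<^sub>M C) \<partial>A)"
    by (rule BC.nn_integral_fst[symmetric]) measurable
  also have "\<dots> = (\<integral>\<^sup>+a. \<integral>\<^sup>+b. \<integral>\<^sup>+c. f (a, b, c) \<partial>C \<partial>B \<partial>A)"
    by (intro nn_integral_cong C.nn_integral_fst[symmetric]) measurable
  finally show ?thesis .
qed

section \<open>The union bound over random codebooks\<close>

lemma (in prob_space) nn_integral_le_const:
  assumes "\<And>x. x \<in> space M \<Longrightarrow> f x \<le> K"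
  shows "(\<integral>\<^sup>+x. f x \<partial>M) \<le> K"
proof -
  have "(\<integral>\<^sup>+x. f x \<partial>M) \<le> (\<integral>\<^sup>+x. K \<partial>M)" by (intro nn_integral_mono assms)
  then show ?thesis by (simp add: emeasure_space_1)
qed

text \<open>The derandomisation step: it extracts concrete codebooks from a bound on the random
  average.\<close>

lemma (in prob_space) exists_less_nn_integral:
  assumes "(\<integral>\<^sup>+x. f x \<partial>M) < e"
  shows "\<exists>x\<in>space M. f x < e"
proof (rule ccontr)
  assume "\<not> ?thesis"
  then have "(\<integral>\<^sup>+x. e \<partial>M) \<le> (\<integral>\<^sup>+x. f x \<partial>M)" by (intro nn_integral_mono) (auto simp: not_less)
  then show False using assms by (simp add: emeasure_space_1)
qed

text \<open>Uniqueness of the passing pair is built in, so at most one message pair decodes and a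
  decoder can be given by a definite description.\<close>

definition decodes :: "('a \<times> 'b \<times> 'y \<Rightarrow> bool) \<Rightarrow> nat \<Rightarrow> nat \<Rightarrow> (nat \<Rightarrow> 'a) \<Rightarrow> (nat \<Rightarrow> 'b) \<Rightarrow> 'y \<Rightarrow> nat \<Rightarrow> nat \<Rightarrow> bool" where
  "decodes A k1 k2 c1 c2 y m1 m2 \<longleftrightarrow> A (c1 m1, c2 m2, y) \<and>
     (\<forall>m1'<k1. \<forall>m2'<k2. (m1', m2') \<noteq> (m1, m2) \<longrightarrow> \<not> A (c1 m1', c2 m2', y))"

text \<open>Decoding fails in four ways: the true pair fails the test, or a pair wrong in its first,
  second or both entries passes. The bounds \<open>e1\<close>, \<open>e2\<close>, \<open>e12\<close>
  are uniform in the observation, so independence of wrong codewords from the observation enters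
  only through the order of integration. The cost \<open>c\<close> is part of the same average, so
  one pair of codebooks controls error and cost together.\<close>

lemma random_coding_MAC:
  fixes Y :: "'a \<times> 'b \<times> 'w \<Rightarrow> 'y" and c :: "'a \<times> 'b \<Rightarrow> ennreal"
  assumes M1: "prob_space M1" and M2: "prob_space M2" and Om: "prob_space \<Omega>"
    and Y [measurable]: "Y \<in> measurable (M1 \<Otimes>\<^sub>M (M2 \<Otimes>\<^sub>M \<Omega>)) MY"
    and A [measurable]: "Measurable.pred (M1 \<Otimes>\<^sub>M (M2 \<Otimes>\<^sub>M MY)) A"
    and c [measurable]: "c \<in> borel_measurable (M1 \<Otimes>\<^sub>M M2)"
    and e0: "(\<integral>\<^sup>+x1. \<integral>\<^sup>+x2. \<integral>\<^sup>+w. indicator {w. \<not> A (x1, x2, Y (x1, x2, w))} w \<partial>\<Omega> \<partial>M2 \<partial>M1) \<le> e0"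
    and e1: "\<And>x2 y. x2 \<in> space M2 \<Longrightarrow> y \<in> space MY \<Longrightarrow> (\<integral>\<^sup>+x1. indicator {x1. A (x1, x2, y)} x1 \<partial>M1) \<le> e1"
    and e2: "\<And>x1 y. x1 \<in> space M1 \<Longrightarrow> y \<in> space MY \<Longrightarrow> (\<integral>\<^sup>+x2. indicator {x2. A (x1, x2, y)} x2 \<partial>M2) \<le> e2"
    and e12: "\<And>y. y \<in> space MY \<Longrightarrow> (\<integral>\<^sup>+x1. \<integral>\<^sup>+x2. indicator {x2. A (x1, x2, y)} x2 \<partial>M2 \<partial>M1) \<le> e12"
    and ec: "(\<integral>\<^sup>+x1. \<integral>\<^sup>+x2. c (x1, x2) \<partial>M2 \<partial>M1) \<le> ec"
    and k: "0 < k1" "0 < k2"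
    and less: "e0 + of_nat (k1 - 1) * e1 + of_nat (k2 - 1) * e2 + of_nat ((k1 - 1) * (k2 - 1)) * e12 + ec < e"
  shows "\<exists>c1 c2. (\<forall>m<k1. c1 m \<in> space M1) \<and> (\<forall>m<k2. c2 m \<in> space M2) \<and>
    ennreal (1 / (real k1 * real k2)) * (\<Sum>m1<k1. \<Sum>m2<k2.
       emeasure \<Omega> {w \<in> space \<Omega>. \<not> decodes A k1 k2 c1 c2 (Y (c1 m1, c2 m2, w)) m1 m2} + c (c1 m1, c2 m2)) < e"
proof -
  interpret M1: prob_space M1 by fact
  interpret M2: prob_space M2 by fact
  interpret Om: prob_space \<Omega> by fact
  define C1 where "C1 = PiM {..<k1} (\<lambda>_. M1)"
  define C2 where "C2 = PiM {..<k2} (\<lambda>_. M2)"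
  interpret C1: prob_space C1 unfolding C1_def by (rule prob_space_PiM) (rule M1)
  interpret C2: prob_space C2 unfolding C2_def by (rule prob_space_PiM) (rule M2)
  have mc1 [measurable]: "m < k1 \<Longrightarrow> (\<lambda>c. c m) \<in> measurable C1 M1" for m
    unfolding C1_def by (rule measurable_component_singleton) simp
  have mc2 [measurable]: "m < k2 \<Longrightarrow> (\<lambda>c. c m) \<in> measurable C2 M2" for m
    unfolding C2_def by (rule measurable_component_singleton) simp
  have sp1: "c1 \<in> space C1 \<Longrightarrow> m < k1 \<Longrightarrow> c1 m \<in> space M1" for c1 m
    using measurable_space[OF mc1] by auto
  have sp2: "c2 \<in> space C2 \<Longrightarrow> m < k2 \<Longrightarrow> c2 m \<in> space M2" for c2 m
    using measurable_space[OF mc2] by auto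
  have C1_1: "(\<integral>\<^sup>+c. f (c m) \<partial>C1) = (\<integral>\<^sup>+x. f x \<partial>M1)" if "m < k1" "f \<in> borel_measurable M1" for f m
    unfolding C1_def using that M1 by (intro nn_integral_PiM_component[where M="\<lambda>_. M1"]) auto
  have C2_1: "(\<integral>\<^sup>+c. f (c m) \<partial>C2) = (\<integral>\<^sup>+x. f x \<partial>M2)" if "m < k2" "f \<in> borel_measurable M2" for f m
    unfolding C2_def using that M2 by (intro nn_integral_PiM_component[where M="\<lambda>_. M2"]) auto
  have C1_2: "(\<integral>\<^sup>+c. f (c m, c m') \<partial>C1) = (\<integral>\<^sup>+x. \<integral>\<^sup>+x'. f (x, x') \<partial>M1 \<partial>M1)"
    if "m < k1" "m' < k1" "m \<noteq> m'" "f \<in> borel_measurable (M1 \<Otimes>\<^sub>M M1)" for f m m'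
    unfolding C1_def using that M1 by (intro nn_integral_PiM_two_components) auto
  have C2_2: "(\<integral>\<^sup>+c. f (c m, c m') \<partial>C2) = (\<integral>\<^sup>+x. \<integral>\<^sup>+x'. f (x, x') \<partial>M2 \<partial>M2)"
    if "m < k2" "m' < k2" "m \<noteq> m'" "f \<in> borel_measurable (M2 \<Otimes>\<^sub>M M2)" for f m m'
    unfolding C2_def using that M2 by (intro nn_integral_PiM_two_components) auto
  define S where "S = e0 + of_nat (k1 - 1) * e1 + of_nat (k2 - 1) * e2 + of_nat ((k1 - 1) * (k2 - 1)) * e12 + ec"
  define I where "I m1 m2 m1' m2' c1 c2 w =
      (indicator {w. A (c1 m1', c2 m2', Y (c1 m1, c2 m2, w))} w :: ennreal)" for m1 m2 m1' m2' :: nat and c1 c2 w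
  define I0 where "I0 m1 m2 c1 c2 w =
      (indicator {w. \<not> A (c1 m1, c2 m2, Y (c1 m1, c2 m2, w))} w :: ennreal)" for m1 m2 :: nat and c1 c2 w
  \<comment> \<open>Pointwise majorant of the failure indicator plus cost, with wrong pairs sorted
    by the entry that is wrong.\<close>
  define F where "F m1 m2 c1 c2 w = I0 m1 m2 c1 c2 w + (\<Sum>m1'\<in>{..<k1}-{m1}. I m1 m2 m1' m2 c1 c2 w)
       + (\<Sum>m2'\<in>{..<k2}-{m2}. I m1 m2 m1 m2' c1 c2 w)
       + (\<Sum>m1'\<in>{..<k1}-{m1}. \<Sum>m2'\<in>{..<k2}-{m2}. I m1 m2 m1' m2' c1 c2 w) + c (c1 m1, c2 m2)" for m1 m2 :: nat and c1 c2 w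
  have mI [measurable]: "(\<lambda>(c1, c2, w). I m1 m2 m1' m2' c1 c2 w) \<in> borel_measurable (C1 \<Otimes>\<^sub>M (C2 \<Otimes>\<^sub>M \<Omega>))"
    if "m1 < k1" "m1' < k1" "m2 < k2" "m2' < k2" for m1 m2 m1' m2'
    using that unfolding I_def indicator_def by (simp add: split_beta') measurable
  have mI0 [measurable]: "(\<lambda>(c1, c2, w). I0 m1 m2 c1 c2 w) \<in> borel_measurable (C1 \<Otimes>\<^sub>M (C2 \<Otimes>\<^sub>M \<Omega>))"
    if "m1 < k1" "m2 < k2" for m1 m2
    using that unfolding I0_def indicator_def by (simp add: split_beta') measurable
  \<comment> \<open>The observation depends on the true codewords and on \<open>w\<close> only; with
    \<open>w\<close> outermost, the wrong entries can be averaged while the observation is held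
    fixed.\<close>
  have IB: "(\<integral>\<^sup>+c1. \<integral>\<^sup>+c2. \<integral>\<^sup>+w. I m1 m2 m1' m2' c1 c2 w \<partial>\<Omega> \<partial>C2 \<partial>C1)
      = (\<integral>\<^sup>+w. \<integral>\<^sup>+c1. \<integral>\<^sup>+c2. I m1 m2 m1' m2' c1 c2 w \<partial>C2 \<partial>C1 \<partial>\<Omega>)"
    if "m1 < k1" "m1' < k1" "m2 < k2" "m2' < k2" for m1 m2 m1' m2'
    using nn_integral_rotate3[OF _ _ _ mI[OF that]] by (simp add: C1.sigma_finite_measure_axioms C2.sigma_finite_measure_axioms Om.sigma_finite_measure_axioms)
  interpret C12: pair_sigma_finite C1 C2 ..
  interpret M12: pair_sigma_finite M1 M2 ..
  have b0: "(\<integral>\<^sup>+c1. \<integral>\<^sup>+c2. \<integral>\<^sup>+w. I0 m1 m2 c1 c2 w \<partial>\<Omega> \<partial>C2 \<partial>C1) \<le> e0" if m: "m1 < k1" "m2 < k2" for m1 m2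
  proof -
    have "(\<integral>\<^sup>+c1. \<integral>\<^sup>+c2. \<integral>\<^sup>+w. I0 m1 m2 c1 c2 w \<partial>\<Omega> \<partial>C2 \<partial>C1)
       = (\<integral>\<^sup>+c1. \<integral>\<^sup>+x2. \<integral>\<^sup>+w. indicator {w. \<not> A (c1 m1, x2, Y (c1 m1, x2, w))} w \<partial>\<Omega> \<partial>M2 \<partial>C1)"
      unfolding I0_def using m sp1
      by (intro nn_integral_cong C2_1[OF m(2)]) (unfold indicator_def, simp, measurable)
    also have "\<dots> = (\<integral>\<^sup>+x1. \<integral>\<^sup>+x2. \<integral>\<^sup>+w. indicator {w. \<not> A (x1, x2, Y (x1, x2, w))} w \<partial>\<Omega> \<partial>M2 \<partial>M1)"
      by (intro C1_1[OF m(1)]) (unfold indicator_def, simp, measurable)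
    finally show ?thesis using e0 by simp
  qed
  have bc: "(\<integral>\<^sup>+c1. \<integral>\<^sup>+c2. c (c1 m1, c2 m2) \<partial>C2 \<partial>C1) \<le> ec" if m: "m1 < k1" "m2 < k2" for m1 m2
  proof -
    have "(\<integral>\<^sup>+c1. \<integral>\<^sup>+c2. c (c1 m1, c2 m2) \<partial>C2 \<partial>C1) = (\<integral>\<^sup>+c1. \<integral>\<^sup>+x2. c (c1 m1, x2) \<partial>M2 \<partial>C1)"
      using m sp1 by (intro nn_integral_cong C2_1[OF m(2)]) measurable
    also have "\<dots> = (\<integral>\<^sup>+x1. \<integral>\<^sup>+x2. c (x1, x2) \<partial>M2 \<partial>M1)"
      by (intro C1_1[OF m(1)]) measurable
    finally show ?thesis using ec by simp
  qed
  have spY: "Y (x1, x2, w) \<in> space MY" if "x1 \<in> space M1" "x2 \<in> space M2" "w \<in> space \<Omega>" for x1 x2 w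
    using measurable_space[OF Y] that by (auto simp: space_pair_measure)
  note le_Om = Om.nn_integral_le_const and le_C1 = C1.nn_integral_le_const and le_C2 = C2.nn_integral_le_const
    and le_M1 = M1.nn_integral_le_const and le_M2 = M2.nn_integral_le_const
  \<comment> \<open>For a wrong first entry the first codebook is integrated innermost:
    \<open>c2 m2\<close> occurs both in the observation and in the tested pair and has to be frozen
    before \<open>e1\<close> applies to the entry \<open>m1'\<close>.\<close>
  have b1: "(\<integral>\<^sup>+c1. \<integral>\<^sup>+c2. \<integral>\<^sup>+w. I m1 m2 m1' m2 c1 c2 w \<partial>\<Omega> \<partial>C2 \<partial>C1) \<le> e1"
    if m: "m1 < k1" "m2 < k2" "m1' < k1" "m1' \<noteq> m1" for m1 m2 m1'
  proof -
    have "(\<integral>\<^sup>+c1. \<integral>\<^sup>+c2. I m1 m2 m1' m2 c1 c2 w \<partial>C2 \<partial>C1) \<le> e1" if w: "w \<in> space \<Omega>" for w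
    proof -
      have "(\<integral>\<^sup>+c1. \<integral>\<^sup>+c2. I m1 m2 m1' m2 c1 c2 w \<partial>C2 \<partial>C1) = (\<integral>\<^sup>+c2. \<integral>\<^sup>+c1. I m1 m2 m1' m2 c1 c2 w \<partial>C1 \<partial>C2)"
        using m w by (intro C12.Fubini'[symmetric]) (unfold I_def indicator_def, simp, measurable)
      also have "\<dots> \<le> e1"
      proof (rule le_C2)
        fix c2 assume c2: "c2 \<in> space C2"
        have "(\<integral>\<^sup>+c1. I m1 m2 m1' m2 c1 c2 w \<partial>C1)
           = (\<integral>\<^sup>+c1. (\<lambda>(x, x'). indicator {x'. A (x', c2 m2, Y (x, c2 m2, w))} x') (c1 m1, c1 m1') \<partial>C1)"
          unfolding I_def by (simp add: indicator_def)
        also have "\<dots> = (\<integral>\<^sup>+x. \<integral>\<^sup>+x'. (\<lambda>(x, x'). indicator {x'. A (x', c2 m2, Y (x, c2 m2, w))} x') (x, x') \<partial>M1 \<partial>M1)"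
          using m sp2[OF c2 m(2)] w by (intro C1_2) (auto simp: indicator_def split_beta')
        also have "\<dots> \<le> e1"
          using sp2[OF c2 m(2)] w spY by (intro le_M1[of "\<lambda>x. \<integral>\<^sup>+x'. g x x' \<partial>M1" for g]) (auto intro!: e1)
        finally show "(\<integral>\<^sup>+c1. I m1 m2 m1' m2 c1 c2 w \<partial>C1) \<le> e1" .
      qed
      finally show ?thesis .
    qed
    then show ?thesis using IB[OF m(1,3,2,2)] le_Om by simp
  qed
  have b2: "(\<integral>\<^sup>+c1. \<integral>\<^sup>+c2. \<integral>\<^sup>+w. I m1 m2 m1 m2' c1 c2 w \<partial>\<Omega> \<partial>C2 \<partial>C1) \<le> e2"
    if m: "m1 < k1" "m2 < k2" "m2' < k2" "m2' \<noteq> m2" for m1 m2 m2'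
  proof -
    have "(\<integral>\<^sup>+c1. \<integral>\<^sup>+c2. I m1 m2 m1 m2' c1 c2 w \<partial>C2 \<partial>C1) \<le> e2" if w: "w \<in> space \<Omega>" for w
    proof (rule le_C1)
      fix c1 assume c1: "c1 \<in> space C1"
      have "(\<integral>\<^sup>+c2. I m1 m2 m1 m2' c1 c2 w \<partial>C2)
         = (\<integral>\<^sup>+c2. (\<lambda>(x, x'). indicator {x'. A (c1 m1, x', Y (c1 m1, x, w))} x') (c2 m2, c2 m2') \<partial>C2)"
        unfolding I_def by (simp add: indicator_def)
      also have "\<dots> = (\<integral>\<^sup>+x. \<integral>\<^sup>+x'. (\<lambda>(x, x'). indicator {x'. A (c1 m1, x', Y (c1 m1, x, w))} x') (x, x') \<partial>M2 \<partial>M2)"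
        using m sp1[OF c1 m(1)] w by (intro C2_2) (auto simp: indicator_def split_beta')
      also have "\<dots> \<le> e2"
        using sp1[OF c1 m(1)] w spY by (intro le_M2[of "\<lambda>x. \<integral>\<^sup>+x'. g x x' \<partial>M2" for g]) (auto intro!: e2)
      finally show "(\<integral>\<^sup>+c2. I m1 m2 m1 m2' c1 c2 w \<partial>C2) \<le> e2" .
    qed
    then show ?thesis using IB[OF m(1,1,2,3)] le_Om by simp
  qed
  have b12: "(\<integral>\<^sup>+c1. \<integral>\<^sup>+c2. \<integral>\<^sup>+w. I m1 m2 m1' m2' c1 c2 w \<partial>\<Omega> \<partial>C2 \<partial>C1) \<le> e12"
    if m: "m1 < k1" "m2 < k2" "m1' < k1" "m1' \<noteq> m1" "m2' < k2" "m2' \<noteq> m2" for m1 m2 m1' m2'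
  proof -
    have "(\<integral>\<^sup>+c1. \<integral>\<^sup>+c2. I m1 m2 m1' m2' c1 c2 w \<partial>C2 \<partial>C1) \<le> e12" if w: "w \<in> space \<Omega>" for w
    proof -
      \<comment> \<open>With both entries wrong, two coordinates of each codebook occur. The two
        from the second codebook are integrated first, which leaves a function of the two from the
        first.\<close>
      define G where "G = (\<lambda>(x1, x1'). \<integral>\<^sup>+x2. \<integral>\<^sup>+x2'. (indicator {x2'. A (x1', x2', Y (x1, x2, w))} x2' :: ennreal) \<partial>M2 \<partial>M2)"
      have mG [measurable]: "G \<in> borel_measurable (M1 \<Otimes>\<^sub>M M1)"
        using w unfolding G_def indicator_def by (simp add: split_beta') measurable
      have "(\<integral>\<^sup>+c1. \<integral>\<^sup>+c2. I m1 m2 m1' m2' c1 c2 w \<partial>C2 \<partial>C1) = (\<integral>\<^sup>+c1. G (c1 m1, c1 m1') \<partial>C1)"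
      proof (rule nn_integral_cong)
        fix c1 assume c1: "c1 \<in> space C1"
        have "(\<integral>\<^sup>+c2. I m1 m2 m1' m2' c1 c2 w \<partial>C2)
           = (\<integral>\<^sup>+c2. (\<lambda>(x, x'). indicator {x'. A (c1 m1', x', Y (c1 m1, x, w))} x') (c2 m2, c2 m2') \<partial>C2)"
          unfolding I_def by (simp add: indicator_def)
        also have "\<dots> = (\<integral>\<^sup>+x. \<integral>\<^sup>+x'. (\<lambda>(x, x'). indicator {x'. A (c1 m1', x', Y (c1 m1, x, w))} x') (x, x') \<partial>M2 \<partial>M2)"
          using m sp1[OF c1 m(1)] sp1[OF c1 m(3)] w by (intro C2_2) (auto simp: indicator_def split_beta')
        finally show "(\<integral>\<^sup>+c2. I m1 m2 m1' m2' c1 c2 w \<partial>C2) = G (c1 m1, c1 m1')" by (simp add: G_def)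
      qed
      also have "\<dots> = (\<integral>\<^sup>+x1. \<integral>\<^sup>+x1'. G (x1, x1') \<partial>M1 \<partial>M1)"
        using m by (intro C1_2) auto
      also have "\<dots> \<le> e12"
      proof (rule le_M1)
        \<comment> \<open>Exchanging the integrals moves the true \<open>x2\<close> outside; the
          observation is then fixed and the two wrong codewords are innermost, as \<open>e12\<close>
          requires.\<close>
        fix x1 assume x1: "x1 \<in> space M1"
        have "(\<integral>\<^sup>+x1'. G (x1, x1') \<partial>M1) = (\<integral>\<^sup>+x2. \<integral>\<^sup>+x1'. \<integral>\<^sup>+x2'. indicator {x2'. A (x1', x2', Y (x1, x2, w))} x2' \<partial>M2 \<partial>M1 \<partial>M2)"
          unfolding G_def prod.case using x1 w by (intro M12.Fubini'[symmetric]) (unfold indicator_def, simp, measurable)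
        also have "\<dots> \<le> e12" using x1 w spY by (intro le_M2 e12)
        finally show "(\<integral>\<^sup>+x1'. G (x1, x1') \<partial>M1) \<le> e12" .
      qed
      finally show ?thesis .
    qed
    then show ?thesis using IB[OF m(1,3,2,5)] le_Om by simp
  qed
  let ?P = "C1 \<Otimes>\<^sub>M (C2 \<Otimes>\<^sub>M \<Omega>)"
  have P3: "integral\<^sup>N ?P f = (\<integral>\<^sup>+c1. \<integral>\<^sup>+c2. \<integral>\<^sup>+w. f (c1, c2, w) \<partial>\<Omega> \<partial>C2 \<partial>C1)" if "f \<in> borel_measurable ?P" for f
    using that by (intro nn_integral_pair3) (auto intro: C2.sigma_finite_measure_axioms Om.sigma_finite_measure_axioms)
  have mc [measurable]: "(\<lambda>(c1, c2, w). c (c1 m1, c2 m2)) \<in> borel_measurable ?P" if "m1 < k1" "m2 < k2" for m1 m2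
    using that by (simp add: split_beta')
  have mF: "(\<lambda>(c1, c2, w). F m1 m2 c1 c2 w) \<in> borel_measurable ?P" if "m1 < k1" "m2 < k2" for m1 m2
    unfolding F_def using mI mI0 mc that by (simp add: split_beta')
  have FS: "(\<integral>\<^sup>+c1. \<integral>\<^sup>+c2. \<integral>\<^sup>+w. F m1 m2 c1 c2 w \<partial>\<Omega> \<partial>C2 \<partial>C1) \<le> S" if m: "m1 < k1" "m2 < k2" for m1 m2
  proof -
    let ?I = "\<lambda>m1' m2'. \<lambda>(c1, c2, w). I m1 m2 m1' m2' c1 c2 w"
    have PI: "integral\<^sup>N ?P (?I m1' m2') = (\<integral>\<^sup>+c1. \<integral>\<^sup>+c2. \<integral>\<^sup>+w. I m1 m2 m1' m2' c1 c2 w \<partial>\<Omega> \<partial>C2 \<partial>C1)" if "m1' < k1" "m2' < k2" for m1' m2'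
      using P3[OF mI[of m1 m1' m2 m2']] m that by simp
    have "(\<integral>\<^sup>+c1. \<integral>\<^sup>+c2. \<integral>\<^sup>+w. F m1 m2 c1 c2 w \<partial>\<Omega> \<partial>C2 \<partial>C1) = integral\<^sup>N ?P (\<lambda>(c1, c2, w). F m1 m2 c1 c2 w)"
      using P3[OF mF[OF m]] by simp
    also have "\<dots> = (\<integral>\<^sup>+p. (\<lambda>(c1, c2, w). I0 m1 m2 c1 c2 w) p + (\<Sum>m1'\<in>{..<k1}-{m1}. ?I m1' m2 p)
       + (\<Sum>m2'\<in>{..<k2}-{m2}. ?I m1 m2' p)
       + (\<Sum>m1'\<in>{..<k1}-{m1}. \<Sum>m2'\<in>{..<k2}-{m2}. ?I m1' m2' p) + (\<lambda>(c1, c2, w). c (c1 m1, c2 m2)) p \<partial>?P)"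
      by (simp add: F_def split_beta')
    also have "\<dots> = integral\<^sup>N ?P (\<lambda>(c1, c2, w). I0 m1 m2 c1 c2 w) + (\<Sum>m1'\<in>{..<k1}-{m1}. integral\<^sup>N ?P (?I m1' m2))
       + (\<Sum>m2'\<in>{..<k2}-{m2}. integral\<^sup>N ?P (?I m1 m2'))
       + (\<Sum>m1'\<in>{..<k1}-{m1}. \<Sum>m2'\<in>{..<k2}-{m2}. integral\<^sup>N ?P (?I m1' m2')) + integral\<^sup>N ?P (\<lambda>(c1, c2, w). c (c1 m1, c2 m2))"
    proof -
      have m1: "(\<lambda>p. \<Sum>m1'\<in>{..<k1}-{m1}. ?I m1' m2 p) \<in> borel_measurable ?P"
        "(\<lambda>p. \<Sum>m2'\<in>{..<k2}-{m2}. ?I m1 m2' p) \<in> borel_measurable ?P"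
        "(\<lambda>p. \<Sum>m1'\<in>{..<k1}-{m1}. \<Sum>m2'\<in>{..<k2}-{m2}. ?I m1' m2' p) \<in> borel_measurable ?P"
        using m by (auto intro!: borel_measurable_sum mI)
      have s1: "integral\<^sup>N ?P (\<lambda>p. \<Sum>m1'\<in>{..<k1}-{m1}. ?I m1' m2 p) = (\<Sum>m1'\<in>{..<k1}-{m1}. integral\<^sup>N ?P (?I m1' m2))"
        using m by (intro nn_integral_sum mI) auto
      have s2: "integral\<^sup>N ?P (\<lambda>p. \<Sum>m2'\<in>{..<k2}-{m2}. ?I m1 m2' p) = (\<Sum>m2'\<in>{..<k2}-{m2}. integral\<^sup>N ?P (?I m1 m2'))"
        using m by (intro nn_integral_sum mI) auto
      have s3: "integral\<^sup>N ?P (\<lambda>p. \<Sum>m1'\<in>{..<k1}-{m1}. \<Sum>m2'\<in>{..<k2}-{m2}. ?I m1' m2' p)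
          = (\<Sum>m1'\<in>{..<k1}-{m1}. \<Sum>m2'\<in>{..<k2}-{m2}. integral\<^sup>N ?P (?I m1' m2'))"
        using m by (intro nn_integral_double_sum mI) auto
      note ma = mI0[OF m] mc[OF m] m1
      show ?thesis
        unfolding s1[symmetric] s2[symmetric] s3[symmetric]
        by (simp only: nn_integral_add ma borel_measurable_add)
    qed
    also have "\<dots> \<le> e0 + (\<Sum>m1'\<in>{..<k1}-{m1}. e1) + (\<Sum>m2'\<in>{..<k2}-{m2}. e2)
       + (\<Sum>m1'\<in>{..<k1}-{m1}. \<Sum>m2'\<in>{..<k2}-{m2}. e12) + ec"
    proof (intro add_mono sum_mono)
      show "integral\<^sup>N ?P (\<lambda>(c1, c2, w). I0 m1 m2 c1 c2 w) \<le> e0"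
        using P3[OF mI0[OF m]] b0[OF m] by simp
      show "integral\<^sup>N ?P (?I m1' m2) \<le> e1" if "m1' \<in> {..<k1}-{m1}" for m1'
        using that m b1[of m1 m2 m1'] PI[of m1' m2] by simp
      show "integral\<^sup>N ?P (?I m1 m2') \<le> e2" if "m2' \<in> {..<k2}-{m2}" for m2'
        using that m b2[of m1 m2 m2'] PI[of m1 m2'] by simp
      show "integral\<^sup>N ?P (?I m1' m2') \<le> e12" if "m1' \<in> {..<k1}-{m1}" "m2' \<in> {..<k2}-{m2}" for m1' m2'
        using that m b12[of m1 m2 m1' m2'] PI[of m1' m2'] by simp
      show "integral\<^sup>N ?P (\<lambda>(c1, c2, w). c (c1 m1, c2 m2)) \<le> ec"
        using P3[OF mc[OF m]] bc[OF m] by (simp add: Om.emeasure_space_1)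
    qed
    also have "\<dots> = S" using m by (simp add: S_def mult.assoc)
    finally show ?thesis .
  qed
  define G where "G m1 m2 = (\<lambda>(c1, c2). \<integral>\<^sup>+w. F m1 m2 c1 c2 w \<partial>\<Omega>)" for m1 m2
  have mG: "G m1 m2 \<in> borel_measurable (C1 \<Otimes>\<^sub>M C2)" if "m1 < k1" "m2 < k2" for m1 m2
  proof -
    have [measurable]: "(\<lambda>p. F m1 m2 (fst p) (fst (snd p)) (snd (snd p))) \<in> borel_measurable ?P"
      using mF[OF that] by (simp add: split_beta')
    have "(\<lambda>q. F m1 m2 (fst (fst q)) (snd (fst q)) (snd q)) \<in> borel_measurable ((C1 \<Otimes>\<^sub>M C2) \<Otimes>\<^sub>M \<Omega>)"
      using measurable_compose[of "\<lambda>q. (fst (fst q), snd (fst q), snd q)" "(C1 \<Otimes>\<^sub>M C2) \<Otimes>\<^sub>M \<Omega>" ?P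
         "\<lambda>p. F m1 m2 (fst p) (fst (snd p)) (snd (snd p))" borel] by simp
    then have "(\<lambda>q. \<integral>\<^sup>+w. F m1 m2 (fst q) (snd q) w \<partial>\<Omega>) \<in> borel_measurable (C1 \<Otimes>\<^sub>M C2)"
      by (intro Om.borel_measurable_nn_integral) (simp add: split_beta')
    then show ?thesis by (simp add: G_def split_beta')
  qed
  define H where "H p = ennreal (1 / (real k1 * real k2)) * (\<Sum>m1<k1. \<Sum>m2<k2. G m1 m2 p)" for p
  have "(\<integral>\<^sup>+p. H p \<partial>(C1 \<Otimes>\<^sub>M C2)) = ennreal (1 / (real k1 * real k2)) * (\<Sum>m1<k1. \<Sum>m2<k2. integral\<^sup>N (C1 \<Otimes>\<^sub>M C2) (G m1 m2))"
  proof -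
    have "(\<integral>\<^sup>+p. (\<Sum>m1<k1. \<Sum>m2<k2. G m1 m2 p) \<partial>(C1 \<Otimes>\<^sub>M C2)) = (\<Sum>m1<k1. \<Sum>m2<k2. integral\<^sup>N (C1 \<Otimes>\<^sub>M C2) (G m1 m2))"
      by (rule nn_integral_double_sum) (use mG in auto)
    moreover have "(\<lambda>p. \<Sum>m1<k1. \<Sum>m2<k2. G m1 m2 p) \<in> borel_measurable (C1 \<Otimes>\<^sub>M C2)"
      by (intro borel_measurable_sum mG) auto
    ultimately show ?thesis unfolding H_def by (subst nn_integral_cmult) auto
  qed
  also have "\<dots> \<le> ennreal (1 / (real k1 * real k2)) * (\<Sum>m1<k1. \<Sum>m2<k2. S)"
  proof (intro mult_left_mono sum_mono)
    fix m1 m2 assume "m1 \<in> {..<k1}" "m2 \<in> {..<k2}"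
    then have m: "m1 < k1" "m2 < k2" by auto
    have "integral\<^sup>N (C1 \<Otimes>\<^sub>M C2) (G m1 m2) = (\<integral>\<^sup>+c1. \<integral>\<^sup>+c2. G m1 m2 (c1, c2) \<partial>C2 \<partial>C1)"
      using mG[OF m] by (simp add: C2.nn_integral_fst)
    then show "integral\<^sup>N (C1 \<Otimes>\<^sub>M C2) (G m1 m2) \<le> S" using FS[OF m] by (simp add: G_def)
  qed simp
  also have "\<dots> = S"
  proof -
    have "(\<Sum>m1<k1. \<Sum>m2<k2. S) = ennreal (real (k1 * k2)) * S"
      unfolding ennreal_of_nat_eq_real_of_nat[symmetric] by (simp add: mult.assoc)
    then have "ennreal (1 / (real k1 * real k2)) * (\<Sum>m1<k1. \<Sum>m2<k2. S)
       = (ennreal (1 / (real k1 * real k2)) * ennreal (real (k1 * k2))) * S"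
      by (simp only: mult.assoc)
    also have "ennreal (1 / (real k1 * real k2)) * ennreal (real (k1 * k2)) = ennreal (1 / (real k1 * real k2) * real (k1 * k2))"
      by (rule ennreal_mult[symmetric]) auto
    also have "1 / (real k1 * real k2) * real (k1 * k2) = 1" using k by simp
    finally show ?thesis by simp
  qed
  also have "S < e" using less by (simp add: S_def)
  finally have "(\<integral>\<^sup>+p. H p \<partial>(C1 \<Otimes>\<^sub>M C2)) < e" .
  note H_less = this
  interpret C: pair_prob_space C1 C2 ..
  obtain p where p: "p \<in> space (C1 \<Otimes>\<^sub>M C2)" "H p < e"
    using C.exists_less_nn_integral[OF H_less] by blast
  obtain c1 c2 where pc: "p = (c1, c2)" by force
  have c12: "c1 \<in> space C1" "c2 \<in> space C2" using p pc by (auto simp: space_pair_measure)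
  have "emeasure \<Omega> {w \<in> space \<Omega>. \<not> decodes A k1 k2 c1 c2 (Y (c1 m1, c2 m2, w)) m1 m2} + c (c1 m1, c2 m2) \<le> G m1 m2 p"
    if m: "m1 < k1" "m2 < k2" for m1 m2
  proof -
    let ?B = "{w \<in> space \<Omega>. \<not> decodes A k1 k2 c1 c2 (Y (c1 m1, c2 m2, w)) m1 m2}"
    have [measurable]: "?B \<in> sets \<Omega>"
      unfolding decodes_def using c12 sp1[OF c12(1)] sp2[OF c12(2)] m by measurable
    have "emeasure \<Omega> ?B + c (c1 m1, c2 m2) = (\<integral>\<^sup>+w. indicator ?B w + c (c1 m1, c2 m2) \<partial>\<Omega>)"
      by (subst nn_integral_add) (simp_all add: Om.emeasure_space_1)
    also have "\<dots> \<le> (\<integral>\<^sup>+w. F m1 m2 c1 c2 w \<partial>\<Omega>)"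
    proof (rule nn_integral_mono)
      fix w assume w: "w \<in> space \<Omega>"
      have "indicator ?B w \<le> I0 m1 m2 c1 c2 w + (\<Sum>m1'\<in>{..<k1}-{m1}. I m1 m2 m1' m2 c1 c2 w)
       + (\<Sum>m2'\<in>{..<k2}-{m2}. I m1 m2 m1 m2' c1 c2 w)
       + (\<Sum>m1'\<in>{..<k1}-{m1}. \<Sum>m2'\<in>{..<k2}-{m2}. I m1 m2 m1' m2' c1 c2 w)" (is "_ \<le> ?a + ?b + ?d + ?e")
      proof (cases "w \<in> ?B")
        case True
        \<comment> \<open>The four kinds of failure correspond to the four groups of terms of the
          majorant.\<close>
        then consider "?a = 1" | m1' where "m1' \<in> {..<k1}-{m1}" "I m1 m2 m1' m2 c1 c2 w = 1"
          | m2' where "m2' \<in> {..<k2}-{m2}" "I m1 m2 m1 m2' c1 c2 w = 1"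
          | m1' m2' where "m1' \<in> {..<k1}-{m1}" "m2' \<in> {..<k2}-{m2}" "I m1 m2 m1' m2' c1 c2 w = 1"
        proof (cases "A (c1 m1, c2 m2, Y (c1 m1, c2 m2, w))")
          case False then show ?thesis using that(1) by (simp add: I0_def)
        next
          case A: True
          with True obtain n1 n2 where n: "n1 < k1" "n2 < k2" "n1 \<noteq> m1 \<or> n2 \<noteq> m2" "A (c1 n1, c2 n2, Y (c1 m1, c2 m2, w))"
            unfolding decodes_def by auto
          then have I1: "I m1 m2 n1 n2 c1 c2 w = 1" by (simp add: I_def)
          show ?thesis
            using that(2)[of n1] that(3)[of n2] that(4)[of n1 n2] I1 n by (cases "n1 = m1"; cases "n2 = m2") auto
        qed
        then have "1 \<le> ?a + ?b + ?d + ?e"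
        proof cases
          case 1 then show ?thesis by (simp add: add.assoc)
        next
          case (2 m1')
          then have "1 \<le> ?b" using member_le_sum[of m1' "{..<k1}-{m1}" "\<lambda>m1'. I m1 m2 m1' m2 c1 c2 w"] by simp
          then show ?thesis by (rule add_increasing2[OF zero_le add_increasing2[OF zero_le add_increasing[OF zero_le]]])
        next
          case (3 m2')
          then have "1 \<le> ?d" using member_le_sum[of m2' "{..<k2}-{m2}" "\<lambda>m2'. I m1 m2 m1 m2' c1 c2 w"] by simp
          then show ?thesis by (rule add_increasing2[OF zero_le add_increasing[OF zero_le]])
        next
          case (4 m1' m2')
          then have "1 \<le> (\<Sum>m2'\<in>{..<k2}-{m2}. I m1 m2 m1' m2' c1 c2 w)"
            using member_le_sum[of m2' "{..<k2}-{m2}" "\<lambda>m2'. I m1 m2 m1' m2' c1 c2 w"] by simp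
          also have "\<dots> \<le> ?e"
            using member_le_sum[of m1' "{..<k1}-{m1}" "\<lambda>m1'. \<Sum>m2'\<in>{..<k2}-{m2}. I m1 m2 m1' m2' c1 c2 w"] 4 by simp
          finally show ?thesis by (rule add_increasing[OF zero_le])
        qed
        then show ?thesis using True by simp
      qed simp
      then show "indicator ?B w + c (c1 m1, c2 m2) \<le> F m1 m2 c1 c2 w"
        unfolding F_def by (rule add_right_mono)
    qed
    finally show ?thesis by (simp add: G_def pc)
  qed
  then have "ennreal (1 / (real k1 * real k2)) * (\<Sum>m1<k1. \<Sum>m2<k2.
       emeasure \<Omega> {w \<in> space \<Omega>. \<not> decodes A k1 k2 c1 c2 (Y (c1 m1, c2 m2, w)) m1 m2} + c (c1 m1, c2 m2)) \<le> H p"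
    unfolding H_def by (intro mult_left_mono sum_mono) auto
  then show ?thesis using p(2) sp1[OF c12(1)] sp2[OF c12(2)] by (intro exI[of _ c1] exI[of _ c2]) auto
qed

section \<open>Gaussian likelihood ratios\<close>

text \<open>Log ratio of the normal density with mean \<open>\<mu>\<close> and deviation
  \<open>s\<close> to the standard normal density at \<open>x\<close>, with the common factor
  cancelled.\<close>

definition gauss_llr :: "real \<Rightarrow> real \<Rightarrow> real \<Rightarrow> real" where
  "gauss_llr s \<mu> x = ln (1 / s) + x\<^sup>2 / 2 - ((x - \<mu>) / s)\<^sup>2 / 2"

lemma borel_measurable_gauss_llr [measurable (raw)]:
  assumes [measurable]: "f \<in> borel_measurable M" "g \<in> borel_measurable M"
  shows "(\<lambda>p. gauss_llr s (f p) (g p)) \<in> borel_measurable M"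
  unfolding gauss_llr_def by measurable

text \<open>The exponential of the log-likelihood ratio is the density of a Gaussian posterior with
  respect to the standard Gaussian prior, whence the total mass one.\<close>

lemma nn_integral_exp_gauss_llr:
  assumes s: "0 < s"
  shows "(\<integral>\<^sup>+x. ennreal (exp (gauss_llr s \<mu> x)) \<partial>std_normal_measure) = 1"
proof -
  have eq: "std_normal_density x * exp (gauss_llr s \<mu> x) = normal_density \<mu> s x" for x
  proof -
    have "exp (gauss_llr s \<mu> x) = 1 / s * exp (x\<^sup>2 / 2) / exp (((x - \<mu>) / s)\<^sup>2 / 2)"
      unfolding gauss_llr_def using s by (simp add: exp_add exp_diff)
    moreover have "exp (- (x - \<mu>)\<^sup>2 / (2 * s\<^sup>2)) = 1 / exp (((x - \<mu>) / s)\<^sup>2 / 2)"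
      by (simp add: exp_minus power_divide field_simps)
    moreover have "exp (- x\<^sup>2 / 2) = 1 / exp (x\<^sup>2 / 2)"
      by (simp add: exp_minus field_simps)
    ultimately show ?thesis
      using s by (simp add: std_normal_density_def normal_density_def real_sqrt_mult)
  qed
  have "(\<integral>\<^sup>+x. ennreal (exp (gauss_llr s \<mu> x)) \<partial>std_normal_measure)
      = (\<integral>\<^sup>+x. ennreal (std_normal_density x) * ennreal (exp (gauss_llr s \<mu> x)) \<partial>lborel)"
    unfolding std_normal_measure_def by (subst nn_integral_density) auto
  also have "\<dots> = (\<integral>\<^sup>+x. ennreal (normal_density \<mu> s x) \<partial>lborel)"
    by (simp add: eq ennreal_mult[symmetric])
  also have "\<dots> = emeasure (density lborel (normal_density \<mu> s)) (space (density lborel (normal_density \<mu> s)))"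
    by (simp add: emeasure_density)
  also have "\<dots> = 1"
    using prob_space.emeasure_space_1[OF prob_space_normal_density[OF s]] by simp
  finally show ?thesis .
qed

section \<open>Random codewords and tail bounds for likelihood ratios\<close>

abbreviation std_block :: "nat \<Rightarrow> (nat \<Rightarrow> real) measure" where
  "std_block L \<equiv> PiM {..<L} (\<lambda>_. std_normal_measure)"

lemma prob_space_std_block: "prob_space (std_block L)"
  by (rule prob_space_PiM) (rule prob_space_std_normal_measure)

lemma measurable_std_block_component: "b < L \<Longrightarrow> (\<lambda>x. x b) \<in> borel_measurable (std_block L)"
  using measurable_component_singleton[of b "{..<L}" "\<lambda>_. std_normal_measure"]
  by (simp cong: measurable_cong_sets)

lemma nn_integral_exp_sum_gauss_llr:
  assumes s: "0 < s"
  shows "(\<integral>\<^sup>+x. ennreal (exp (\<Sum>b<L. gauss_llr s (\<mu> b) (x b))) \<partial>std_block L) = 1"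
proof -
  interpret S: prob_space std_normal_measure by (rule prob_space_std_normal_measure)
  interpret P: product_prob_space "\<lambda>_. std_normal_measure" "{..<L}" ..
  have "(\<integral>\<^sup>+x. ennreal (exp (\<Sum>b<L. gauss_llr s (\<mu> b) (x b))) \<partial>std_block L)
    = (\<integral>\<^sup>+x. (\<Prod>b<L. ennreal (exp (gauss_llr s (\<mu> b) (x b)))) \<partial>std_block L)"
    by (simp add: exp_sum prod_ennreal)
  also have "\<dots> = (\<Prod>b<L. \<integral>\<^sup>+x. ennreal (exp (gauss_llr s (\<mu> b) x)) \<partial>std_normal_measure)"
    by (intro P.product_nn_integral_prod) auto
  finally show ?thesis by (simp add: nn_integral_exp_gauss_llr[OF s])
qed

text \<open>The pointwise form of the exponential Markov inequality.\<close>

lemma indicator_le_exp: "indicator {x. g < f x} x \<le> ennreal (exp (- g)) * ennreal (exp (f x))"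
proof (cases "g < f x")
  case True
  then have "1 \<le> exp (- g) * exp (f x)" by (simp add: exp_add[symmetric])
  then show ?thesis using True by (simp add: indicator_def ennreal_mult[symmetric] del: exp_minus)
qed simp

lemma gauss_llr_tail:
  assumes s: "0 < s"
  shows "(\<integral>\<^sup>+x. indicator {x. g < (\<Sum>b<L. gauss_llr s (\<mu> b) (x b))} x \<partial>std_block L) \<le> ennreal (exp (- g))"
proof -
  have m: "(\<lambda>x. \<Sum>b<L. gauss_llr s (\<mu> b) (x b)) \<in> borel_measurable (std_block L)"
    by (intro borel_measurable_sum borel_measurable_gauss_llr measurable_std_block_component) auto
  have "(\<integral>\<^sup>+x. indicator {x. g < (\<Sum>b<L. gauss_llr s (\<mu> b) (x b))} x \<partial>std_block L)
     \<le> (\<integral>\<^sup>+x. ennreal (exp (- g)) * ennreal (exp (\<Sum>b<L. gauss_llr s (\<mu> b) (x b))) \<partial>std_block L)"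
    by (intro nn_integral_mono indicator_le_exp)
  also have "\<dots> = ennreal (exp (- g))"
    using m by (subst nn_integral_cmult) (auto simp: nn_integral_exp_sum_gauss_llr[OF s])
  finally show ?thesis .
qed

text \<open>The second mean may depend on the first codeword: integrating over \<open>x'\<close>
  gives mass one for each fixed \<open>x\<close>, after which the first factor also integrates to
  one.\<close>

lemma gauss_llr_tail2:
  assumes s: "0 < s" "0 < s'"
  shows "(\<integral>\<^sup>+x. \<integral>\<^sup>+x'. indicator {x'. g < (\<Sum>b<L. gauss_llr s (\<mu> b) (x b)) + (\<Sum>b<L. gauss_llr s' (\<mu>' b x) (x' b))} x'
      \<partial>std_block L \<partial>std_block L) \<le> ennreal (exp (- g))"
proof -
  have m: "(\<lambda>x. \<Sum>b<L. gauss_llr s (\<mu> b) (x b)) \<in> borel_measurable (std_block L)" for s \<mu>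
    by (intro borel_measurable_sum borel_measurable_gauss_llr measurable_std_block_component) auto
  have "(\<integral>\<^sup>+x. \<integral>\<^sup>+x'. indicator {x'. g < (\<Sum>b<L. gauss_llr s (\<mu> b) (x b)) + (\<Sum>b<L. gauss_llr s' (\<mu>' b x) (x' b))} x'
      \<partial>std_block L \<partial>std_block L) \<le>
    (\<integral>\<^sup>+x. \<integral>\<^sup>+x'. ennreal (exp (- g)) * ennreal (exp ((\<Sum>b<L. gauss_llr s (\<mu> b) (x b)) + (\<Sum>b<L. gauss_llr s' (\<mu>' b x) (x' b))))
      \<partial>std_block L \<partial>std_block L)"
    by (intro nn_integral_mono indicator_le_exp)
  also have "\<dots> = (\<integral>\<^sup>+x. ennreal (exp (- g)) * ennreal (exp (\<Sum>b<L. gauss_llr s (\<mu> b) (x b))) \<partial>std_block L)"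
  proof (intro nn_integral_cong)
    fix x
    have "(\<integral>\<^sup>+x'. ennreal (exp (- g)) * ennreal (exp ((\<Sum>b<L. gauss_llr s (\<mu> b) (x b)) + (\<Sum>b<L. gauss_llr s' (\<mu>' b x) (x' b)))) \<partial>std_block L)
      = (\<integral>\<^sup>+x'. (ennreal (exp (- g)) * ennreal (exp (\<Sum>b<L. gauss_llr s (\<mu> b) (x b)))) * ennreal (exp (\<Sum>b<L. gauss_llr s' (\<mu>' b x) (x' b))) \<partial>std_block L)"
      by (simp add: exp_add ennreal_mult mult.assoc)
    also have "\<dots> = ennreal (exp (- g)) * ennreal (exp (\<Sum>b<L. gauss_llr s (\<mu> b) (x b)))"
      using m by (subst nn_integral_cmult) (auto simp: nn_integral_exp_sum_gauss_llr[OF s(2)])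
    finally show "(\<integral>\<^sup>+x'. ennreal (exp (- g)) * ennreal (exp ((\<Sum>b<L. gauss_llr s (\<mu> b) (x b)) + (\<Sum>b<L. gauss_llr s' (\<mu>' b x) (x' b)))) \<partial>std_block L)
       = ennreal (exp (- g)) * ennreal (exp (\<Sum>b<L. gauss_llr s (\<mu> b) (x b)))" .
  qed
  also have "\<dots> = ennreal (exp (- g))"
    using m by (subst nn_integral_cmult) (auto simp: nn_integral_exp_sum_gauss_llr[OF s(1)])
  finally show ?thesis .
qed

lemma iid_std_block: "iid_std (std_block L) ({..<L} \<times> {()}) (\<lambda>(b, _) x. x b)"
  using iid_std_PiM[OF iid_std_single, of "{..<L}"] by simp

text \<open>The three summands of the index select the standard normals behind the channel noise and
  behind the two Cholesky inputs at time \<open>fst k\<close>.\<close>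

definition noise_coord :: "nat \<times> (unit + unit + unit) \<Rightarrow> (nat \<Rightarrow> real \<times> real \<times> real) \<Rightarrow> real" where
  "noise_coord k \<omega> = (case snd k of Inl _ \<Rightarrow> fst (\<omega> (fst k)) | Inr (Inl _) \<Rightarrow> fst (snd (\<omega> (fst k))) | Inr (Inr _) \<Rightarrow> snd (snd (\<omega> (fst k))))"

lemma iid_std_noise_space: "iid_std (noise_space n) ({..<n} \<times> ({()} <+> ({()} <+> {()}))) noise_coord"
proof -
  have "iid_std noise_letter ({()} <+> ({()} <+> {()})) (\<lambda>k p. case k of Inl _ \<Rightarrow> fst p | Inr l \<Rightarrow> (case l of Inl _ \<Rightarrow> fst (snd p) | Inr _ \<Rightarrow> snd (snd p)))"
    using iid_std_pair[OF iid_std_single iid_std_pair[OF iid_std_single iid_std_single]]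
    by (simp add: noise_letter_def)
  from iid_std_PiM[OF this, of "{..<n}"]
  have "iid_std (noise_space n) ({..<n} \<times> ({()} <+> ({()} <+> {()})))
     (\<lambda>(i, j) \<omega>. case j of Inl _ \<Rightarrow> fst (\<omega> i) | Inr l \<Rightarrow> (case l of Inl _ \<Rightarrow> fst (snd (\<omega> i)) | Inr _ \<Rightarrow> snd (snd (\<omega> i))))"
    by (simp add: noise_space_def)
  moreover have "(\<lambda>(i, j) \<omega>. case j of Inl _ \<Rightarrow> fst (\<omega> i) | Inr l \<Rightarrow> (case l of Inl _ \<Rightarrow> fst (snd (\<omega> i)) | Inr _ \<Rightarrow> snd (snd (\<omega> i)))) = noise_coord"
    by (auto simp: fun_eq_iff noise_coord_def split: sum.splits)
  ultimately show ?thesis by simp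
qed

lemma prob_space_noise_space: "prob_space (noise_space n)"
  using iid_std_noise_space[of n] by (simp add: iid_std_def)

lemma measurable_noise_Z: "t < n \<Longrightarrow> (\<lambda>\<omega>. fst (\<omega> t)) \<in> borel_measurable (noise_space n)"
proof -
  assume "t < n"
  then have "noise_coord (t, Inl ()) \<in> borel_measurable (noise_space n)"
    using iid_std_noise_space[of n] by (auto simp: iid_std_def)
  then show ?thesis by (simp add: noise_coord_def[abs_def])
qed

lemma block_index_less: "b < L \<Longrightarrow> i < \<eta> \<Longrightarrow> L * \<eta> \<le> n \<Longrightarrow> b * \<eta> + i < (n::nat)"
proof -
  assume a: "b < L" "i < \<eta>" "L * \<eta> \<le> n"
  have "b * \<eta> + i < Suc b * \<eta>" using a by simp
  also have "\<dots> \<le> L * \<eta>" using a by (intro mult_le_mono1) simp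
  finally show ?thesis using a by simp
qed

text \<open>Codewords and noise are merged into one family. The form of block \<open>b\<close> uses
  the symbols with index \<open>b\<close> and the \<open>\<eta>\<close> noise samples from
  \<open>b * \<eta>\<close> on, so different blocks have disjoint index sets.\<close>

lemma block_form_square_mean:
  fixes u v :: real and w :: "nat \<Rightarrow> real"
  assumes one: "u\<^sup>2 + v\<^sup>2 + (\<Sum>i<\<eta>. (w i)\<^sup>2) = 1" and L: "0 < L" "L * \<eta> \<le> n"
  shows "(\<integral>\<^sup>+x1. \<integral>\<^sup>+x2. \<integral>\<^sup>+\<omega>. ennreal (((\<Sum>b<L. (u * x1 b + v * x2 b + (\<Sum>i<\<eta>. w i * fst (\<omega> (b * \<eta> + i))))\<^sup>2) / real L - 1)\<^sup>2)
      \<partial>noise_space n \<partial>std_block L \<partial>std_block L) = ennreal (2 / real L)"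
proof -
  let ?P = "std_block L \<Otimes>\<^sub>M (std_block L \<Otimes>\<^sub>M noise_space n)"
  let ?J = "({..<L} \<times> {()}) <+> (({..<L} \<times> {()}) <+> ({..<n} \<times> ({()} <+> ({()} <+> {()}))))"
  let ?X = "\<lambda>k p. case k of Inl i \<Rightarrow> (case i of (b, _) \<Rightarrow> \<lambda>x. x b) (fst p)
    | Inr k' \<Rightarrow> (case k' of Inl i \<Rightarrow> (case i of (b, _) \<Rightarrow> \<lambda>x. x b) (fst (snd p)) | Inr j \<Rightarrow> noise_coord j (snd (snd p)))"
  have iid: "iid_std ?P ?J ?X"
    using iid_std_pair[OF iid_std_block iid_std_pair[OF iid_std_block iid_std_noise_space]] .
  define Z where "Z b i = (Inr (Inr (b * \<eta> + i, Inl ())) :: (nat \<times> unit) + (nat \<times> unit) + nat \<times> (unit + unit + unit))" for b i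
  define K where "K b = {Inl (b, ()), Inr (Inl (b, ()))} \<union> Z b ` {..<\<eta>}" for b
  \<comment> \<open>Coefficients live on the global index, so the position inside the block is
    recovered as \<open>t mod \<eta>\<close>.\<close>
  define c where "c k = (case k of Inl _ \<Rightarrow> u | Inr (Inl _) \<Rightarrow> v | Inr (Inr (t, _)) \<Rightarrow> w (t mod \<eta>))"
    for k :: "(nat \<times> unit) + (nat \<times> unit) + nat \<times> (unit + unit + unit)"
  have sumK: "(\<Sum>k\<in>K b. f k) = f (Inl (b, ())) + f (Inr (Inl (b, ()))) + (\<Sum>i<\<eta>. f (Z b i))" for b and f :: "_ \<Rightarrow> real"
  proof -
    have "inj_on (Z b) {..<\<eta>}" by (auto simp: inj_on_def Z_def)
    then have "sum f (Z b ` {..<\<eta>}) = (\<Sum>i<\<eta>. f (Z b i))" by (simp add: sum.reindex)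
    moreover have "sum f (K b) = sum f {Inl (b, ()), Inr (Inl (b, ()))} + sum f (Z b ` {..<\<eta>})"
      unfolding K_def by (rule sum.union_disjoint) (auto simp: Z_def)
    ultimately show ?thesis by simp
  qed
  have c: "c (Inl (b, ())) = u" "c (Inr (Inl (b, ()))) = v" "i < \<eta> \<Longrightarrow> c (Z b i) = w i" for b i
    by (auto simp: c_def Z_def)
  have K1: "K b \<subseteq> ?J" if "b < L" for b
    using that block_index_less[OF that _ L(2)] by (auto simp: K_def Z_def)
  have K2: "disjoint_family_on K {..<L}"
  proof -
    have "b = b'" if "b * \<eta> + i = b' * \<eta> + i'" "i < \<eta>" "i' < \<eta>" for b b' i i'
      using arg_cong[OF that(1), of "\<lambda>x. x div \<eta>"] that(2,3) by simp
    then show ?thesis by (auto simp: disjoint_family_on_def K_def Z_def)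
  qed
  have e: "(\<Sum>k\<in>K b. c k * ?X k p) = u * fst p b + v * fst (snd p) b + (\<Sum>i<\<eta>. w i * fst (snd (snd p) (b * \<eta> + i)))" for b p
    unfolding sumK by (simp add: c) (auto intro!: sum.cong simp: c Z_def[abs_def] noise_coord_def)
  let ?f = "\<lambda>p. ennreal (((\<Sum>b<L. (\<Sum>k\<in>K b. c k * ?X k p)\<^sup>2) / real L - 1)\<^sup>2)"
  have mX: "?X k \<in> borel_measurable ?P" if "k \<in> ?J" for k
    using iid that unfolding iid_std_def by blast
  have mf: "?f \<in> borel_measurable ?P"
    using K1 by (intro measurable_compose[OF _ measurable_ennreal] borel_measurable_power borel_measurable_diff borel_measurable_divide
        borel_measurable_sum borel_measurable_times mX borel_measurable_const) auto
  have "integral\<^sup>N ?P ?f = ennreal (2 / real L)"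
    by (rule iid_std_square_mean[OF iid K1 K2 _ L(1)]) (simp_all add: sumK c one)
  moreover have "integral\<^sup>N ?P ?f = (\<integral>\<^sup>+x1. \<integral>\<^sup>+x2. \<integral>\<^sup>+\<omega>. ?f (x1, x2, \<omega>) \<partial>noise_space n \<partial>std_block L \<partial>std_block L)"
    by (rule nn_integral_pair3[OF _ _ mf])
      (auto intro: prob_space_imp_sigma_finite prob_space_std_block prob_space_noise_space)
  ultimately show ?thesis unfolding e by simp
qed

section \<open>The memoryless Gaussian multiple-access channel\<close>

text \<open>Relative deviation of an empirical second moment; all randomness in the tests at the
  true codewords has this shape.\<close>

definition block_dev :: "nat \<Rightarrow> nat \<Rightarrow> real \<Rightarrow> real \<Rightarrow> (nat \<Rightarrow> real) \<Rightarrow>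
    (nat \<Rightarrow> real) \<times> (nat \<Rightarrow> real) \<times> (nat \<Rightarrow> real \<times> real \<times> real) \<Rightarrow> real" where
  "block_dev \<eta> L u v w = (\<lambda>(x1, x2, \<omega>).
     (\<Sum>b<L. (u * x1 b + v * x2 b + (\<Sum>i<\<eta>. w i * fst (\<omega> (b * \<eta> + i))))\<^sup>2) / real L - 1)"

abbreviation code_space :: "nat \<Rightarrow> nat \<Rightarrow> ((nat \<Rightarrow> real) \<times> (nat \<Rightarrow> real) \<times> (nat \<Rightarrow> real \<times> real \<times> real)) measure" where
  "code_space L n \<equiv> std_block L \<Otimes>\<^sub>M (std_block L \<Otimes>\<^sub>M noise_space n)"

lemma measurable_code_space_components:
  "b < L \<Longrightarrow> (\<lambda>p. fst p b) \<in> borel_measurable (std_block L \<Otimes>\<^sub>M M)"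
  "b < L \<Longrightarrow> (\<lambda>p. fst (snd p) b) \<in> borel_measurable (M \<Otimes>\<^sub>M (std_block L \<Otimes>\<^sub>M M'))"
  "t < n \<Longrightarrow> (\<lambda>p. fst (snd (snd p) t)) \<in> borel_measurable (M \<Otimes>\<^sub>M (M' \<Otimes>\<^sub>M noise_space n))"
proof -
  assume "b < L" from measurable_compose[OF measurable_fst measurable_std_block_component[OF this]]
  show "(\<lambda>p. fst p b) \<in> borel_measurable (std_block L \<Otimes>\<^sub>M M)" .
next
  assume "b < L" from measurable_compose[OF measurable_snd measurable_compose[OF measurable_fst measurable_std_block_component[OF this]]]
  show "(\<lambda>p. fst (snd p) b) \<in> borel_measurable (M \<Otimes>\<^sub>M (std_block L \<Otimes>\<^sub>M M'))" .
next
  assume "t < n" from measurable_compose[OF measurable_snd measurable_compose[OF measurable_snd measurable_noise_Z[OF this]]]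
  show "(\<lambda>p. fst (snd (snd p) t)) \<in> borel_measurable (M \<Otimes>\<^sub>M (M' \<Otimes>\<^sub>M noise_space n))" .
qed

lemma measurable_block_dev:
  assumes "L * \<eta> \<le> n"
  shows "block_dev \<eta> L u v w \<in> borel_measurable (code_space L n)"
  unfolding block_dev_def split_beta'
  by (intro borel_measurable_diff borel_measurable_divide borel_measurable_sum borel_measurable_power borel_measurable_add
      borel_measurable_times borel_measurable_const measurable_code_space_components) (auto intro: block_index_less[OF _ _ assms])

lemma nn_integral_code_space:
  assumes "f \<in> borel_measurable (code_space L n)"
  shows "integral\<^sup>N (code_space L n) f = (\<integral>\<^sup>+x1. \<integral>\<^sup>+x2. \<integral>\<^sup>+\<omega>. f (x1, x2, \<omega>) \<partial>noise_space n \<partial>std_block L \<partial>std_block L)"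
  by (rule nn_integral_pair3[OF _ _ assms])
    (auto intro: prob_space_imp_sigma_finite prob_space_std_block prob_space_noise_space)

lemma nn_integral_block_dev_square:
  assumes "u\<^sup>2 + v\<^sup>2 + (\<Sum>i<\<eta>. (w i)\<^sup>2) = 1" "0 < L" "L * \<eta> \<le> n"
  shows "(\<integral>\<^sup>+p. ennreal ((block_dev \<eta> L u v w p)\<^sup>2) \<partial>code_space L n) = ennreal (2 / real L)"
proof -
  have "(\<lambda>p. ennreal ((block_dev \<eta> L u v w p)\<^sup>2)) \<in> borel_measurable (code_space L n)"
    using measurable_block_dev[OF assms(3)] by (intro measurable_compose[OF _ measurable_ennreal] borel_measurable_power)
  from nn_integral_code_space[OF this] show ?thesis
    using block_form_square_mean[OF assms] by (simp add: block_dev_def)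
qed

text \<open>A sum of squares, so that a single nonnegative number of mean \<open>8 / L\<close>
  bounds all four deviations and can serve as the cost of a codeword pair.\<close>

definition power_dev :: "nat \<Rightarrow> (nat \<Rightarrow> real) \<times> (nat \<Rightarrow> real) \<Rightarrow> real" where
  "power_dev L = (\<lambda>(x1, x2). ((\<Sum>b<L. (x1 b)\<^sup>2) / real L - 1)\<^sup>2 + ((\<Sum>b<L. (x2 b)\<^sup>2) / real L - 1)\<^sup>2
     + ((\<Sum>b<L. ((x1 b + x2 b) / sqrt 2)\<^sup>2) / real L - 1)\<^sup>2 + ((\<Sum>b<L. ((x1 b - x2 b) / sqrt 2)\<^sup>2) / real L - 1)\<^sup>2)"

lemma measurable_power_dev: "power_dev L \<in> borel_measurable (std_block L \<Otimes>\<^sub>M std_block L)"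
proof -
  have 1: "b < L \<Longrightarrow> (\<lambda>p. fst p b) \<in> borel_measurable (std_block L \<Otimes>\<^sub>M std_block L)" for b
    by (rule measurable_code_space_components(1))
  have 2: "b < L \<Longrightarrow> (\<lambda>p. snd p b) \<in> borel_measurable (std_block L \<Otimes>\<^sub>M std_block L)" for b
    using measurable_compose[OF measurable_snd measurable_std_block_component] .
  show ?thesis
    unfolding power_dev_def split_beta'
    by (intro borel_measurable_diff borel_measurable_divide borel_measurable_sum borel_measurable_power borel_measurable_add
      borel_measurable_times borel_measurable_const 1 2) auto
qed

lemma nn_integral_power_dev:
  assumes "0 < L"
  shows "(\<integral>\<^sup>+x1. \<integral>\<^sup>+x2. ennreal (power_dev L (x1, x2)) \<partial>std_block L \<partial>std_block L) = ennreal (8 / real L)"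
proof -
  interpret O: prob_space "noise_space 0" by (rule prob_space_noise_space)
  interpret B: prob_space "std_block L" by (rule prob_space_std_block)
  define q where "q u v p = ((\<Sum>b<L. (u * fst p b + v * snd p b)\<^sup>2) / real L - 1)\<^sup>2" for u v :: real and p :: "(nat \<Rightarrow> real) \<times> (nat \<Rightarrow> real)"
  have q: "(\<integral>\<^sup>+x1. \<integral>\<^sup>+x2. ennreal (q u v (x1, x2)) \<partial>std_block L \<partial>std_block L) = ennreal (2 / real L)" if "u\<^sup>2 + v\<^sup>2 = 1" for u v
    \<comment> \<open>Taking \<open>\<eta> = 0\<close> and \<open>n = 0\<close> removes the noise
      terms, so the result for forms also covers the symbols alone.\<close>
    using block_form_square_mean[where u=u and v=v and w="\<lambda>_. 0" and \<eta>=0 and L=L and n=0] that assms by (simp add: q_def O.emeasure_space_1)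
  have 1: "b < L \<Longrightarrow> (\<lambda>p. fst p b) \<in> borel_measurable (std_block L \<Otimes>\<^sub>M std_block L)" for b
    by (rule measurable_code_space_components(1))
  have 2: "b < L \<Longrightarrow> (\<lambda>p. snd p b) \<in> borel_measurable (std_block L \<Otimes>\<^sub>M std_block L)" for b
    using measurable_compose[OF measurable_snd measurable_std_block_component] .
  have mq: "(\<lambda>p. ennreal (q u v p)) \<in> borel_measurable (std_block L \<Otimes>\<^sub>M std_block L)" for u v
    unfolding q_def by (intro measurable_compose[OF _ measurable_ennreal] borel_measurable_diff borel_measurable_divide borel_measurable_sum borel_measurable_power borel_measurable_add
      borel_measurable_times borel_measurable_const 1 2) auto
  have q': "(\<integral>\<^sup>+p. ennreal (q u v p) \<partial>(std_block L \<Otimes>\<^sub>M std_block L)) = ennreal (2 / real L)" if "u\<^sup>2 + v\<^sup>2 = 1" for u v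
    using q[OF that] B.nn_integral_fst[OF mq[of u v], of ] by simp
  have nn: "0 \<le> q u v p" for u v p by (simp add: q_def)
  have pd: "power_dev L p = q 1 0 p + q 0 1 p + q (1 / sqrt 2) (1 / sqrt 2) p + q (1 / sqrt 2) (- (1 / sqrt 2)) p" for p
    by (simp add: power_dev_def q_def split_beta' add_divide_distrib diff_divide_distrib)
  have "(\<integral>\<^sup>+x1. \<integral>\<^sup>+x2. ennreal (power_dev L (x1, x2)) \<partial>std_block L \<partial>std_block L) = (\<integral>\<^sup>+p. ennreal (power_dev L p) \<partial>(std_block L \<Otimes>\<^sub>M std_block L))"
    using measurable_power_dev[of L] by (intro B.nn_integral_fst) simp
  also have "\<dots> = (\<integral>\<^sup>+p. ennreal (q 1 0 p) + ennreal (q 0 1 p) + ennreal (q (1 / sqrt 2) (1 / sqrt 2) p) + ennreal (q (1 / sqrt 2) (- (1 / sqrt 2)) p) \<partial>(std_block L \<Otimes>\<^sub>M std_block L))"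
    unfolding pd by (simp add: nn)
  also have "\<dots> = ennreal (2 / real L) + ennreal (2 / real L) + ennreal (2 / real L) + ennreal (2 / real L)"
    using mq by (simp add: nn_integral_add q' power_divide)
  also have "\<dots> = ennreal (8 / real L)"
    by (simp flip: ennreal_plus add: add_divide_distrib[symmetric])
  finally show ?thesis .
qed

locale gaussian_mac =
  fixes \<eta> :: nat and N :: real and a1 a2 :: "nat \<Rightarrow> real"
  assumes N_pos: "0 < N"
begin

section \<open>Gram data, posterior deviations and normalised errors\<close>

definition al where "al = (\<Sum>i<\<eta>. (a1 i)\<^sup>2)"
definition be where "be = (\<Sum>i<\<eta>. (a2 i)\<^sup>2)"
definition ka where "ka = (\<Sum>i<\<eta>. a1 i * a2 i)"
text \<open>Let \<open>Q = N I + a2 a2^T\<close> be the covariance of the second signal plus noise.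
  By the Sherman-Morrison formula \<open>dd\<close> is \<open>N Q^-1 a1\<close>, and
  \<open>de\<close> is \<open>N a1^T Q^-1 a1\<close>: the data for estimating \<open>x1\<close> when
  \<open>x2\<close> counts as Gaussian noise.\<close>

definition dd where "dd i = a1 i - ka / (N + be) * a2 i"
definition de where "de = al - ka\<^sup>2 / (N + be)"

text \<open>Posterior standard deviations: of \<open>x1\<close> given \<open>x2\<close> and the
  output, of \<open>x2\<close> given \<open>x1\<close> and the output, and of \<open>x1\<close>
  given the output alone.\<close>

definition sa where "sa = sqrt (N / (N + al))"
definition sb where "sb = sqrt (N / (N + be))"
definition sd where "sd = sqrt (N / (N + de))"

lemma al_nonneg: "0 \<le> al" and be_nonneg: "0 \<le> be"
  by (auto simp: al_def be_def intro!: sum_nonneg)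

lemma ka_square_le: "ka\<^sup>2 \<le> al * be"
  unfolding ka_def al_def be_def by (rule Cauchy_Schwarz_ineq_sum)

lemma de_nonneg: "0 \<le> de"
proof -
  have "ka\<^sup>2 \<le> al * (N + be)"
    using ka_square_le al_nonneg N_pos by (smt (verit) mult_left_mono)
  then show ?thesis using N_pos be_nonneg by (simp add: de_def divide_le_eq)
qed

lemma s_pos: "0 < sa" "0 < sb" "0 < sd"
  using N_pos al_nonneg be_nonneg de_nonneg by (auto simp: sa_def sb_def sd_def)

lemma dd_a2: "(\<Sum>i<\<eta>. dd i * a2 i) = ka * N / (N + be)"
proof -
  have "(\<Sum>i<\<eta>. dd i * a2 i) = ka - ka / (N + be) * be"
    by (simp add: dd_def ka_def[symmetric] be_def left_diff_distrib sum_subtractf sum_distrib_left power2_eq_square mult.assoc)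
  then show ?thesis using N_pos be_nonneg by (simp add: field_simps)
qed

lemma dd_a1: "(\<Sum>i<\<eta>. dd i * a1 i) = de"
proof -
  have "(\<Sum>i<\<eta>. dd i * a1 i) = al - ka / (N + be) * (\<Sum>i<\<eta>. a2 i * a1 i)"
    by (simp add: dd_def al_def left_diff_distrib sum_subtractf sum_distrib_left power2_eq_square mult.assoc)
  also have "(\<Sum>i<\<eta>. a2 i * a1 i) = ka" by (simp add: ka_def mult.commute)
  finally show ?thesis by (simp add: de_def power2_eq_square)
qed

lemma dd_dd: "(\<Sum>i<\<eta>. (dd i)\<^sup>2) = de - ka / (N + be) * (ka * N / (N + be))"
proof -
  have "(\<Sum>i<\<eta>. (dd i)\<^sup>2) = (\<Sum>i<\<eta>. dd i * a1 i) - ka / (N + be) * (\<Sum>i<\<eta>. dd i * a2 i)"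
    unfolding sum_distrib_left sum_subtractf[symmetric]
    by (intro sum.cong) (auto simp: dd_def power2_eq_square algebra_simps)
  then show ?thesis unfolding dd_a1 dd_a2 .
qed

lemma normalized_square: "M > 0 \<Longrightarrow> (x / (M * sqrt (N / M)))\<^sup>2 = x\<^sup>2 / (N * M)"
proof -
  assume M: "0 < M"
  have "(M * sqrt (N / M))\<^sup>2 = M\<^sup>2 * (N / M)" using N_pos M by (simp add: power_mult_distrib)
  also have "\<dots> = N * M" using M by (simp add: power2_eq_square)
  finally show ?thesis by (simp add: power_divide)
qed

text \<open>These are the coefficients of the estimation error of \<open>x1\<close> divided by
  \<open>sa\<close>; the squares add up to \<open>(N^2 + N * al) / (N * (N + al))\<close>.\<close>

lemma unit_form1: "(N / ((N + al) * sa))\<^sup>2 + 0\<^sup>2 + (\<Sum>i<\<eta>. (- (sqrt N * a1 i) / ((N + al) * sa))\<^sup>2) = 1"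
proof -
  have M: "0 < N + al" using N_pos al_nonneg by simp
  have S: "(\<Sum>i<\<eta>. (- (sqrt N * a1 i) / ((N + al) * sa))\<^sup>2) = N * al / (N * (N + al))"
    unfolding sa_def normalized_square[OF M] using N_pos
    by (simp add: al_def sum_divide_distrib[symmetric] power_mult_distrib sum_distrib_left[symmetric])
  show ?thesis
    unfolding S unfolding sa_def normalized_square[OF M]
    using N_pos M by (simp add: power2_eq_square add_divide_distrib[symmetric] distrib_left[symmetric])
qed

lemma unit_form2: "0\<^sup>2 + (N / ((N + be) * sb))\<^sup>2 + (\<Sum>i<\<eta>. (- (sqrt N * a2 i) / ((N + be) * sb))\<^sup>2) = 1"
proof -
  have M: "0 < N + be" using N_pos be_nonneg by simp
  have S: "(\<Sum>i<\<eta>. (- (sqrt N * a2 i) / ((N + be) * sb))\<^sup>2) = N * be / (N * (N + be))"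
    unfolding sb_def normalized_square[OF M] using N_pos
    by (simp add: be_def sum_divide_distrib[symmetric] power_mult_distrib sum_distrib_left[symmetric])
  show ?thesis
    unfolding S unfolding sb_def normalized_square[OF M]
    using N_pos M by (simp add: power2_eq_square add_divide_distrib[symmetric] distrib_left[symmetric])
qed

text \<open>Since \<open>x2\<close> acts as noise in this estimate, it has a coefficient of its own.
  The amount \<open>q\<close> it contributes is exactly what \<open>dd_dd\<close> falls short of
  \<open>de\<close>, and the two cancel.\<close>

lemma unit_form12: "(N / ((N + de) * sd))\<^sup>2 + (- (ka * N / (N + be)) / ((N + de) * sd))\<^sup>2
    + (\<Sum>i<\<eta>. (- (sqrt N * dd i) / ((N + de) * sd))\<^sup>2) = 1"
proof -
  have M: "0 < N + de" using N_pos de_nonneg by simp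
  define q where "q = ka / (N + be) * (ka * N / (N + be))"
  have S: "(\<Sum>i<\<eta>. (- (sqrt N * dd i) / ((N + de) * sd))\<^sup>2) = N * (de - q) / (N * (N + de))"
    unfolding sd_def normalized_square[OF M] q_def dd_dd[symmetric] using N_pos
    by (simp add: sum_divide_distrib[symmetric] power_mult_distrib sum_distrib_left[symmetric])
  have q: "(- (ka * N / (N + be)))\<^sup>2 = N * q"
    by (simp add: power2_eq_square q_def)
  have "N\<^sup>2 / (N * (N + de)) + N * q / (N * (N + de)) + N * (de - q) / (N * (N + de)) = (N * (N + de)) / (N * (N + de))"
    unfolding add_divide_distrib[symmetric] by (simp add: power2_eq_square right_diff_distrib distrib_left)
  then show ?thesis
    unfolding S unfolding sd_def normalized_square[OF M] q using N_pos M by simp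
qed

text \<open>Posterior means of a symbol given the block output: with the other symbol known for
  \<open>mu1\<close> and \<open>mu2\<close>, and unknown for \<open>mu12\<close>.\<close>

definition mu1 where "mu1 x2 y = (\<Sum>i<\<eta>. a1 i * (y i - a2 i * x2)) / (N + al)"
definition mu2 where "mu2 x1 y = (\<Sum>i<\<eta>. a2 i * (y i - a1 i * x1)) / (N + be)"
definition mu12 where "mu12 y = (\<Sum>i<\<eta>. dd i * y i) / (N + de)"

definition T1 where "T1 L = (\<lambda>(x1, x2, y). \<Sum>b<L. gauss_llr sa (mu1 (x2 b) (\<lambda>i. y (b * \<eta> + i))) (x1 b))"
definition T2 where "T2 L = (\<lambda>(x1, x2, y). \<Sum>b<L. gauss_llr sb (mu2 (x1 b) (\<lambda>i. y (b * \<eta> + i))) (x2 b))"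
definition T12 where "T12 L = (\<lambda>(x1, x2, y). (\<Sum>b<L. gauss_llr sd (mu12 (\<lambda>i. y (b * \<eta> + i))) (x1 b))
    + (\<Sum>b<L. gauss_llr sb (mu2 (x1 b) (\<lambda>i. y (b * \<eta> + i))) (x2 b)))"

text \<open>Mutual informations per block, in nats: the prior deviation is one, so each term is
  minus the logarithm of a posterior deviation.\<close>

definition I1 where "I1 = ln (1 / sa)"
definition I2 where "I2 = ln (1 / sb)"
definition I12 where "I12 = ln (1 / sd) + ln (1 / sb)"

definition test :: "nat \<Rightarrow> real \<Rightarrow> (nat \<Rightarrow> real) \<times> (nat \<Rightarrow> real) \<times> (nat \<Rightarrow> real) \<Rightarrow> bool" where
  "test L \<epsilon> p \<longleftrightarrow> real L * (I1 - \<epsilon>) < T1 L p \<and> real L * (I2 - \<epsilon>) < T2 L p \<and> real L * (I12 - \<epsilon>) < T12 L p"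

definition obs :: "nat \<Rightarrow> (nat \<Rightarrow> real) \<times> (nat \<Rightarrow> real) \<times> (nat \<Rightarrow> real \<times> real \<times> real) \<Rightarrow> nat \<Rightarrow> real" where
  "obs L = (\<lambda>(x1, x2, \<omega>). \<lambda>t\<in>{..<L * \<eta>}. a1 (t mod \<eta>) * x1 (t div \<eta>) + a2 (t mod \<eta>) * x2 (t div \<eta>) + sqrt N * fst (\<omega> t))"

lemma obs_block:
  "b < L \<Longrightarrow> i < \<eta> \<Longrightarrow> obs L (x1, x2, \<omega>) (b * \<eta> + i) = a1 i * x1 b + a2 i * x2 b + sqrt N * fst (\<omega> (b * \<eta> + i))"
  using block_index_less[of b L i \<eta> "L * \<eta>"] by (simp add: obs_def)


text \<open>\<open>D1\<close> and \<open>D2\<close> concern the symbols; \<open>E1\<close>,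
  \<open>E2\<close> and \<open>E12\<close> concern the estimation errors divided by their posterior
  deviations.\<close>

definition D1 where "D1 L = block_dev \<eta> L 1 0 (\<lambda>_. 0)"
definition D2 where "D2 L = block_dev \<eta> L 0 1 (\<lambda>_. 0)"
definition E1 where "E1 L = block_dev \<eta> L (N / ((N + al) * sa)) 0 (\<lambda>i. - (sqrt N * a1 i) / ((N + al) * sa))"
definition E2 where "E2 L = block_dev \<eta> L 0 (N / ((N + be) * sb)) (\<lambda>i. - (sqrt N * a2 i) / ((N + be) * sb))"
definition E12 where "E12 L = block_dev \<eta> L (N / ((N + de) * sd)) (- (ka * N / (N + be)) / ((N + de) * sd))
    (\<lambda>i. - (sqrt N * dd i) / ((N + de) * sd))"

text \<open>The squared symbol and the squared normalised error both have mean one, so these means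
  cancel in the difference; what is left is the information plus half the difference of two
  deviations.\<close>

lemma sum_gauss_llr:
  assumes "0 < L" "\<And>b. b < L \<Longrightarrow> (x b - m b) / s = e b"
  shows "(\<Sum>b<L. gauss_llr s (m b) (x b)) = real L * ln (1 / s)
     + real L / 2 * (((\<Sum>b<L. (x b)\<^sup>2) / real L - 1) - ((\<Sum>b<L. (e b)\<^sup>2) / real L - 1))"
proof -
  have "(\<Sum>b<L. gauss_llr s (m b) (x b)) = (\<Sum>b<L. ln (1 / s) + (x b)\<^sup>2 / 2 - (e b)\<^sup>2 / 2)"
    by (intro sum.cong) (auto simp: gauss_llr_def assms(2))
  also have "\<dots> = real L * ln (1 / s) + (\<Sum>b<L. (x b)\<^sup>2) / 2 - (\<Sum>b<L. (e b)\<^sup>2) / 2"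
    by (simp add: sum.distrib sum_subtractf sum_divide_distrib)
  also have "\<dots> = real L * ln (1 / s)
     + real L / 2 * (((\<Sum>b<L. (x b)\<^sup>2) / real L - 1) - ((\<Sum>b<L. (e b)\<^sup>2) / real L - 1))"
    using assms(1) by (simp add: field_simps)
  finally show ?thesis .
qed

lemma error_form:
  assumes "0 < N + m" "s \<noteq> 0" "X = x - Q / (N + m)" "(N + m) * x - Q = R"
  shows "X / s = R / ((N + m) * s)"
proof -
  have "X = R / (N + m)" using assms(1,3,4) by (simp add: field_simps)
  then show ?thesis by simp
qed

lemma T1_obs:
  assumes "0 < L"
  shows "T1 L (x1, x2, obs L (x1, x2, \<omega>)) = real L * I1 + real L / 2 * (D1 L (x1, x2, \<omega>) - E1 L (x1, x2, \<omega>))"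
proof -
  have *: "(x1 b - mu1 (x2 b) (\<lambda>i. obs L (x1, x2, \<omega>) (b * \<eta> + i))) / sa
     = N / ((N + al) * sa) * x1 b + 0 * x2 b + (\<Sum>i<\<eta>. - (sqrt N * a1 i) / ((N + al) * sa) * fst (\<omega> (b * \<eta> + i)))" if b: "b < L" for b
  proof -
    have "(\<Sum>i<\<eta>. a1 i * (obs L (x1, x2, \<omega>) (b * \<eta> + i) - a2 i * x2 b))
        = (\<Sum>i<\<eta>. (a1 i)\<^sup>2 * x1 b + sqrt N * a1 i * fst (\<omega> (b * \<eta> + i)))"
      by (intro sum.cong refl) (simp add: obs_block[OF b], simp add: algebra_simps power2_eq_square)
    also have "\<dots> = al * x1 b + (\<Sum>i<\<eta>. sqrt N * a1 i * fst (\<omega> (b * \<eta> + i)))"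
      by (simp add: al_def sum.distrib sum_distrib_right)
    finally have "(N + al) * x1 b - (\<Sum>i<\<eta>. a1 i * (obs L (x1, x2, \<omega>) (b * \<eta> + i) - a2 i * x2 b))
        = N * x1 b - (\<Sum>i<\<eta>. sqrt N * a1 i * fst (\<omega> (b * \<eta> + i)))"
      by (simp add: distrib_right)
    from error_form[OF _ _ _ this, where s=sa, OF _ _ refl]
    have "(x1 b - mu1 (x2 b) (\<lambda>i. obs L (x1, x2, \<omega>) (b * \<eta> + i))) / sa
       = (N * x1 b - (\<Sum>i<\<eta>. sqrt N * a1 i * fst (\<omega> (b * \<eta> + i)))) / ((N + al) * sa)"
      using N_pos al_nonneg s_pos by (simp add: mu1_def)
    then show ?thesis by (simp add: diff_divide_distrib sum_divide_distrib sum_negf)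
  qed
  show ?thesis
    using sum_gauss_llr[OF assms *] by (simp add: T1_def I1_def D1_def E1_def block_dev_def)
qed

lemma T2_obs_sum:
  assumes "0 < L"
  shows "(\<Sum>b<L. gauss_llr sb (mu2 (x1 b) (\<lambda>i. obs L (x1, x2, \<omega>) (b * \<eta> + i))) (x2 b))
     = real L * ln (1 / sb) + real L / 2 * (D2 L (x1, x2, \<omega>) - E2 L (x1, x2, \<omega>))"
proof -
  have *: "(x2 b - mu2 (x1 b) (\<lambda>i. obs L (x1, x2, \<omega>) (b * \<eta> + i))) / sb
     = 0 * x1 b + N / ((N + be) * sb) * x2 b + (\<Sum>i<\<eta>. - (sqrt N * a2 i) / ((N + be) * sb) * fst (\<omega> (b * \<eta> + i)))" if b: "b < L" for b
  proof -
    have "(\<Sum>i<\<eta>. a2 i * (obs L (x1, x2, \<omega>) (b * \<eta> + i) - a1 i * x1 b))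
        = (\<Sum>i<\<eta>. (a2 i)\<^sup>2 * x2 b + sqrt N * a2 i * fst (\<omega> (b * \<eta> + i)))"
      by (intro sum.cong refl) (simp add: obs_block[OF b], simp add: algebra_simps power2_eq_square)
    also have "\<dots> = be * x2 b + (\<Sum>i<\<eta>. sqrt N * a2 i * fst (\<omega> (b * \<eta> + i)))"
      by (simp add: be_def sum.distrib sum_distrib_right)
    finally have "(N + be) * x2 b - (\<Sum>i<\<eta>. a2 i * (obs L (x1, x2, \<omega>) (b * \<eta> + i) - a1 i * x1 b))
        = N * x2 b - (\<Sum>i<\<eta>. sqrt N * a2 i * fst (\<omega> (b * \<eta> + i)))"
      by (simp add: distrib_right)
    from error_form[OF _ _ _ this, where s=sb, OF _ _ refl]
    have "(x2 b - mu2 (x1 b) (\<lambda>i. obs L (x1, x2, \<omega>) (b * \<eta> + i))) / sb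
       = (N * x2 b - (\<Sum>i<\<eta>. sqrt N * a2 i * fst (\<omega> (b * \<eta> + i)))) / ((N + be) * sb)"
      using N_pos be_nonneg s_pos by (simp add: mu2_def)
    then show ?thesis by (simp add: diff_divide_distrib sum_divide_distrib sum_negf)
  qed
  show ?thesis
    using sum_gauss_llr[OF assms *] by (simp add: D2_def E2_def block_dev_def)
qed

lemma T2_obs:
  assumes "0 < L"
  shows "T2 L (x1, x2, obs L (x1, x2, \<omega>)) = real L * I2 + real L / 2 * (D2 L (x1, x2, \<omega>) - E2 L (x1, x2, \<omega>))"
  unfolding T2_def prod.case I2_def T2_obs_sum[OF assms] ..

lemma T12_obs:
  assumes "0 < L"
  shows "T12 L (x1, x2, obs L (x1, x2, \<omega>)) = real L * I12
    + real L / 2 * (D1 L (x1, x2, \<omega>) - E12 L (x1, x2, \<omega>) + (D2 L (x1, x2, \<omega>) - E2 L (x1, x2, \<omega>)))"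
proof -
  have *: "(x1 b - mu12 (\<lambda>i. obs L (x1, x2, \<omega>) (b * \<eta> + i))) / sd
     = N / ((N + de) * sd) * x1 b + - (ka * N / (N + be)) / ((N + de) * sd) * x2 b
       + (\<Sum>i<\<eta>. - (sqrt N * dd i) / ((N + de) * sd) * fst (\<omega> (b * \<eta> + i)))" if b: "b < L" for b
  proof -
    \<comment> \<open>Correlating with \<open>dd\<close> passes \<open>x1\<close> with gain
      \<open>de\<close> and leaves a residual of \<open>x2\<close>, which remains in the error as
      noise.\<close>
    have "(\<Sum>i<\<eta>. dd i * obs L (x1, x2, \<omega>) (b * \<eta> + i))
        = (\<Sum>i<\<eta>. (dd i * a1 i) * x1 b + (dd i * a2 i) * x2 b + sqrt N * dd i * fst (\<omega> (b * \<eta> + i)))"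
      by (intro sum.cong refl) (simp add: obs_block[OF b], simp add: algebra_simps)
    also have "\<dots> = de * x1 b + ka * N / (N + be) * x2 b + (\<Sum>i<\<eta>. sqrt N * dd i * fst (\<omega> (b * \<eta> + i)))"
      unfolding sum.distrib sum_distrib_right[symmetric] dd_a1 dd_a2 ..
    finally have "(N + de) * x1 b - (\<Sum>i<\<eta>. dd i * obs L (x1, x2, \<omega>) (b * \<eta> + i))
        = N * x1 b - ka * N / (N + be) * x2 b - (\<Sum>i<\<eta>. sqrt N * dd i * fst (\<omega> (b * \<eta> + i)))"
      by (simp add: distrib_right)
    from error_form[OF _ _ _ this, where s=sd, OF _ _ refl]
    have "(x1 b - mu12 (\<lambda>i. obs L (x1, x2, \<omega>) (b * \<eta> + i))) / sd
       = (N * x1 b - ka * N / (N + be) * x2 b - (\<Sum>i<\<eta>. sqrt N * dd i * fst (\<omega> (b * \<eta> + i)))) / ((N + de) * sd)"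
      using N_pos de_nonneg s_pos by (simp add: mu12_def)
    then show ?thesis by (simp add: diff_divide_distrib sum_divide_distrib sum_negf)
  qed
  have "(\<Sum>b<L. gauss_llr sd (mu12 (\<lambda>i. obs L (x1, x2, \<omega>) (b * \<eta> + i))) (x1 b))
     = real L * ln (1 / sd) + real L / 2 * (D1 L (x1, x2, \<omega>) - E12 L (x1, x2, \<omega>))"
    using sum_gauss_llr[OF assms *] by (simp add: D1_def E12_def block_dev_def)
  then show ?thesis
    unfolding T12_def prod.case T2_obs_sum[OF assms] I12_def by (simp add: distrib_left)
qed

text \<open>The factor 4 comes from the threshold \<open>\<epsilon> / 2\<close> for each deviation:
  \<open>T12\<close> contains four of them with weight \<open>L / 2\<close>, so it then drops by
  less than \<open>L * \<epsilon>\<close>, and \<open>T1\<close> and \<open>T2\<close> drop by less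
  still. Failure thus makes some deviation large, in the form needed for a second-moment
  bound.\<close>

lemma test_obs:
  assumes L: "0 < L" and e: "0 < \<epsilon>" and no: "\<not> test L \<epsilon> (x1, x2, obs L (x1, x2, \<omega>))"
  defines "p \<equiv> (x1, x2, \<omega>)"
  shows "1 \<le> 4 / \<epsilon>\<^sup>2 * ((D1 L p)\<^sup>2 + (D2 L p)\<^sup>2 + (E1 L p)\<^sup>2 + (E2 L p)\<^sup>2 + (E12 L p)\<^sup>2)"
proof (rule ccontr)
  define S where "S = (D1 L p)\<^sup>2 + (D2 L p)\<^sup>2 + (E1 L p)\<^sup>2 + (E2 L p)\<^sup>2 + (E12 L p)\<^sup>2"
  assume "\<not> ?thesis"
  then have "4 * S / \<epsilon>\<^sup>2 < 1" unfolding S_def[symmetric] by simp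
  then have S: "S < (\<epsilon> / 2)\<^sup>2" using e by (simp add: pos_divide_less_eq power_divide)
  have small: "\<bar>x\<bar> < \<epsilon> / 2" if "x\<^sup>2 \<le> S" for x
    using that S e by (intro power_less_imp_less_base[of "\<bar>x\<bar>" 2 "\<epsilon> / 2"]) auto
  have "\<bar>D1 L p\<bar> < \<epsilon> / 2" "\<bar>D2 L p\<bar> < \<epsilon> / 2" "\<bar>E1 L p\<bar> < \<epsilon> / 2" "\<bar>E2 L p\<bar> < \<epsilon> / 2" "\<bar>E12 L p\<bar> < \<epsilon> / 2"
    by (rule small, simp add: S_def)+
  then have "- (2 * \<epsilon>) < D1 L p - E1 L p" "- (2 * \<epsilon>) < D2 L p - E2 L p" "- (2 * \<epsilon>) < D1 L p - E12 L p + (D2 L p - E2 L p)"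
    using e by linarith+
  moreover have "real L * (I - \<epsilon>) < real L * I + real L / 2 * X" if "- (2 * \<epsilon>) < X" for I X
  proof -
    have "real L / 2 * (- (2 * \<epsilon>)) < real L / 2 * X" using L by (intro mult_strict_left_mono[OF that]) simp
    then show ?thesis by (simp add: right_diff_distrib)
  qed
  ultimately have "test L \<epsilon> (x1, x2, obs L (x1, x2, \<omega>))"
    unfolding test_def T1_obs[OF L] T2_obs[OF L] T12_obs[OF L] unfolding p_def[symmetric] by blast
  then show False using no by simp
qed

section \<open>Probability of test failure and choice of codebooks\<close>

abbreviation obs_space where "obs_space L \<equiv> PiM {..<L * \<eta>} (\<lambda>_. borel :: real measure)"

lemma measurable_obs:
  assumes "L * \<eta> \<le> n"
  shows "obs L \<in> measurable (code_space L n) (obs_space L)"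
proof -
  have 1: "t < L * \<eta> \<Longrightarrow> t div \<eta> < L" for t using less_mult_imp_div_less[of t L \<eta>] by simp
  show ?thesis
    unfolding obs_def split_beta'
    using assms by (intro measurable_restrict borel_measurable_add borel_measurable_times borel_measurable_const measurable_code_space_components) (auto dest: 1)
qed

lemma measurable_test: "Measurable.pred (std_block L \<Otimes>\<^sub>M (std_block L \<Otimes>\<^sub>M obs_space L)) (test L \<epsilon>)"
proof -
  let ?M = "std_block L \<Otimes>\<^sub>M (std_block L \<Otimes>\<^sub>M obs_space L)"
  have y: "(\<lambda>p. snd (snd p) (b * \<eta> + i)) \<in> borel_measurable ?M" if "b < L" "i < \<eta>" for b i
    using measurable_compose[OF measurable_snd measurable_compose[OF measurable_snd measurable_component_singleton[of "b * \<eta> + i" "{..<L * \<eta>}" "\<lambda>_. borel"]]]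
      block_index_less[OF that order_refl] by auto
  have [measurable]: "T1 L \<in> borel_measurable ?M"
    unfolding T1_def split_beta' mu1_def
    by (intro borel_measurable_sum borel_measurable_gauss_llr borel_measurable_divide borel_measurable_times borel_measurable_diff
        borel_measurable_const measurable_code_space_components y) auto
  have [measurable]: "T2 L \<in> borel_measurable ?M"
    unfolding T2_def split_beta' mu2_def
    by (intro borel_measurable_sum borel_measurable_gauss_llr borel_measurable_divide borel_measurable_times borel_measurable_diff
        borel_measurable_const measurable_code_space_components y) auto
  have [measurable]: "T12 L \<in> borel_measurable ?M"
    unfolding T12_def split_beta' mu12_def mu2_def
    by (intro borel_measurable_add borel_measurable_sum borel_measurable_gauss_llr borel_measurable_divide borel_measurable_times borel_measurable_diff
        borel_measurable_const measurable_code_space_components y) auto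
  show ?thesis unfolding test_def by measurable
qed

text \<open>The constant 40 is the factor 4 of \<open>test_obs\<close> times five deviations with
  second moment \<open>2 / L\<close> each.\<close>

lemma test_fail_bound:
  assumes L: "0 < L" "L * \<eta> \<le> n" and e: "0 < \<epsilon>"
  shows "(\<integral>\<^sup>+x1. \<integral>\<^sup>+x2. \<integral>\<^sup>+\<omega>. indicator {\<omega>. \<not> test L \<epsilon> (x1, x2, obs L (x1, x2, \<omega>))} \<omega> \<partial>noise_space n \<partial>std_block L \<partial>std_block L)
     \<le> ennreal (40 / (\<epsilon>\<^sup>2 * real L))"
proof -
  let ?P = "code_space L n"
  let ?S = "\<lambda>p. ennreal ((D1 L p)\<^sup>2) + ennreal ((D2 L p)\<^sup>2) + ennreal ((E1 L p)\<^sup>2) + ennreal ((E2 L p)\<^sup>2) + ennreal ((E12 L p)\<^sup>2)"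
  have m: "(\<lambda>p. ennreal ((D1 L p)\<^sup>2)) \<in> borel_measurable ?P" "(\<lambda>p. ennreal ((D2 L p)\<^sup>2)) \<in> borel_measurable ?P"
    "(\<lambda>p. ennreal ((E1 L p)\<^sup>2)) \<in> borel_measurable ?P" "(\<lambda>p. ennreal ((E2 L p)\<^sup>2)) \<in> borel_measurable ?P"
    "(\<lambda>p. ennreal ((E12 L p)\<^sup>2)) \<in> borel_measurable ?P"
    unfolding D1_def D2_def E1_def E2_def E12_def
    using measurable_block_dev[OF L(2)] by (auto intro!: measurable_compose[OF _ measurable_ennreal] borel_measurable_power)
  have i0: "(\<integral>\<^sup>+p. ennreal ((D1 L p)\<^sup>2) \<partial>?P) = ennreal (2 / real L)"
    unfolding D1_def by (rule nn_integral_block_dev_square[OF _ L]) simp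
  have i1: "(\<integral>\<^sup>+p. ennreal ((D2 L p)\<^sup>2) \<partial>?P) = ennreal (2 / real L)"
    unfolding D2_def by (rule nn_integral_block_dev_square[OF _ L]) simp
  have i2: "(\<integral>\<^sup>+p. ennreal ((E1 L p)\<^sup>2) \<partial>?P) = ennreal (2 / real L)"
    unfolding E1_def by (rule nn_integral_block_dev_square[OF unit_form1 L])
  have i3: "(\<integral>\<^sup>+p. ennreal ((E2 L p)\<^sup>2) \<partial>?P) = ennreal (2 / real L)"
    unfolding E2_def by (rule nn_integral_block_dev_square[OF unit_form2 L])
  have i4: "(\<integral>\<^sup>+p. ennreal ((E12 L p)\<^sup>2) \<partial>?P) = ennreal (2 / real L)"
    unfolding E12_def by (rule nn_integral_block_dev_square[OF unit_form12 L])
  have "(\<integral>\<^sup>+x1. \<integral>\<^sup>+x2. \<integral>\<^sup>+\<omega>. indicator {\<omega>. \<not> test L \<epsilon> (x1, x2, obs L (x1, x2, \<omega>))} \<omega> \<partial>noise_space n \<partial>std_block L \<partial>std_block L)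
     \<le> (\<integral>\<^sup>+x1. \<integral>\<^sup>+x2. \<integral>\<^sup>+\<omega>. ennreal (4 / \<epsilon>\<^sup>2) * ?S (x1, x2, \<omega>) \<partial>noise_space n \<partial>std_block L \<partial>std_block L)"
  proof (intro nn_integral_mono)
    fix x1 x2 \<omega>
    show "indicator {\<omega>. \<not> test L \<epsilon> (x1, x2, obs L (x1, x2, \<omega>))} \<omega> \<le> ennreal (4 / \<epsilon>\<^sup>2) * ?S (x1, x2, \<omega>)"
    proof (cases "test L \<epsilon> (x1, x2, obs L (x1, x2, \<omega>))")
      case False
      have "ennreal 1 \<le> ennreal (4 / \<epsilon>\<^sup>2 * ((D1 L (x1, x2, \<omega>))\<^sup>2 + (D2 L (x1, x2, \<omega>))\<^sup>2 + (E1 L (x1, x2, \<omega>))\<^sup>2 + (E2 L (x1, x2, \<omega>))\<^sup>2 + (E12 L (x1, x2, \<omega>))\<^sup>2))"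
        by (rule ennreal_leI) (rule test_obs[OF L(1) e False])
      also have "\<dots> = ennreal (4 / \<epsilon>\<^sup>2) * ?S (x1, x2, \<omega>)"
        by (subst ennreal_mult) simp_all
      finally show ?thesis using False by (simp add: indicator_def)
    qed simp
  qed
  also have "\<dots> = (\<integral>\<^sup>+p. ennreal (4 / \<epsilon>\<^sup>2) * ?S p \<partial>?P)"
    using m by (intro nn_integral_code_space[symmetric]) auto
  also have "\<dots> = ennreal (4 / \<epsilon>\<^sup>2) * (ennreal (2 / real L) + ennreal (2 / real L) + ennreal (2 / real L) + ennreal (2 / real L) + ennreal (2 / real L))"
    using m by (simp add: nn_integral_cmult nn_integral_add i0 i1 i2 i3 i4)
  also have "\<dots> = ennreal (4 / \<epsilon>\<^sup>2) * ennreal (10 / real L)"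
    by (simp add: add_divide_distrib[symmetric] flip: ennreal_plus)
  also have "\<dots> = ennreal (40 / (\<epsilon>\<^sup>2 * real L))"
    by (subst ennreal_mult[symmetric]) simp_all
  finally show ?thesis .
qed

text \<open>Each kind of error is charged to the one test whose posterior covers exactly the wrong
  entries: \<open>T1\<close> or \<open>T2\<close> for a single wrong entry, \<open>T12\<close> for
  two.\<close>

lemma codebook_exists:
  assumes L: "0 < L" "L * \<eta> \<le> n" and e: "0 < \<epsilon>" and k: "0 < k1" "0 < k2"
    and bound: "40 / (\<epsilon>\<^sup>2 * real L) + real (k1 - 1) * exp (- (real L * (I1 - \<epsilon>))) + real (k2 - 1) * exp (- (real L * (I2 - \<epsilon>)))
      + real ((k1 - 1) * (k2 - 1)) * exp (- (real L * (I12 - \<epsilon>))) + 8 / real L < r"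
  shows "\<exists>c1 c2. ennreal (1 / (real k1 * real k2)) * (\<Sum>m1<k1. \<Sum>m2<k2.
       emeasure (noise_space n) {\<omega> \<in> space (noise_space n). \<not> decodes (test L \<epsilon>) k1 k2 c1 c2 (obs L (c1 m1, c2 m2, \<omega>)) m1 m2}
       + ennreal (power_dev L (c1 m1, c2 m2))) < ennreal r \<and> (\<forall>m<k1. c1 m \<in> space (std_block L)) \<and> (\<forall>m<k2. c2 m \<in> space (std_block L))"
proof -
  have "\<exists>c1 c2. (\<forall>m<k1. c1 m \<in> space (std_block L)) \<and> (\<forall>m<k2. c2 m \<in> space (std_block L)) \<and>
    ennreal (1 / (real k1 * real k2)) * (\<Sum>m1<k1. \<Sum>m2<k2.
       emeasure (noise_space n) {\<omega> \<in> space (noise_space n). \<not> decodes (test L \<epsilon>) k1 k2 c1 c2 (obs L (c1 m1, c2 m2, \<omega>)) m1 m2}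
       + ennreal (power_dev L (c1 m1, c2 m2))) < ennreal r"
  proof (rule random_coding_MAC[where ?M1.0="std_block L" and ?M2.0="std_block L" and \<Omega>="noise_space n" and MY="obs_space L"
        and c="\<lambda>p. ennreal (power_dev L p)" and Y="obs L" and A="test L \<epsilon>"
        and ?e0.0="ennreal (40 / (\<epsilon>\<^sup>2 * real L))" and ?e1.0="ennreal (exp (- (real L * (I1 - \<epsilon>))))"
        and ?e2.0="ennreal (exp (- (real L * (I2 - \<epsilon>))))" and ?e12.0="ennreal (exp (- (real L * (I12 - \<epsilon>))))" and ec="ennreal (8 / real L)"])
    show "(\<lambda>p. ennreal (power_dev L p)) \<in> borel_measurable (std_block L \<Otimes>\<^sub>M std_block L)"
      using measurable_power_dev by simp
    show "(\<integral>\<^sup>+x1. \<integral>\<^sup>+x2. \<integral>\<^sup>+\<omega>. indicator {\<omega>. \<not> test L \<epsilon> (x1, x2, obs L (x1, x2, \<omega>))} \<omega> \<partial>noise_space n \<partial>std_block L \<partial>std_block L)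
     \<le> ennreal (40 / (\<epsilon>\<^sup>2 * real L))" by (rule test_fail_bound[OF L e])
    show "(\<integral>\<^sup>+x1. indicator {x1. test L \<epsilon> (x1, x2, y)} x1 \<partial>std_block L) \<le> ennreal (exp (- (real L * (I1 - \<epsilon>))))" for x2 y
    proof -
      have "(\<integral>\<^sup>+x1. indicator {x1. test L \<epsilon> (x1, x2, y)} x1 \<partial>std_block L)
         \<le> (\<integral>\<^sup>+x1. indicator {x1. real L * (I1 - \<epsilon>) < T1 L (x1, x2, y)} x1 \<partial>std_block L)"
        by (intro nn_integral_mono) (auto simp: indicator_def test_def)
      also have "\<dots> \<le> ennreal (exp (- (real L * (I1 - \<epsilon>))))"
        unfolding T1_def prod.case by (rule gauss_llr_tail[OF s_pos(1)])
      finally show ?thesis .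
    qed
    show "(\<integral>\<^sup>+x2. indicator {x2. test L \<epsilon> (x1, x2, y)} x2 \<partial>std_block L) \<le> ennreal (exp (- (real L * (I2 - \<epsilon>))))" for x1 y
    proof -
      have "(\<integral>\<^sup>+x2. indicator {x2. test L \<epsilon> (x1, x2, y)} x2 \<partial>std_block L)
         \<le> (\<integral>\<^sup>+x2. indicator {x2. real L * (I2 - \<epsilon>) < T2 L (x1, x2, y)} x2 \<partial>std_block L)"
        by (intro nn_integral_mono) (auto simp: indicator_def test_def)
      also have "\<dots> \<le> ennreal (exp (- (real L * (I2 - \<epsilon>))))"
        unfolding T2_def prod.case by (rule gauss_llr_tail[OF s_pos(2)])
      finally show ?thesis .
    qed
    show "(\<integral>\<^sup>+x1. \<integral>\<^sup>+x2. indicator {x2. test L \<epsilon> (x1, x2, y)} x2 \<partial>std_block L \<partial>std_block L) \<le> ennreal (exp (- (real L * (I12 - \<epsilon>))))" for y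
    proof -
      have "(\<integral>\<^sup>+x1. \<integral>\<^sup>+x2. indicator {x2. test L \<epsilon> (x1, x2, y)} x2 \<partial>std_block L \<partial>std_block L)
         \<le> (\<integral>\<^sup>+x1. \<integral>\<^sup>+x2. indicator {x2. real L * (I12 - \<epsilon>) < T12 L (x1, x2, y)} x2 \<partial>std_block L \<partial>std_block L)"
        by (intro nn_integral_mono) (auto simp: indicator_def test_def)
      also have "\<dots> \<le> ennreal (exp (- (real L * (I12 - \<epsilon>))))"
        unfolding T12_def prod.case
        by (rule gauss_llr_tail2[OF s_pos(3,2), where \<mu>'="\<lambda>b x1. mu2 (x1 b) (\<lambda>i. y (b * \<eta> + i))"])
      finally show ?thesis .
    qed
    show "(\<integral>\<^sup>+x1. \<integral>\<^sup>+x2. ennreal (power_dev L (x1, x2)) \<partial>std_block L \<partial>std_block L) \<le> ennreal (8 / real L)"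
      by (simp add: nn_integral_power_dev[OF L(1)])
    have "ennreal (40 / (\<epsilon>\<^sup>2 * real L)) + of_nat (k1 - 1) * ennreal (exp (- (real L * (I1 - \<epsilon>)))) + of_nat (k2 - 1) * ennreal (exp (- (real L * (I2 - \<epsilon>))))
      + of_nat ((k1 - 1) * (k2 - 1)) * ennreal (exp (- (real L * (I12 - \<epsilon>)))) + ennreal (8 / real L)
      = ennreal (40 / (\<epsilon>\<^sup>2 * real L) + real (k1 - 1) * exp (- (real L * (I1 - \<epsilon>))) + real (k2 - 1) * exp (- (real L * (I2 - \<epsilon>)))
      + real ((k1 - 1) * (k2 - 1)) * exp (- (real L * (I12 - \<epsilon>))) + 8 / real L)"
      unfolding ennreal_of_nat_eq_real_of_nat
      by (simp add: ennreal_plus ennreal_mult del: of_nat_mult of_nat_diff)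
    also have "\<dots> < ennreal r"
      using bound by (intro ennreal_lessI) (auto intro: le_less_trans[rotated, OF bound] add_nonneg_nonneg)
    finally show "ennreal (40 / (\<epsilon>\<^sup>2 * real L)) + of_nat (k1 - 1) * ennreal (exp (- (real L * (I1 - \<epsilon>)))) + of_nat (k2 - 1) * ennreal (exp (- (real L * (I2 - \<epsilon>))))
      + of_nat ((k1 - 1) * (k2 - 1)) * ennreal (exp (- (real L * (I12 - \<epsilon>)))) + ennreal (8 / real L) < ennreal r" .
  qed (use prob_space_std_block prob_space_noise_space measurable_obs[OF L(2)] measurable_test k in auto)
  then show ?thesis by blast
qed

end

section \<open>Linear feedback and the covariance of the inputs\<close>

lemma mult_mat_vec_index:
  fixes A :: "real mat"
  assumes "A \<in> carrier_mat n m" "v \<in> carrier_vec m" "i < n"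
  shows "(A *\<^sub>v v) $ i = (\<Sum>j<m. A $$ (i, j) * v $ j)"
  using assms by (auto simp: scalar_prod_def atLeast0LessThan intro!: sum.cong)

lemma KW_mat_entries [simp]:
  "KW_mat s1 s2 rho $$ (0,0) = s1\<^sup>2" "KW_mat s1 s2 rho $$ (0,1) = rho * s1 * s2"
  "KW_mat s1 s2 rho $$ (1,0) = rho * s1 * s2" "KW_mat s1 s2 rho $$ (1,1) = s2\<^sup>2"
  "KW_mat s1 s2 rho $$ (0,Suc 0) = rho * s1 * s2"
  "KW_mat s1 s2 rho $$ (Suc 0,0) = rho * s1 * s2" "KW_mat s1 s2 rho $$ (Suc 0,Suc 0) = s2\<^sup>2"
  by (simp_all add: KW_mat_def)

text \<open>For \<open>s1 = 0\<close> the entry \<open>rho * s1 * s2\<close> vanishes, so the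
  default value 0 of \<open>chol21\<close> is correct. Otherwise semidefiniteness makes the argument
  of the square root in \<open>chol22\<close> nonnegative.\<close>

lemma cholesky_KW_mat:
  assumes "psd_mat (KW_mat s1 s2 rho)"
  defines "K \<equiv> KW_mat s1 s2 rho"
  shows "(chol11 K)\<^sup>2 = K $$ (0,0)" "chol11 K * chol21 K = K $$ (0,1)" "chol21 K * chol11 K = K $$ (1,0)"
    "(chol21 K)\<^sup>2 + (chol22 K)\<^sup>2 = K $$ (1,1)"
proof -
  show "(chol11 K)\<^sup>2 = K $$ (0,0)" "chol11 K * chol21 K = K $$ (0,1)" "chol21 K * chol11 K = K $$ (1,0)"
    by (auto simp: chol11_def chol21_def K_def)
  define r where "r = rho * s1 * s2"
  \<comment> \<open>On the vector \<open>(- r, s1^2)\<close> the quadratic form takes the value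
    \<open>s1^2\<close> times the determinant.\<close>
  define x where "x = vec 2 (\<lambda>i. if i = 0 then - r else s1\<^sup>2)"
  have KW: "KW_mat s1 s2 rho \<in> carrier_mat 2 2" by (simp add: KW_mat_def)
  have x: "x \<in> carrier_vec 2" "x $ 0 = - r" "x $ 1 = s1\<^sup>2" by (auto simp: x_def)
  have two: "(\<Sum>i<2. f i) = f 0 + f 1" for f :: "nat \<Rightarrow> real" by (simp add: numeral_2_eq_2)
  have "0 \<le> x \<bullet> (KW_mat s1 s2 rho *\<^sub>v x)"
    using assms(1) KW x(1) unfolding psd_mat_def by auto
  also have "\<dots> = (\<Sum>i<2. x $ i * (KW_mat s1 s2 rho *\<^sub>v x) $ i)"
    using KW by (simp add: scalar_prod_def lessThan_atLeast0)
  also have "\<dots> = (\<Sum>i<2. x $ i * (\<Sum>j<2. KW_mat s1 s2 rho $$ (i, j) * x $ j))"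
    by (intro sum.cong refl arg_cong2[where f="(*)"] mult_mat_vec_index[OF KW x(1)]) simp
  also have "\<dots> = s1\<^sup>2 * (s1\<^sup>2 * s2\<^sup>2 - r\<^sup>2)"
    unfolding two x KW_mat_entries r_def[symmetric] by (simp add: power2_eq_square algebra_simps)
  finally have *: "0 \<le> s1\<^sup>2 * (s1\<^sup>2 * s2\<^sup>2 - r\<^sup>2)" .
  have "0 \<le> s2\<^sup>2 - (chol21 K)\<^sup>2"
  proof (cases "s1 = 0")
    case False
    then have p: "0 < s1\<^sup>2" by simp
    then have "r\<^sup>2 \<le> s2\<^sup>2 * s1\<^sup>2" using * by (simp add: zero_le_mult_iff mult.commute)
    then have "r\<^sup>2 / s1\<^sup>2 \<le> s2\<^sup>2" using p by (simp only: pos_divide_le_eq)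
    moreover have "(chol21 K)\<^sup>2 = r\<^sup>2 / s1\<^sup>2"
      using False by (simp add: chol21_def K_def power_divide r_def)
    ultimately show ?thesis by simp
  qed (simp add: chol21_def K_def)
  then show "(chol21 K)\<^sup>2 + (chol22 K)\<^sup>2 = K $$ (1,1)" by (simp add: chol22_def K_def)
qed

text \<open>The block matrix is not triangular, but a kernel vector \<open>(v1, v2)\<close>
  satisfies \<open>v1 = B1 s\<close> and \<open>v2 = B2 s\<close> with \<open>s = v1 + v2\<close>.
  Hence \<open>s = (B1 + B2) s\<close> with a strictly lower triangular matrix, and
  \<open>s = 0\<close> by forward substitution.\<close>

lemma feedback_matrix_inverse:
  assumes "strictly_lower e B1" "strictly_lower e B2"
  obtains Mi where "mat_inverse (1\<^sub>m (2 * e) - four_block_mat B1 B1 B2 B2) = Some Mi"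
    "Mi \<in> carrier_mat (2 * e) (2 * e)" "Mi * (1\<^sub>m (2 * e) - four_block_mat B1 B1 B2 B2) = 1\<^sub>m (2 * e)"
proof -
  have B: "B1 \<in> carrier_mat e e" "B2 \<in> carrier_mat e e" using assms by (auto simp: strictly_lower_def)
  let ?F = "four_block_mat B1 B1 B2 B2"
  have F: "?F \<in> carrier_mat (2 * e) (2 * e)" using B four_block_carrier_mat[of B1 e e B2 e e] by (simp add: mult_2)
  let ?A = "1\<^sub>m (2 * e) - ?F"
  have A: "?A \<in> carrier_mat (2 * e) (2 * e)" by (rule minus_carrier_mat[OF F])
  have "det ?A \<noteq> 0"
  proof
    assume "det ?A = 0"
    then obtain v where v: "v \<in> carrier_vec (2 * e)" "v \<noteq> 0\<^sub>v (2 * e)" "?A *\<^sub>v v = 0\<^sub>v (2 * e)"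
      using det_0_iff_vec_prod_zero[OF A] by auto
    define v1 v2 where "v1 = vec_first v e" and "v2 = vec_last v e"
    have v12: "v1 \<in> carrier_vec e" "v2 \<in> carrier_vec e" "v = v1 @\<^sub>v v2"
      using v(1) by (auto simp: v1_def v2_def mult_2)
    have "v - ?F *\<^sub>v v = 0\<^sub>v (2 * e)"
      using v(3) minus_mult_distrib_mat_vec[OF one_carrier_mat F v(1)] one_mult_mat_vec[OF v(1)] by simp
    then have "(v - ?F *\<^sub>v v) $ i = 0" if "i < 2 * e" for i using that by simp
    then have vF: "v $ i = (?F *\<^sub>v v) $ i" if "i < 2 * e" for i using that F v(1) by fastforce
    define s where "s = v1 + v2"
    have s: "s \<in> carrier_vec e" using v12 by (simp add: s_def)
    have Fv: "?F *\<^sub>v v = (B1 *\<^sub>v s) @\<^sub>v (B2 *\<^sub>v s)"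
      unfolding v12(3) s_def using B v12
      by (subst four_block_mat_mult_vec[where ?nr1.0=e and ?nr2.0=e and ?nc1.0=e and ?nc2.0=e]) (auto simp: mult_add_distrib_mat_vec)
    have v1i: "v1 $ i = (B1 *\<^sub>v s) $ i" "v2 $ i = (B2 *\<^sub>v s) $ i" if "i < e" for i
      using vF[of i] vF[of "i + e"] that B v12 unfolding Fv by (auto simp: v12(3))
    have s0: "i < e \<Longrightarrow> s $ i = 0" for i
    proof (induction i rule: less_induct)
      case (less i)
      have "B1 $$ (i, j) * s $ j = 0" "B2 $$ (i, j) * s $ j = 0" if "j < e" for j
        using less that assms by (cases "j < i"; auto simp: strictly_lower_def)+
      then have "(B1 *\<^sub>v s) $ i = 0" "(B2 *\<^sub>v s) $ i = 0"
        using B s less(2) by (auto simp: scalar_prod_def intro!: sum.neutral)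
      then show ?case using v1i[OF less(2)] less(2) v12 by (simp add: s_def)
    qed
    then have "s = 0\<^sub>v e" using s by (intro eq_vecI) auto
    then have "v1 $ i = 0" "v2 $ i = 0" if "i < e" for i using v1i[OF that] B that by auto
    then have "v = 0\<^sub>v (2 * e)" using v12 by (intro eq_vecI) (auto simp: mult_2)
    then show False using v(2) by simp
  qed
  then have "?A \<in> Units (ring_mat TYPE(real) (2 * e) ())"
    using det_non_zero_imp_unit[OF A] by simp
  then obtain Mi where "mat_inverse ?A = Some Mi" using mat_inverse(1)[OF A, of "()"] by (cases "mat_inverse ?A") auto
  with mat_inverse(2)[OF A this] show ?thesis by (intro that) auto
qed

lemma mult_gram_transpose:
  fixes M A :: "real mat"
  assumes "M \<in> carrier_mat n m" "A \<in> carrier_mat m k"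
  shows "M * (A * A\<^sup>T) * M\<^sup>T = (M * A) * (M * A)\<^sup>T"
proof -
  have "M * (A * A\<^sup>T) = M * A * A\<^sup>T" using assms by (intro assoc_mult_mat[symmetric]) auto
  then have "M * (A * A\<^sup>T) * M\<^sup>T = M * A * (A\<^sup>T * M\<^sup>T)"
    using assms assoc_mult_mat[of "M * A" n k "A\<^sup>T" m "M\<^sup>T" n] by simp
  then show ?thesis by (simp add: transpose_mult[OF assms])
qed

lemma gram_carrier: "A \<in> carrier_mat n k \<Longrightarrow> A * A\<^sup>T \<in> carrier_mat n n"
  by auto

lemma gram_diag:
  fixes A :: "real mat"
  assumes "A \<in> carrier_mat n k" "i < n"
  shows "(A * A\<^sup>T) $$ (i, i) = (\<Sum>j<k. (A $$ (i, j))\<^sup>2)"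
  using assms by (auto simp: scalar_prod_def power2_eq_square atLeast0LessThan intro!: sum.cong)

text \<open>\<open>Ch\<close> is a block Cholesky factor of the feedback-noise covariance, so every
  part of \<open>Sigma_mat\<close> is a Gram matrix, up to the factor \<open>N\<close>. The diagonal
  becomes a sum of squared gains from independent Gaussian sources to the inputs.\<close>

lemma Sigma_mat_gram:
  fixes a1 a2 :: "real vec"
  assumes psd: "psd_mat (KW_mat s1 s2 rho)" and B: "strictly_lower e B1" "strictly_lower e B2"
  defines "K \<equiv> KW_mat s1 s2 rho"
  defines "Ad \<equiv> four_block_mat (mat_of_cols e [a1]) (0\<^sub>m e 1) (0\<^sub>m e 1) (mat_of_cols e [a2])"
  defines "Bd \<equiv> four_block_mat B1 (0\<^sub>m e e) (0\<^sub>m e e) B2"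
  defines "Ch \<equiv> four_block_mat (chol11 K \<cdot>\<^sub>m 1\<^sub>m e) (0\<^sub>m e e) (chol21 K \<cdot>\<^sub>m 1\<^sub>m e) (chol22 K \<cdot>\<^sub>m 1\<^sub>m e)"
  assumes Mi: "mat_inverse (1\<^sub>m (2 * e) - four_block_mat B1 B1 B2 B2) = Some Mi" "Mi \<in> carrier_mat (2 * e) (2 * e)"
    and i: "i < 2 * e"
  shows "Sigma_mat N K e a1 a2 B1 B2 $$ (i, i) =
    (\<Sum>j<2. ((Mi * Ad) $$ (i, j))\<^sup>2) + N * (\<Sum>j<e. ((Mi * (B1 @\<^sub>r B2)) $$ (i, j))\<^sup>2) + (\<Sum>j<2*e. ((Mi * (Bd * Ch)) $$ (i, j))\<^sup>2)"
proof -
  have Bc: "B1 \<in> carrier_mat e e" "B2 \<in> carrier_mat e e" using B by (auto simp: strictly_lower_def)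
  let ?KI = "four_block_mat (K $$ (0,0) \<cdot>\<^sub>m 1\<^sub>m e) (K $$ (0,1) \<cdot>\<^sub>m 1\<^sub>m e) (K $$ (1,0) \<cdot>\<^sub>m 1\<^sub>m e) (K $$ (1,1) \<cdot>\<^sub>m 1\<^sub>m e)"
  have Bt: "B1 @\<^sub>r B2 \<in> carrier_mat (2 * e) e" using Bc carrier_append_rows[of B1 e e B2 e] by (simp add: mult_2)
  have Ad: "Ad \<in> carrier_mat (2 * e) 2"
    unfolding Ad_def using four_block_carrier_mat[of "mat_of_cols e [a1]" e 1 "mat_of_cols e [a2]" e 1]
      mat_of_cols_carrier(1)[of e "[a1]"] mat_of_cols_carrier(1)[of e "[a2]"] by (simp add: mult_2 numeral_2_eq_2)
  have Bd: "Bd \<in> carrier_mat (2 * e) (2 * e)"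
    unfolding Bd_def using four_block_carrier_mat[of B1 e e B2 e e] Bc by (simp add: mult_2)
  have Ch: "Ch \<in> carrier_mat (2 * e) (2 * e)"
    unfolding Ch_def using four_block_carrier_mat[of "chol11 K \<cdot>\<^sub>m 1\<^sub>m e" e e "chol22 K \<cdot>\<^sub>m 1\<^sub>m e" e e] by (simp add: mult_2)
  have sm: "(x \<cdot>\<^sub>m 1\<^sub>m e) * (y \<cdot>\<^sub>m 1\<^sub>m e) = (x * y) \<cdot>\<^sub>m 1\<^sub>m e" for x y :: real
    by (rule eq_matI) (auto simp: scalar_prod_def if_distrib[of "\<lambda>x. x * _"] if_distrib[of "\<lambda>x. _ * x"] cong: if_cong)
  have sa: "(x \<cdot>\<^sub>m 1\<^sub>m e) + (y \<cdot>\<^sub>m 1\<^sub>m e) = (x + y) \<cdot>\<^sub>m 1\<^sub>m e" for x y :: real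
    by (rule eq_matI) (auto simp: algebra_simps)
  have st: "(x \<cdot>\<^sub>m 1\<^sub>m e)\<^sup>T = x \<cdot>\<^sub>m 1\<^sub>m e" for x :: real
    by (rule eq_matI) auto
  let ?c11 = "chol11 K \<cdot>\<^sub>m 1\<^sub>m e" and ?c21 = "chol21 K \<cdot>\<^sub>m 1\<^sub>m e" and ?c22 = "chol22 K \<cdot>\<^sub>m 1\<^sub>m e" and ?z = "0\<^sub>m e e :: real mat"
  have cc: "?c11 \<in> carrier_mat e e" "?c21 \<in> carrier_mat e e" "?c22 \<in> carrier_mat e e" "?z \<in> carrier_mat e e" by auto
  have CT: "Ch\<^sup>T = four_block_mat ?c11 ?c21 ?z ?c22"
    unfolding Ch_def transpose_four_block_mat[OF cc(1,4,2,3)] st by simp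
  have "Ch * Ch\<^sup>T = four_block_mat (?c11 * ?c11 + ?z * ?z) (?c11 * ?c21 + ?z * ?c22) (?c21 * ?c11 + ?c22 * ?z) (?c21 * ?c21 + ?c22 * ?c22)"
    unfolding CT unfolding Ch_def by (rule mult_four_block_mat[OF cc(1,4,2,3) cc(1,2,4,3)])
  also have "\<dots> = four_block_mat ((chol11 K)\<^sup>2 \<cdot>\<^sub>m 1\<^sub>m e) ((chol11 K * chol21 K) \<cdot>\<^sub>m 1\<^sub>m e)
     ((chol21 K * chol11 K) \<cdot>\<^sub>m 1\<^sub>m e) (((chol21 K)\<^sup>2 + (chol22 K)\<^sup>2) \<cdot>\<^sub>m 1\<^sub>m e)"
  proof -
    have "?c11 * ?c11 + ?z * ?z = (chol11 K)\<^sup>2 \<cdot>\<^sub>m 1\<^sub>m e"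
      unfolding sm left_mult_zero_mat[OF cc(4)] power2_eq_square by (rule right_add_zero_mat) auto
    moreover have "?c11 * ?c21 + ?z * ?c22 = (chol11 K * chol21 K) \<cdot>\<^sub>m 1\<^sub>m e"
      unfolding sm left_mult_zero_mat[OF cc(3)] by (rule right_add_zero_mat) auto
    moreover have "?c21 * ?c11 + ?c22 * ?z = (chol21 K * chol11 K) \<cdot>\<^sub>m 1\<^sub>m e"
      unfolding sm right_mult_zero_mat[OF cc(3)] by (rule right_add_zero_mat) auto
    moreover have "?c21 * ?c21 + ?c22 * ?c22 = ((chol21 K)\<^sup>2 + (chol22 K)\<^sup>2) \<cdot>\<^sub>m 1\<^sub>m e"
      unfolding sm sa power2_eq_square ..
    ultimately show ?thesis by (simp only:)
  qed
  finally have "Ch * Ch\<^sup>T = four_block_mat ((chol11 K)\<^sup>2 \<cdot>\<^sub>m 1\<^sub>m e) ((chol11 K * chol21 K) \<cdot>\<^sub>m 1\<^sub>m e)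
     ((chol21 K * chol11 K) \<cdot>\<^sub>m 1\<^sub>m e) (((chol21 K)\<^sup>2 + (chol22 K)\<^sup>2) \<cdot>\<^sub>m 1\<^sub>m e)" .
  then have KI: "?KI = Ch * Ch\<^sup>T"
    by (simp only: cholesky_KW_mat[OF psd, folded K_def])
  have "Bd * ?KI * Bd\<^sup>T = (Bd * Ch) * (Bd * Ch)\<^sup>T"
    unfolding KI by (rule mult_gram_transpose[OF Bd Ch])
  then have "Sigma_mat N K e a1 a2 B1 B2 = Mi * (Ad * Ad\<^sup>T + N \<cdot>\<^sub>m ((B1 @\<^sub>r B2) * (B1 @\<^sub>r B2)\<^sup>T) + (Bd * Ch) * (Bd * Ch)\<^sup>T) * Mi\<^sup>T"
    unfolding Sigma_mat_def Let_def Mi(1) Ad_def Bd_def by simp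
  also have "\<dots> = Mi * (Ad * Ad\<^sup>T) * Mi\<^sup>T + N \<cdot>\<^sub>m (Mi * ((B1 @\<^sub>r B2) * (B1 @\<^sub>r B2)\<^sup>T) * Mi\<^sup>T) + Mi * ((Bd * Ch) * (Bd * Ch)\<^sup>T) * Mi\<^sup>T"
  proof -
    let ?n = "2 * e"
    have c: "Ad * Ad\<^sup>T \<in> carrier_mat ?n ?n" "(B1 @\<^sub>r B2) * (B1 @\<^sub>r B2)\<^sup>T \<in> carrier_mat ?n ?n" "(Bd * Ch) * (Bd * Ch)\<^sup>T \<in> carrier_mat ?n ?n"
      by (rule gram_carrier, (rule Ad Bt mult_carrier_mat[OF Bd Ch]))+
    have d: "Mi * (A + A') * Mi\<^sup>T = Mi * A * Mi\<^sup>T + Mi * A' * Mi\<^sup>T" if "A \<in> carrier_mat ?n ?n" "A' \<in> carrier_mat ?n ?n" for A A'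
      unfolding mult_add_distrib_mat[OF Mi(2) that]
      by (rule add_mult_distrib_mat[OF mult_carrier_mat[OF Mi(2) that(1)] mult_carrier_mat[OF Mi(2) that(2)]]) (use Mi(2) in simp)
    have e: "Mi * (N \<cdot>\<^sub>m A) * Mi\<^sup>T = N \<cdot>\<^sub>m (Mi * A * Mi\<^sup>T)" if "A \<in> carrier_mat ?n ?n" for A
      unfolding mult_smult_distrib[OF Mi(2) that]
      by (rule mult_smult_assoc_mat[OF mult_carrier_mat[OF Mi(2) that]]) (use Mi(2) in simp)
    have cN: "N \<cdot>\<^sub>m ((B1 @\<^sub>r B2) * (B1 @\<^sub>r B2)\<^sup>T) \<in> carrier_mat ?n ?n" using c(2) by (rule smult_carrier_mat)
    show ?thesis unfolding d[OF add_carrier_mat[OF cN] c(3)] d[OF c(1) cN] e[OF c(2)] ..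
  qed
  also have "\<dots> = (Mi * Ad) * (Mi * Ad)\<^sup>T + N \<cdot>\<^sub>m ((Mi * (B1 @\<^sub>r B2)) * (Mi * (B1 @\<^sub>r B2))\<^sup>T) + (Mi * (Bd * Ch)) * (Mi * (Bd * Ch))\<^sup>T"
    unfolding mult_gram_transpose[OF Mi(2) Ad] mult_gram_transpose[OF Mi(2) Bt] mult_gram_transpose[OF Mi(2) mult_carrier_mat[OF Bd Ch]] ..
  finally have S: "Sigma_mat N K e a1 a2 B1 B2 = (Mi * Ad) * (Mi * Ad)\<^sup>T + N \<cdot>\<^sub>m ((Mi * (B1 @\<^sub>r B2)) * (Mi * (B1 @\<^sub>r B2))\<^sup>T) + (Mi * (Bd * Ch)) * (Mi * (Bd * Ch))\<^sup>T" .
  have c: "Mi * Ad \<in> carrier_mat (2 * e) 2" "Mi * (B1 @\<^sub>r B2) \<in> carrier_mat (2 * e) e" "Mi * (Bd * Ch) \<in> carrier_mat (2 * e) (2 * e)"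
    by (rule mult_carrier_mat[OF Mi(2)], (rule Ad Bt mult_carrier_mat[OF Bd Ch]))+
  have add: "(P + N \<cdot>\<^sub>m Q + R) $$ (i, i) = P $$ (i, i) + N * Q $$ (i, i) + R $$ (i, i)"
    if "P \<in> carrier_mat (2 * e) (2 * e)" "Q \<in> carrier_mat (2 * e) (2 * e)" "R \<in> carrier_mat (2 * e) (2 * e)" for P Q R
    using that i by simp
  have g: "(Mi * Ad) * (Mi * Ad)\<^sup>T \<in> carrier_mat (2 * e) (2 * e)"
    "(Mi * (B1 @\<^sub>r B2)) * (Mi * (B1 @\<^sub>r B2))\<^sup>T \<in> carrier_mat (2 * e) (2 * e)"
    "(Mi * (Bd * Ch)) * (Mi * (Bd * Ch))\<^sup>T \<in> carrier_mat (2 * e) (2 * e)"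
    using gram_carrier[OF c(1)] gram_carrier[OF c(2)] gram_carrier[OF c(3)] by auto
  show ?thesis unfolding S add[OF g] gram_diag[OF c(1) i] gram_diag[OF c(2) i] gram_diag[OF c(3) i] ..
qed

lemma sum_lessThan_double:
  fixes f :: "nat \<Rightarrow> real"
  shows "(\<Sum>j<2 * e. f j) = (\<Sum>j<e. f j) + (\<Sum>j<e. f (e + j))"
proof -
  have "(\<Sum>j<e + k. f j) = (\<Sum>j<e. f j) + (\<Sum>j<k. f (e + j))" for k by (induct k) simp_all
  then show ?thesis by (simp add: mult_2)
qed

text \<open>One set of gains does two jobs: the squares add up to the diagonal of
  \<open>Sigma_mat\<close>, and the gains express any solution of the feedback recursion through
  symbols and noise. This links the trace condition to the inputs actually sent. The recursion is
  stated for arbitrary real sequences, so it applies to each block and each noise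
  realisation.\<close>

lemma feedback_response:
  assumes psd: "psd_mat (KW_mat s1 s2 rho)" and N: "0 \<le> N" and a: "a1 \<in> carrier_vec e" "a2 \<in> carrier_vec e"
    and B: "strictly_lower e B1" "strictly_lower e B2"
  defines "K \<equiv> KW_mat s1 s2 rho"
  shows "\<exists>h1 h2 p q r.
    (\<forall>i<2 * e. Sigma_mat N K e a1 a2 B1 B2 $$ (i, i) =
        (h1 i)\<^sup>2 + (h2 i)\<^sup>2 + (\<Sum>j<e. (p i j)\<^sup>2 + (q i j)\<^sup>2 + (r i j)\<^sup>2)) \<and>
    (\<forall>X1 X2 x1 x2 z u1 u2.
       (\<forall>i<e. X1 i = a1 $ i * x1 + (\<Sum>j<i. B1 $$ (i, j) * (X1 j + X2 j + sqrt N * z j + chol11 K * u1 j))) \<longrightarrow>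
       (\<forall>i<e. X2 i = a2 $ i * x2 + (\<Sum>j<i. B2 $$ (i, j) * (X1 j + X2 j + sqrt N * z j + (chol21 K * u1 j + chol22 K * u2 j)))) \<longrightarrow>
       (\<forall>i<e. X1 i = h1 i * x1 + h2 i * x2 + (\<Sum>j<e. p i j * z j + q i j * u1 j + r i j * u2 j) \<and>
          X2 i = h1 (e + i) * x1 + h2 (e + i) * x2 + (\<Sum>j<e. p (e + i) j * z j + q (e + i) j * u1 j + r (e + i) j * u2 j)))"
proof -
  have Bc: "B1 \<in> carrier_mat e e" "B2 \<in> carrier_mat e e" using B by (auto simp: strictly_lower_def)
  define F where "F = four_block_mat B1 B1 B2 B2"
  obtain Mi where Mi: "mat_inverse (1\<^sub>m (2 * e) - F) = Some Mi"
    "Mi \<in> carrier_mat (2 * e) (2 * e)" "Mi * (1\<^sub>m (2 * e) - F) = 1\<^sub>m (2 * e)"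
    using feedback_matrix_inverse[OF B] unfolding F_def by blast
  define Ad where "Ad = four_block_mat (mat_of_cols e [a1]) (0\<^sub>m e 1) (0\<^sub>m e 1) (mat_of_cols e [a2])"
  define Bd where "Bd = four_block_mat B1 (0\<^sub>m e e) (0\<^sub>m e e) B2"
  define Ch where "Ch = four_block_mat (chol11 K \<cdot>\<^sub>m 1\<^sub>m e) (0\<^sub>m e e) (chol21 K \<cdot>\<^sub>m 1\<^sub>m e) (chol22 K \<cdot>\<^sub>m 1\<^sub>m e)"
  define Bt where "Bt = B1 @\<^sub>r B2"
  have ac: "mat_of_cols e [a1] \<in> carrier_mat e 1" "mat_of_cols e [a2] \<in> carrier_mat e 1"
    using mat_of_cols_carrier(1)[of e "[a1]"] mat_of_cols_carrier(1)[of e "[a2]"] by auto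
  have F: "F \<in> carrier_mat (2 * e) (2 * e)"
    unfolding F_def using Bc four_block_carrier_mat[of B1 e e B2 e e] by (simp add: mult_2)
  have Bt: "Bt \<in> carrier_mat (2 * e) e" unfolding Bt_def using Bc carrier_append_rows[of B1 e e B2 e] by (simp add: mult_2)
  have Ad: "Ad \<in> carrier_mat (2 * e) 2"
    unfolding Ad_def using four_block_carrier_mat[OF ac] by (simp add: mult_2 numeral_2_eq_2)
  have Bd: "Bd \<in> carrier_mat (2 * e) (2 * e)"
    unfolding Bd_def using four_block_carrier_mat[of B1 e e B2 e e] Bc by (simp add: mult_2)
  have Ch: "Ch \<in> carrier_mat (2 * e) (2 * e)"
    unfolding Ch_def using four_block_carrier_mat[of "chol11 K \<cdot>\<^sub>m 1\<^sub>m e" e e "chol22 K \<cdot>\<^sub>m 1\<^sub>m e" e e] by (simp add: mult_2)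
  define H where "H = Mi * Ad"
  define Pz where "Pz = Mi * Bt"
  define Q where "Q = Mi * (Bd * Ch)"
  have Hc: "H \<in> carrier_mat (2 * e) 2" and Pc: "Pz \<in> carrier_mat (2 * e) e" and Qc: "Q \<in> carrier_mat (2 * e) (2 * e)"
    unfolding H_def Pz_def Q_def by (rule mult_carrier_mat[OF Mi(2)], (rule Ad Bt mult_carrier_mat[OF Bd Ch]))+
  show ?thesis
  proof (rule exI[of _ "\<lambda>i. H $$ (i, 0)"], rule exI[of _ "\<lambda>i. H $$ (i, 1)"], rule exI[of _ "\<lambda>i j. sqrt N * Pz $$ (i, j)"],
        rule exI[of _ "\<lambda>i j. Q $$ (i, j)"], rule exI[of _ "\<lambda>i j. Q $$ (i, e + j)"], rule conjI; intro allI impI)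
    fix i assume i: "i < 2 * e"
    have "Sigma_mat N K e a1 a2 B1 B2 $$ (i, i) =
        (\<Sum>j<2. (H $$ (i, j))\<^sup>2) + N * (\<Sum>j<e. (Pz $$ (i, j))\<^sup>2) + (\<Sum>j<2*e. (Q $$ (i, j))\<^sup>2)"
      unfolding H_def Pz_def Q_def Ad_def Bd_def Ch_def Bt_def K_def
      by (rule Sigma_mat_gram[OF psd B Mi(1)[unfolded F_def] Mi(2) i])
    note Sii = this
    show "Sigma_mat N K e a1 a2 B1 B2 $$ (i, i) = (H $$ (i, 0))\<^sup>2 + (H $$ (i, 1))\<^sup>2
        + (\<Sum>j<e. (sqrt N * Pz $$ (i, j))\<^sup>2 + (Q $$ (i, j))\<^sup>2 + (Q $$ (i, e + j))\<^sup>2)"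
    proof -
      have two: "(\<Sum>i<2. f i) = f 0 + f 1" for f :: "nat \<Rightarrow> real" by (simp add: numeral_2_eq_2)
      have sq: "(sqrt N * y)\<^sup>2 = N * y\<^sup>2" for y using N by (simp add: power_mult_distrib)
      show ?thesis
        unfolding Sii two sum_lessThan_double by (simp add: sum.distrib sq sum_distrib_left)
    qed
  next
    fix X1 X2 z u1 u2 :: "nat \<Rightarrow> real" and x1 x2 :: real and i
    assume X1': "\<forall>i<e. X1 i = a1 $ i * x1 + (\<Sum>j<i. B1 $$ (i, j) * (X1 j + X2 j + sqrt N * z j + chol11 K * u1 j))"
      and X2': "\<forall>i<e. X2 i = a2 $ i * x2 + (\<Sum>j<i. B2 $$ (i, j) * (X1 j + X2 j + sqrt N * z j + (chol21 K * u1 j + chol22 K * u2 j)))"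
      and i: "i < e"
    note X1 = X1'[rule_format] and X2 = X2'[rule_format]
    define X where "X = vec e X1 @\<^sub>v vec e X2"
    define xi where "xi = vec 1 (\<lambda>_. x1) @\<^sub>v vec 1 (\<lambda>_. x2)"
    define Z where "Z = vec e (\<lambda>j. sqrt N * z j)"
    define W1 where "W1 = vec e (\<lambda>j. chol11 K * u1 j)"
    define W2 where "W2 = vec e (\<lambda>j. chol21 K * u1 j + chol22 K * u2 j)"
    define U where "U = vec e u1 @\<^sub>v vec e u2"
    have c: "X \<in> carrier_vec (2 * e)" "xi \<in> carrier_vec 2" "Z \<in> carrier_vec e" "U \<in> carrier_vec (2 * e)"
      "W1 \<in> carrier_vec e" "W2 \<in> carrier_vec e"
      by (rule carrier_vecI, simp add: X_def xi_def Z_def U_def W1_def W2_def)+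
    \<comment> \<open>Strict lower triangularity lets the causal sum over the past be written as a
      full matrix row.\<close>
    have full: "(\<Sum>j<k. D $$ (k, j) * f j) = (\<Sum>j<e. D $$ (k, j) * f j)" if "strictly_lower e D" "k < e" for k D and f :: "nat \<Rightarrow> real"
      using that by (intro sum.mono_neutral_left) (auto simp: strictly_lower_def)
    have CU: "Ch *\<^sub>v U = W1 @\<^sub>v W2"
    proof -
      have sv: "(x \<cdot>\<^sub>m 1\<^sub>m e) *\<^sub>v v = x \<cdot>\<^sub>v v" if "v \<in> carrier_vec e" for x :: real and v
        using that by (intro eq_vecI) (auto simp: scalar_prod_def if_distrib[of "\<lambda>y. x * y"] if_distrib[of "\<lambda>y. y * _"] cong: if_cong)
      have "Ch *\<^sub>v U = ((chol11 K \<cdot>\<^sub>m 1\<^sub>m e) *\<^sub>v vec e u1 + 0\<^sub>m e e *\<^sub>v vec e u2) @\<^sub>v ((chol21 K \<cdot>\<^sub>m 1\<^sub>m e) *\<^sub>v vec e u1 + (chol22 K \<cdot>\<^sub>m 1\<^sub>m e) *\<^sub>v vec e u2)"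
        unfolding Ch_def U_def by (rule four_block_mat_mult_vec) auto
      also have "\<dots> = W1 @\<^sub>v W2"
      proof (rule arg_cong2[where f="append_vec"])
        show "(chol11 K \<cdot>\<^sub>m 1\<^sub>m e) *\<^sub>v vec e u1 + 0\<^sub>m e e *\<^sub>v vec e u2 = W1"
          unfolding sv[OF vec_carrier] W1_def by (rule eq_vecI) (auto simp: scalar_prod_def)
        show "(chol21 K \<cdot>\<^sub>m 1\<^sub>m e) *\<^sub>v vec e u1 + (chol22 K \<cdot>\<^sub>m 1\<^sub>m e) *\<^sub>v vec e u2 = W2"
          unfolding sv[OF vec_carrier] W2_def by (rule eq_vecI) auto
      qed
      finally show ?thesis .
    qed
    have FX: "F *\<^sub>v X = (B1 *\<^sub>v vec e X1 + B1 *\<^sub>v vec e X2) @\<^sub>v (B2 *\<^sub>v vec e X1 + B2 *\<^sub>v vec e X2)"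
      unfolding F_def X_def by (rule four_block_mat_mult_vec[OF Bc(1,1,2,2) vec_carrier vec_carrier])
    have Ax: "Ad *\<^sub>v xi = (mat_of_cols e [a1] *\<^sub>v vec 1 (\<lambda>_. x1) + 0\<^sub>m e 1 *\<^sub>v vec 1 (\<lambda>_. x2)) @\<^sub>v (0\<^sub>m e 1 *\<^sub>v vec 1 (\<lambda>_. x1) + mat_of_cols e [a2] *\<^sub>v vec 1 (\<lambda>_. x2))"
      unfolding Ad_def xi_def by (rule four_block_mat_mult_vec[OF ac(1) zero_carrier_mat zero_carrier_mat ac(2) vec_carrier vec_carrier])
    have BZ: "Bt *\<^sub>v Z = (B1 *\<^sub>v Z) @\<^sub>v (B2 *\<^sub>v Z)"
      unfolding Bt_def by (rule mat_mult_append[OF Bc c(3)])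
    have BW: "Bd *\<^sub>v (W1 @\<^sub>v W2) = (B1 *\<^sub>v W1 + 0\<^sub>m e e *\<^sub>v W2) @\<^sub>v (0\<^sub>m e e *\<^sub>v W1 + B2 *\<^sub>v W2)"
      unfolding Bd_def by (rule four_block_mat_mult_vec[OF Bc(1) zero_carrier_mat zero_carrier_mat Bc(2) c(5,6)])
    have zr: "(0\<^sub>m e k *\<^sub>v v) $ j = 0" if "j < e" "v \<in> carrier_vec k" for k j and v :: "real vec"
      using that by (simp add: scalar_prod_def)
    have ai: "(mat_of_cols e [b] *\<^sub>v vec 1 (\<lambda>_. y)) $ j = b $ j * y" if "j < e" "b \<in> carrier_vec e" for b y j
      using that by (simp add: scalar_prod_def mat_of_cols_index)
    \<comment> \<open>The recursion in matrix form; multiplication by the inverse of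
      \<open>1 - F\<close> then solves it for the inputs.\<close>
    have eq: "X - F *\<^sub>v X = Ad *\<^sub>v xi + Bt *\<^sub>v Z + Bd *\<^sub>v (Ch *\<^sub>v U)"
    proof (rule eq_vecI)
      fix j assume "j < dim_vec (Ad *\<^sub>v xi + Bt *\<^sub>v Z + Bd *\<^sub>v (Ch *\<^sub>v U))"
      then have j: "j < 2 * e" using Bd by simp
      note mi = mult_mat_vec_index[OF Bc(1)] mult_mat_vec_index[OF Bc(2)]
      show "(X - F *\<^sub>v X) $ j = (Ad *\<^sub>v xi + Bt *\<^sub>v Z + Bd *\<^sub>v (Ch *\<^sub>v U)) $ j"
      proof (cases "j < e")
        case True
        have "X1 j = a1 $ j * x1 + (\<Sum>k<e. B1 $$ (j, k) * (X1 k + X2 k + sqrt N * z k + chol11 K * u1 k))"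
          using X1[OF True] full[OF B(1) True] by simp
        then show ?thesis
          unfolding CU FX Ax BZ BW using True Bc c ac a
          by (simp add: X_def zr ai[unfolded One_nat_def] mi Z_def W1_def sum.distrib distrib_left del: index_mult_mat_vec)
      next
        case False
        then have j': "j - e < e" using j by simp
        have "X2 (j - e) = a2 $ (j - e) * x2 + (\<Sum>k<e. B2 $$ (j - e, k) * (X1 k + X2 k + sqrt N * z k + (chol21 K * u1 k + chol22 K * u2 k)))"
          using X2[OF j'] full[OF B(2) j'] by simp
        then show ?thesis
          unfolding CU FX Ax BZ BW using False j' j Bc c ac a
          by (simp add: X_def zr ai[unfolded One_nat_def] mi Z_def W2_def sum.distrib distrib_left del: index_mult_mat_vec)
      qed
    qed (use Bd c F in auto)
    have s1: "(Mi * (1\<^sub>m (2 * e) - F)) *\<^sub>v X = X" unfolding Mi(3) using c by simp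
    have s2: "(Mi * (1\<^sub>m (2 * e) - F)) *\<^sub>v X = Mi *\<^sub>v ((1\<^sub>m (2 * e) - F) *\<^sub>v X)"
      by (rule assoc_mult_mat_vec[OF Mi(2) minus_carrier_mat[OF F] c(1)])
    have s3: "(1\<^sub>m (2 * e) - F) *\<^sub>v X = X - F *\<^sub>v X"
      using minus_mult_distrib_mat_vec[OF one_carrier_mat F c(1)] c by simp
    have s4: "Mi *\<^sub>v (X - F *\<^sub>v X) = Mi *\<^sub>v (Ad *\<^sub>v xi) + Mi *\<^sub>v (Bt *\<^sub>v Z) + Mi *\<^sub>v (Bd *\<^sub>v (Ch *\<^sub>v U))"
    proof -
      have c': "Ad *\<^sub>v xi \<in> carrier_vec (2 * e)" "Bt *\<^sub>v Z \<in> carrier_vec (2 * e)" "Bd *\<^sub>v (Ch *\<^sub>v U) \<in> carrier_vec (2 * e)"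
        using mult_mat_vec_carrier[OF Ad c(2)] mult_mat_vec_carrier[OF Bt c(3)] mult_mat_vec_carrier[OF Bd mult_mat_vec_carrier[OF Ch c(4)]] by auto
      show ?thesis
        unfolding eq mult_add_distrib_mat_vec[OF Mi(2) add_carrier_vec[OF c'(1,2)] c'(3)] mult_add_distrib_mat_vec[OF Mi(2) c'(1,2)] ..
    qed
    have s5: "Mi *\<^sub>v (Ad *\<^sub>v xi) + Mi *\<^sub>v (Bt *\<^sub>v Z) + Mi *\<^sub>v (Bd *\<^sub>v (Ch *\<^sub>v U)) = H *\<^sub>v xi + Pz *\<^sub>v Z + Q *\<^sub>v U"
    proof -
      have "Bd *\<^sub>v (Ch *\<^sub>v U) = (Bd * Ch) *\<^sub>v U" by (rule assoc_mult_mat_vec[OF Bd Ch c(4), symmetric])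
      moreover have "Mi *\<^sub>v ((Bd * Ch) *\<^sub>v U) = Q *\<^sub>v U"
        unfolding Q_def using assoc_mult_mat_vec[OF Mi(2) mult_carrier_mat[OF Bd Ch] c(4)] by (simp only:)
      ultimately show ?thesis
        unfolding H_def Pz_def by (simp only: assoc_mult_mat_vec[OF Mi(2) Ad c(2)] assoc_mult_mat_vec[OF Mi(2) Bt c(3)])
    qed
    have Xeq: "X = H *\<^sub>v xi + Pz *\<^sub>v Z + Q *\<^sub>v U"
      using s1 unfolding s2 s3 s4 s5 by (rule sym)
    have Xj: "X $ j = H $$ (j, 0) * x1 + H $$ (j, 1) * x2 + (\<Sum>k<e. sqrt N * Pz $$ (j, k) * z k + Q $$ (j, k) * u1 k + Q $$ (j, e + k) * u2 k)"
      if j: "j < 2 * e" for j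
    proof -
      have "X $ j = (H *\<^sub>v xi) $ j + (Pz *\<^sub>v Z) $ j + (Q *\<^sub>v U) $ j"
        unfolding Xeq using j Hc Pc Qc by (simp del: index_mult_mat_vec)
      also have "(H *\<^sub>v xi) $ j = H $$ (j, 0) * x1 + H $$ (j, 1) * x2"
        unfolding mult_mat_vec_index[OF Hc c(2) j] by (simp add: numeral_2_eq_2 xi_def)
      also have "(Pz *\<^sub>v Z) $ j = (\<Sum>k<e. sqrt N * Pz $$ (j, k) * z k)"
        unfolding mult_mat_vec_index[OF Pc c(3) j] by (auto simp: Z_def intro!: sum.cong)
      also have "(Q *\<^sub>v U) $ j = (\<Sum>k<e. Q $$ (j, k) * u1 k) + (\<Sum>k<e. Q $$ (j, e + k) * u2 k)"
        unfolding mult_mat_vec_index[OF Qc c(4) j] sum_lessThan_double by (simp add: U_def)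
      finally show ?thesis by (simp add: sum.distrib)
    qed
    show "X1 i = H $$ (i, 0) * x1 + H $$ (i, 1) * x2 + (\<Sum>j<e. sqrt N * Pz $$ (i, j) * z j + Q $$ (i, j) * u1 j + Q $$ (i, e + j) * u2 j) \<and>
       X2 i = H $$ (e + i, 0) * x1 + H $$ (e + i, 1) * x2 + (\<Sum>j<e. sqrt N * Pz $$ (e + i, j) * z j + Q $$ (e + i, j) * u1 j + Q $$ (e + i, e + j) * u2 j)"
    proof -
      have "X $ i = X1 i" "X $ (e + i) = X2 i" using i by (simp_all add: X_def)
      moreover have "i < 2 * e" "e + i < 2 * e" using i by simp_all
      ultimately show ?thesis using Xj[of i] Xj[of "e + i"] by (simp only:)
    qed
  qed
qed

section \<open>The channel under linear block encoders\<close>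

text \<open>A step of the recursion writes only its own time, so entries already made stay
  fixed.\<close>

lemma hist_eq_chX: "s < t \<Longrightarrow> hist N K f1 f2 m1 m2 \<omega> t s = chX N K f1 f2 m1 m2 \<omega> s"
proof (induction t)
  case (Suc t)
  show ?case
  proof (cases "s = t")
    case True then show ?thesis by (simp add: chX_def)
  next
    case False then show ?thesis using Suc by (simp add: Let_def)
  qed
qed simp

text \<open>The closed-loop form of the channel, free of the auxiliary history: encoders act on the
  past of output plus feedback noise.\<close>

lemma chX_eq:
  "chX N K f1 f2 m1 m2 \<omega> t =
    (f1 t m1 (\<lambda>s\<in>{..<t}. chY N K f1 f2 m1 m2 \<omega> s + W1s K \<omega> s),
     f2 t m2 (\<lambda>s\<in>{..<t}. chY N K f1 f2 m1 m2 \<omega> s + W2s K \<omega> s))"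
proof -
  have "(\<lambda>s\<in>{..<t}. fst (hist N K f1 f2 m1 m2 \<omega> t s) + snd (hist N K f1 f2 m1 m2 \<omega> t s) + Zs N \<omega> s + W s)
     = (\<lambda>s\<in>{..<t}. chY N K f1 f2 m1 m2 \<omega> s + W s)" for W
    by (auto simp: restrict_def fun_eq_iff chY_def hist_eq_chX)
  then show ?thesis by (simp add: chX_def[of _ _ _ _ _ _ _ t] Let_def)
qed

text \<open>Feedback is used only inside the current block, which starts at
  \<open>t div \<eta> * \<eta>\<close>, so that the blocks become separate uses of one vector
  channel. \<open>c m\<close> is the codeword of message \<open>m\<close>, with one symbol per
  block; from time \<open>L * \<eta>\<close> on the transmitter is silent.\<close>

definition lin_enc :: "nat \<Rightarrow> nat \<Rightarrow> (nat \<Rightarrow> real) \<Rightarrow> (nat \<Rightarrow> nat \<Rightarrow> real) \<Rightarrow> (nat \<Rightarrow> nat \<Rightarrow> real) \<Rightarrow> encoder" where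
  "lin_enc \<eta> L a B c t m v = (if t < L * \<eta>
     then a (t mod \<eta>) * c m (t div \<eta>) + (\<Sum>j<t mod \<eta>. B (t mod \<eta>) j * v (t div \<eta> * \<eta> + j)) else 0)"

lemma measurable_lin_enc: "lin_enc \<eta> L a B c t m \<in> borel_measurable (PiM {..<t} (\<lambda>_. borel))"
proof -
  have "t div \<eta> * \<eta> + j < t" if "j < t mod \<eta>" for j
    using that div_mult_mod_eq[of t \<eta>] by linarith
  then have "(\<lambda>v. v (t div \<eta> * \<eta> + j)) \<in> borel_measurable (PiM {..<t} (\<lambda>_. borel))" if "j < t mod \<eta>" for j
    using that by (intro measurable_component_singleton) auto
  then show ?thesis
    unfolding lin_enc_def[abs_def]
    by (cases "t < L * \<eta>") (auto intro!: borel_measurable_add borel_measurable_sum borel_measurable_times)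
qed

text \<open>\<open>d t\<close> holds the output and the two feedback noises, so output plus noise is
  what each transmitter has seen; its linear contribution to the current inputs is
  subtracted.\<close>

definition innov :: "nat \<Rightarrow> nat \<Rightarrow> (nat \<Rightarrow> nat \<Rightarrow> real) \<Rightarrow> (nat \<Rightarrow> nat \<Rightarrow> real) \<Rightarrow> (nat \<Rightarrow> real \<times> real \<times> real) \<Rightarrow> nat \<Rightarrow> real" where
  "innov \<eta> L B1 B2 d = (\<lambda>t\<in>{..<L * \<eta>}. fst (d t) - (\<Sum>j<t mod \<eta>.
      B1 (t mod \<eta>) j * (fst (d (t div \<eta> * \<eta> + j)) + fst (snd (d (t div \<eta> * \<eta> + j))))
    + B2 (t mod \<eta>) j * (fst (d (t div \<eta> * \<eta> + j)) + snd (snd (d (t div \<eta> * \<eta> + j))))))"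

lemma measurable_innov:
  assumes "L * \<eta> \<le> n"
  shows "innov \<eta> L B1 B2 \<in> measurable (PiM {..<n} (\<lambda>_. borel)) (PiM {..<L * \<eta>} (\<lambda>_. borel))"
proof -
  have i: "t div \<eta> * \<eta> + j < n" if "t < L * \<eta>" "j < t mod \<eta>" for t j
    using that assms div_mult_mod_eq[of t \<eta>] by linarith
  have m [measurable]: "s < n \<Longrightarrow> (\<lambda>d. d s) \<in> measurable (PiM {..<n} (\<lambda>_. borel :: (real \<times> real \<times> real) measure)) (borel \<Otimes>\<^sub>M (borel \<Otimes>\<^sub>M borel))" for s
    using measurable_component_singleton[of s "{..<n}" "\<lambda>_. borel :: (real \<times> real \<times> real) measure"] by (simp add: borel_prod)
  have 1: "(\<lambda>d. fst (d s)) \<in> borel_measurable (PiM {..<n} (\<lambda>_. borel :: (real \<times> real \<times> real) measure))"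
      "(\<lambda>d. fst (snd (d s))) \<in> borel_measurable (PiM {..<n} (\<lambda>_. borel :: (real \<times> real \<times> real) measure))"
      "(\<lambda>d. snd (snd (d s))) \<in> borel_measurable (PiM {..<n} (\<lambda>_. borel :: (real \<times> real \<times> real) measure))" if s: "s < n" for s
    using measurable_compose[OF m[OF s] measurable_fst]
      measurable_compose[OF measurable_compose[OF m[OF s] measurable_snd] measurable_fst]
      measurable_compose[OF measurable_compose[OF m[OF s] measurable_snd] measurable_snd] by auto
  show ?thesis
    unfolding innov_def[abs_def] using assms
    by (intro measurable_restrict borel_measurable_diff borel_measurable_sum borel_measurable_add borel_measurable_times borel_measurable_const 1)
      (auto intro: i)
qed

context
  fixes \<eta> L :: nat and N :: real and K :: "real mat" and a1 a2 :: "nat \<Rightarrow> real" and B1 B2 :: "nat \<Rightarrow> nat \<Rightarrow> real"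
    and c1 c2 :: "nat \<Rightarrow> nat \<Rightarrow> real" and m1 m2 :: nat and \<omega> :: "nat \<Rightarrow> real \<times> real \<times> real"
begin

abbreviation "X1 \<equiv> \<lambda>t. fst (chX N K (lin_enc \<eta> L a1 B1 c1) (lin_enc \<eta> L a2 B2 c2) m1 m2 \<omega> t)"
abbreviation "X2 \<equiv> \<lambda>t. snd (chX N K (lin_enc \<eta> L a1 B1 c1) (lin_enc \<eta> L a2 B2 c2) m1 m2 \<omega> t)"
abbreviation "Yt \<equiv> \<lambda>t. chY N K (lin_enc \<eta> L a1 B1 c1) (lin_enc \<eta> L a2 B2 c2) m1 m2 \<omega> t"

lemma lin_enc_inputs:
  assumes "t < L * \<eta>"
  shows "X1 t = a1 (t mod \<eta>) * c1 m1 (t div \<eta>) + (\<Sum>j<t mod \<eta>. B1 (t mod \<eta>) j * (Yt (t div \<eta> * \<eta> + j) + W1s K \<omega> (t div \<eta> * \<eta> + j)))"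
    "X2 t = a2 (t mod \<eta>) * c2 m2 (t div \<eta>) + (\<Sum>j<t mod \<eta>. B2 (t mod \<eta>) j * (Yt (t div \<eta> * \<eta> + j) + W2s K \<omega> (t div \<eta> * \<eta> + j)))"
proof -
  have *: "t div \<eta> * \<eta> + j < t" if "j < t mod \<eta>" for j
    using that div_mult_mod_eq[of t \<eta>] by linarith
  show "X1 t = a1 (t mod \<eta>) * c1 m1 (t div \<eta>) + (\<Sum>j<t mod \<eta>. B1 (t mod \<eta>) j * (Yt (t div \<eta> * \<eta> + j) + W1s K \<omega> (t div \<eta> * \<eta> + j)))"
    unfolding chX_eq[of _ _ _ _ _ _ _ t] fst_conv lin_enc_def[of _ _ _ _ _ t] using assms * by (simp add: lin_enc_def[abs_def])
  show "X2 t = a2 (t mod \<eta>) * c2 m2 (t div \<eta>) + (\<Sum>j<t mod \<eta>. B2 (t mod \<eta>) j * (Yt (t div \<eta> * \<eta> + j) + W2s K \<omega> (t div \<eta> * \<eta> + j)))"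
    unfolding chX_eq[of _ _ _ _ _ _ _ t] snd_conv lin_enc_def[of _ _ _ _ _ t] using assms * by (simp add: lin_enc_def[abs_def])
qed

lemma lin_enc_inputs_idle:
  assumes "\<not> t < L * \<eta>"
  shows "X1 t = 0" "X2 t = 0"
  unfolding chX_eq[of _ _ _ _ _ _ _ t] using assms by (simp_all add: lin_enc_def)

text \<open>Both feedback signals are reconstructed exactly by the receiver, so the difference
  retains no trace of the feedback noise.\<close>

lemma innov_output:
  assumes "L * \<eta> \<le> n"
  shows "innov \<eta> L B1 B2 (\<lambda>t\<in>{..<n}. (Yt t, W1s K \<omega> t, W2s K \<omega> t)) =
    (\<lambda>t\<in>{..<L * \<eta>}. a1 (t mod \<eta>) * c1 m1 (t div \<eta>) + a2 (t mod \<eta>) * c2 m2 (t div \<eta>) + sqrt N * fst (\<omega> t))"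
proof
  fix t
  show "innov \<eta> L B1 B2 (\<lambda>t\<in>{..<n}. (Yt t, W1s K \<omega> t, W2s K \<omega> t)) t =
    (\<lambda>t\<in>{..<L * \<eta>}. a1 (t mod \<eta>) * c1 m1 (t div \<eta>) + a2 (t mod \<eta>) * c2 m2 (t div \<eta>) + sqrt N * fst (\<omega> t)) t"
  proof (cases "t < L * \<eta>")
    case True
    have *: "t div \<eta> * \<eta> + j < n" if "j < t mod \<eta>" for j
      using that True assms div_mult_mod_eq[of t \<eta>] by linarith
    have lhs: "innov \<eta> L B1 B2 (\<lambda>t\<in>{..<n}. (Yt t, W1s K \<omega> t, W2s K \<omega> t)) t = Yt t - (\<Sum>j<t mod \<eta>.
        B1 (t mod \<eta>) j * (Yt (t div \<eta> * \<eta> + j) + W1s K \<omega> (t div \<eta> * \<eta> + j))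
      + B2 (t mod \<eta>) j * (Yt (t div \<eta> * \<eta> + j) + W2s K \<omega> (t div \<eta> * \<eta> + j)))"
      using True assms * by (simp add: innov_def)
    have Y: "Yt t = X1 t + X2 t + sqrt N * fst (\<omega> t)"
      by (simp add: chY_def Zs_def)
    show ?thesis
      unfolding lhs Y lin_enc_inputs[OF True] using True by (simp add: sum.distrib)
  qed (simp add: innov_def)
qed

lemma lin_enc_block_inputs:
  assumes b: "b < L" and i: "i < \<eta>"
  shows "X1 (b * \<eta> + i) = a1 i * c1 m1 b + (\<Sum>j<i. B1 i j * (X1 (b * \<eta> + j) + X2 (b * \<eta> + j)
       + sqrt N * fst (\<omega> (b * \<eta> + j)) + chol11 K * fst (snd (\<omega> (b * \<eta> + j)))))"
    "X2 (b * \<eta> + i) = a2 i * c2 m2 b + (\<Sum>j<i. B2 i j * (X1 (b * \<eta> + j) + X2 (b * \<eta> + j)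
       + sqrt N * fst (\<omega> (b * \<eta> + j)) + (chol21 K * fst (snd (\<omega> (b * \<eta> + j))) + chol22 K * snd (snd (\<omega> (b * \<eta> + j))))))"
proof -
  have t: "b * \<eta> + i < L * \<eta>" by (rule block_index_less[OF b i order_refl])
  have d: "(b * \<eta> + i) div \<eta> = b" "(b * \<eta> + i) mod \<eta> = i" using i by auto
  have Y: "Yt s = X1 s + X2 s + sqrt N * fst (\<omega> s)" for s by (simp add: chY_def Zs_def)
  show "X1 (b * \<eta> + i) = a1 i * c1 m1 b + (\<Sum>j<i. B1 i j * (X1 (b * \<eta> + j) + X2 (b * \<eta> + j)
       + sqrt N * fst (\<omega> (b * \<eta> + j)) + chol11 K * fst (snd (\<omega> (b * \<eta> + j)))))"
    using lin_enc_inputs(1)[OF t] unfolding d Y W1s_def .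
  show "X2 (b * \<eta> + i) = a2 i * c2 m2 b + (\<Sum>j<i. B2 i j * (X1 (b * \<eta> + j) + X2 (b * \<eta> + j)
       + sqrt N * fst (\<omega> (b * \<eta> + j)) + (chol21 K * fst (snd (\<omega> (b * \<eta> + j))) + chol22 K * snd (snd (\<omega> (b * \<eta> + j))))))"
    using lin_enc_inputs(2)[OF t] unfolding d Y W2s_def .
qed

end

section \<open>Input power per block\<close>

lemma noise_block_second_moment:
  assumes b: "b < L" "L * \<eta> \<le> n"
  shows "(\<integral>\<^sup>+\<omega>. ennreal ((m + (\<Sum>j<\<eta>. p j * fst (\<omega> (b * \<eta> + j)) + q j * fst (snd (\<omega> (b * \<eta> + j))) + r j * snd (snd (\<omega> (b * \<eta> + j)))))\<^sup>2) \<partial>noise_space n)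
     = ennreal (m\<^sup>2 + (\<Sum>j<\<eta>. (p j)\<^sup>2 + (q j)\<^sup>2 + (r j)\<^sup>2))"
proof -
  define S where "S = (\<lambda>j. b * \<eta> + j) ` {..<\<eta>} \<times> ({()} <+> ({()} <+> {()}))"
  define c where "c k = (case snd k of Inl _ \<Rightarrow> p (fst k - b * \<eta>) | Inr (Inl _) \<Rightarrow> q (fst k - b * \<eta>) | Inr (Inr _) \<Rightarrow> r (fst k - b * \<eta>))"
    for k :: "nat \<times> (unit + unit + unit)"
  have S: "S \<subseteq> {..<n} \<times> ({()} <+> ({()} <+> {()}))"
    unfolding S_def using block_index_less[OF b(1) _ b(2)] by auto
  have sumS: "(\<Sum>k\<in>S. f k) = (\<Sum>j<\<eta>. f (b * \<eta> + j, Inl ()) + f (b * \<eta> + j, Inr (Inl ())) + f (b * \<eta> + j, Inr (Inr ())))" for f :: "_ \<Rightarrow> real"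
  proof -
    have "(\<Sum>k\<in>S. f k) = (\<Sum>t\<in>(\<lambda>j. b * \<eta> + j) ` {..<\<eta>}. \<Sum>k\<in>{()} <+> ({()} <+> {()}). f (t, k))"
      unfolding S_def by (simp add: sum.cartesian_product)
    also have "\<dots> = (\<Sum>j<\<eta>. \<Sum>k\<in>{()} <+> ({()} <+> {()}). f (b * \<eta> + j, k))"
      by (subst sum.reindex) (auto simp: inj_on_def)
    finally show ?thesis by (simp add: sum.Plus add.assoc)
  qed
  have "(\<integral>\<^sup>+\<omega>. ennreal ((m + (\<Sum>k\<in>S. c k * noise_coord k \<omega>))\<^sup>2) \<partial>noise_space n) = ennreal (m\<^sup>2 + (\<Sum>k\<in>S. (c k)\<^sup>2))"
    by (rule iid_std_affine_second_moment[OF iid_std_noise_space S])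
  then show ?thesis unfolding sumS by (simp add: c_def noise_coord_def)
qed

lemma sum_blocks:
  fixes f :: "nat \<Rightarrow> real"
  assumes "L * \<eta> \<le> n" "\<And>t. \<not> t < L * \<eta> \<Longrightarrow> f t = 0"
  shows "(\<Sum>t<n. f t) = (\<Sum>b<L. \<Sum>i<\<eta>. f (b * \<eta> + i))"
proof -
  have "(\<Sum>t<n. f t) = (\<Sum>t<L * \<eta>. f t)"
    using assms by (intro sum.mono_neutral_right) auto
  also have "\<dots> = (\<Sum>b<L. sum f {b * \<eta>..<b * \<eta> + \<eta>})"
    by (rule sum.nat_group[symmetric])
  also have "\<dots> = (\<Sum>b<L. \<Sum>i<\<eta>. f (b * \<eta> + i))"
  proof (rule sum.cong[OF refl])
    fix b
    show "sum f {b * \<eta>..<b * \<eta> + \<eta>} = (\<Sum>i<\<eta>. f (b * \<eta> + i))"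
      using sum.shift_bounds_nat_ivl[of f 0 "b * \<eta>" \<eta>] by (simp add: lessThan_atLeast0 add.commute)
  qed
  finally show ?thesis .
qed

text \<open>The correlation of the two codewords is controlled through the powers of
  \<open>(x1 + x2) / sqrt 2\<close> and \<open>(x1 - x2) / sqrt 2\<close>.\<close>

lemma block_power_bound:
  fixes x1 x2 h1 h2 :: "nat \<Rightarrow> real"
  assumes L: "0 < L" and \<theta>: "0 < \<theta>"
  shows "(\<Sum>b<L. \<Sum>i\<in>J. (h1 i * x1 b + h2 i * x2 b)\<^sup>2)
     \<le> real L * ((\<Sum>i\<in>J. (h1 i)\<^sup>2 + (h2 i)\<^sup>2) * (1 + 4 * \<theta> + power_dev L (x1, x2) / \<theta>))"
proof -
  define H1 H2 Hx where "H1 = (\<Sum>i\<in>J. (h1 i)\<^sup>2)" and "H2 = (\<Sum>i\<in>J. (h2 i)\<^sup>2)" and "Hx = (\<Sum>i\<in>J. h1 i * h2 i)"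
  define d1 d2 dp dm where "d1 = (\<Sum>b<L. (x1 b)\<^sup>2) / real L - 1" and "d2 = (\<Sum>b<L. (x2 b)\<^sup>2) / real L - 1"
    and "dp = (\<Sum>b<L. ((x1 b + x2 b) / sqrt 2)\<^sup>2) / real L - 1" and "dm = (\<Sum>b<L. ((x1 b - x2 b) / sqrt 2)\<^sup>2) / real L - 1"
  have nn: "0 \<le> H1" "0 \<le> H2" by (auto simp: H1_def H2_def intro!: sum_nonneg)
  have "(\<Sum>b<L. \<Sum>i\<in>J. (h1 i * x1 b + h2 i * x2 b)\<^sup>2) = (\<Sum>b<L. H1 * (x1 b)\<^sup>2 + 2 * Hx * (x1 b * x2 b) + H2 * (x2 b)\<^sup>2)"
    unfolding H1_def H2_def Hx_def sum_distrib_left sum_distrib_right sum.distrib[symmetric]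
    by (intro sum.cong refl) (simp add: power2_eq_square algebra_simps)
  also have "\<dots> = H1 * (\<Sum>b<L. (x1 b)\<^sup>2) + 2 * Hx * (\<Sum>b<L. x1 b * x2 b) + H2 * (\<Sum>b<L. (x2 b)\<^sup>2)"
    by (simp add: sum.distrib sum_distrib_left)
  also have "(\<Sum>b<L. (x1 b)\<^sup>2) = real L * (1 + d1)" using L by (simp add: d1_def)
  also have "(\<Sum>b<L. (x2 b)\<^sup>2) = real L * (1 + d2)" using L by (simp add: d2_def)
  also have "(\<Sum>b<L. x1 b * x2 b) = real L * (dp - dm) / 2"
  proof -
    have "((x + y) / sqrt 2)\<^sup>2 - ((x - y) / sqrt 2)\<^sup>2 = 2 * (x * y)" for x y :: real
      by (simp add: power_divide power2_eq_square field_simps)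
    then have "(\<Sum>b<L. ((x1 b + x2 b) / sqrt 2)\<^sup>2) - (\<Sum>b<L. ((x1 b - x2 b) / sqrt 2)\<^sup>2) = 2 * (\<Sum>b<L. x1 b * x2 b)"
      unfolding sum_subtractf[symmetric] by (simp add: sum_distrib_left)
    moreover have "real L * (dp - dm) = (\<Sum>b<L. ((x1 b + x2 b) / sqrt 2)\<^sup>2) - (\<Sum>b<L. ((x1 b - x2 b) / sqrt 2)\<^sup>2)"
      using L by (simp add: dp_def dm_def diff_divide_distrib[symmetric])
    ultimately show ?thesis by simp
  qed
  also have "H1 * (real L * (1 + d1)) + 2 * Hx * (real L * (dp - dm) / 2) + H2 * (real L * (1 + d2))
      = real L * (H1 * (1 + d1) + Hx * (dp - dm) + H2 * (1 + d2))" by (simp add: field_simps)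
  also have "\<dots> \<le> real L * ((H1 + H2) * (1 + 4 * \<theta> + power_dev L (x1, x2) / \<theta>))"
  proof (rule mult_left_mono)
    have Hx: "\<bar>Hx\<bar> \<le> H1 + H2"
    proof -
      have "\<bar>Hx\<bar> \<le> (\<Sum>i\<in>J. \<bar>h1 i * h2 i\<bar>)" unfolding Hx_def by (rule sum_abs)
      also have "\<dots> \<le> (\<Sum>i\<in>J. (h1 i)\<^sup>2 + (h2 i)\<^sup>2)"
      proof (rule sum_mono)
        fix i
        have "2 * (\<bar>h1 i\<bar> * \<bar>h2 i\<bar>) \<le> (h1 i)\<^sup>2 + (h2 i)\<^sup>2"
          using sum_squares_bound[of "\<bar>h1 i\<bar>" "\<bar>h2 i\<bar>"] by (simp add: mult.assoc)
        moreover have "0 \<le> \<bar>h1 i\<bar> * \<bar>h2 i\<bar>" by simp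
        ultimately show "\<bar>h1 i * h2 i\<bar> \<le> (h1 i)\<^sup>2 + (h2 i)\<^sup>2" unfolding abs_mult by linarith
      qed
      finally show ?thesis by (simp add: H1_def H2_def sum.distrib)
    qed
    \<comment> \<open>Trades absolute for squared deviations at the price of a fixed slack
      \<open>\<theta>\<close>; four deviations give the term \<open>4 * \<theta>\<close>.\<close>
    have ab: "\<bar>d\<bar> \<le> \<theta> + d\<^sup>2 / \<theta>" for d
    proof (cases "\<bar>d\<bar> \<le> \<theta>")
      case True then show ?thesis using \<theta> by (simp add: add_increasing2)
    next
      case False
      then have "\<bar>d\<bar> * \<theta> \<le> \<bar>d\<bar> * \<bar>d\<bar>" by (intro mult_left_mono) auto
      then have "\<bar>d\<bar> \<le> d\<^sup>2 / \<theta>" using \<theta> by (simp add: pos_le_divide_eq power2_eq_square)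
      then show ?thesis using \<theta> by simp
    qed
    have "\<bar>d1\<bar> + \<bar>d2\<bar> + \<bar>dp\<bar> + \<bar>dm\<bar> \<le> 4 * \<theta> + (d1\<^sup>2 + d2\<^sup>2 + dp\<^sup>2 + dm\<^sup>2) / \<theta>"
      using ab[of d1] ab[of d2] ab[of dp] ab[of dm] by (simp add: add_divide_distrib)
    also have "d1\<^sup>2 + d2\<^sup>2 + dp\<^sup>2 + dm\<^sup>2 = power_dev L (x1, x2)"
      by (simp add: power_dev_def d1_def d2_def dp_def dm_def)
    finally have tot: "\<bar>d1\<bar> + \<bar>d2\<bar> + \<bar>dp\<bar> + \<bar>dm\<bar> \<le> 4 * \<theta> + power_dev L (x1, x2) / \<theta>" .
    have "Hx * (dp - dm) \<le> (H1 + H2) * (\<bar>dp\<bar> + \<bar>dm\<bar>)"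
    proof -
      have "Hx * (dp - dm) \<le> \<bar>Hx\<bar> * \<bar>dp - dm\<bar>" by (metis abs_ge_self abs_mult)
      also have "\<dots> \<le> (H1 + H2) * (\<bar>dp\<bar> + \<bar>dm\<bar>)" using Hx by (intro mult_mono) auto
      finally show ?thesis .
    qed
    moreover have "H1 * d1 \<le> H1 * (\<bar>d1\<bar> + \<bar>d2\<bar>)" "H2 * d2 \<le> H2 * (\<bar>d1\<bar> + \<bar>d2\<bar>)" using nn by (auto intro!: mult_left_mono)
    ultimately have "H1 * (1 + d1) + Hx * (dp - dm) + H2 * (1 + d2) \<le> (H1 + H2) * (1 + (\<bar>d1\<bar> + \<bar>d2\<bar> + \<bar>dp\<bar> + \<bar>dm\<bar>))"
      by (simp add: algebra_simps)
    also have "\<dots> \<le> (H1 + H2) * (1 + 4 * \<theta> + power_dev L (x1, x2) / \<theta>)"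
      using tot nn by (intro mult_left_mono) auto
    finally show "H1 * (1 + d1) + Hx * (dp - dm) + H2 * (1 + d2) \<le> (H1 + H2) * (1 + 4 * \<theta> + power_dev L (x1, x2) / \<theta>)" .
  qed simp
  finally show ?thesis by (simp add: H1_def H2_def sum.distrib)
qed

section \<open>Rates and projections\<close>

text \<open>Monotonicity of the determinant under adding a positive semidefinite matrix. By the
  arithmetic-geometric mean inequality \<open>2 * C * c \<le> A * b + B * a\<close>, so the mixed
  terms do not decrease it.\<close>

lemma psd_det_mono:
  fixes A B C :: real
  assumes "0 \<le> A" "0 \<le> B" "C\<^sup>2 \<le> A * B" "0 \<le> a" "0 \<le> b" "c\<^sup>2 \<le> a * b"
  shows "A * B - C\<^sup>2 \<le> (A + a) * (B + b) - (C + c)\<^sup>2"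
proof -
  have "(C * c)\<^sup>2 \<le> (A * B) * (a * b)"
    unfolding power_mult_distrib using assms by (intro mult_mono) auto
  also have "\<dots> = (A * b) * (B * a)" by simp
  also have "4 * \<dots> \<le> (A * b + B * a)\<^sup>2"
    using zero_le_power2[of "A * b - B * a"] by (simp add: power2_eq_square algebra_simps)
  finally have "(2 * (C * c))\<^sup>2 \<le> (A * b + B * a)\<^sup>2" by (simp add: power_mult_distrib)
  moreover have "0 \<le> A * b + B * a" using assms by simp
  ultimately have "2 * (C * c) \<le> A * b + B * a" by (rule power2_le_imp_le)
  then show ?thesis using assms(6) by (simp add: power2_eq_square algebra_simps)
qed

text \<open>Orthogonality splits the Gram matrix of \<open>f\<close> and \<open>g\<close> into that
  of the projections plus that of the residuals, both positive semidefinite. The expressions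
  compared are determinants of the identity plus a Gram matrix over \<open>N\<close>; the lower
  bound 1 is Cauchy-Schwarz.\<close>

lemma projection_gram:
  fixes f g p q :: "nat \<Rightarrow> real"
  assumes N: "0 < (N::real)"
    and orth: "(\<Sum>i<n. p i * (f i - p i)) = 0" "(\<Sum>i<n. q i * (g i - q i)) = 0"
      "(\<Sum>i<n. p i * (g i - q i)) = 0" "(\<Sum>i<n. q i * (f i - p i)) = 0"
  shows "(\<Sum>i<n. (p i)\<^sup>2) \<le> (\<Sum>i<n. (f i)\<^sup>2)"
    and "(1 + (\<Sum>i<n. (p i)\<^sup>2) / N) * (1 + (\<Sum>i<n. (q i)\<^sup>2) / N) - (\<Sum>i<n. p i * q i)\<^sup>2 / N\<^sup>2
      \<le> (1 + (\<Sum>i<n. (f i)\<^sup>2) / N) * (1 + (\<Sum>i<n. (g i)\<^sup>2) / N) - (\<Sum>i<n. f i * g i)\<^sup>2 / N\<^sup>2"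
    and "1 \<le> (1 + (\<Sum>i<n. (p i)\<^sup>2) / N) * (1 + (\<Sum>i<n. (q i)\<^sup>2) / N) - (\<Sum>i<n. p i * q i)\<^sup>2 / N\<^sup>2"
proof -
  define e e' where "e i = f i - p i" and "e' i = g i - q i" for i
  have fe: "f i = p i + e i" "g i = q i + e' i" for i by (auto simp: e_def e'_def)
  note o = orth[folded e_def e'_def]
  define pu pv pw eu ev ew where "pu = (\<Sum>i<n. (p i)\<^sup>2)" "pv = (\<Sum>i<n. (q i)\<^sup>2)" "pw = (\<Sum>i<n. p i * q i)"
    "eu = (\<Sum>i<n. (e i)\<^sup>2)" "ev = (\<Sum>i<n. (e' i)\<^sup>2)" "ew = (\<Sum>i<n. e i * e' i)"
  note d = this
  have nn: "0 \<le> pu" "0 \<le> pv" "0 \<le> eu" "0 \<le> ev" unfolding d by (auto intro!: sum_nonneg)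
  have cs: "pw\<^sup>2 \<le> pu * pv" "ew\<^sup>2 \<le> eu * ev" unfolding d by (rule Cauchy_Schwarz_ineq_sum)+
  have "(\<Sum>i<n. (f i)\<^sup>2) = pu + 2 * (\<Sum>i<n. p i * e i) + eu"
    unfolding fe d sum_distrib_left sum.distrib[symmetric] by (intro sum.cong) (auto simp: power2_eq_square algebra_simps)
  then have f2: "(\<Sum>i<n. (f i)\<^sup>2) = pu + eu" using o by simp
  have "(\<Sum>i<n. (g i)\<^sup>2) = pv + 2 * (\<Sum>i<n. q i * e' i) + ev"
    unfolding fe d sum_distrib_left sum.distrib[symmetric] by (intro sum.cong) (auto simp: power2_eq_square algebra_simps)
  then have g2: "(\<Sum>i<n. (g i)\<^sup>2) = pv + ev" using o by simp
  have "(\<Sum>i<n. f i * g i) = pw + (\<Sum>i<n. p i * e' i) + (\<Sum>i<n. q i * e i) + ew"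
    unfolding fe d sum.distrib[symmetric] by (intro sum.cong) (auto simp: algebra_simps)
  then have fg: "(\<Sum>i<n. f i * g i) = pw + ew" using o by simp
  show "(\<Sum>i<n. (p i)\<^sup>2) \<le> (\<Sum>i<n. (f i)\<^sup>2)" unfolding f2 using nn by (simp add: d)
  have pwN: "pw\<^sup>2 / N\<^sup>2 \<le> pu / N * (pv / N)"
    using cs(1) N by (simp add: power2_eq_square divide_right_mono)
  have "(1 + pu / N) * (1 + pv / N) - (pw / N)\<^sup>2 \<le> (1 + pu / N + eu / N) * (1 + pv / N + ev / N) - (pw / N + ew / N)\<^sup>2"
  proof (rule psd_det_mono)
    show "(pw / N)\<^sup>2 \<le> (1 + pu / N) * (1 + pv / N)"
    proof -
      have "pu / N * (pv / N) \<le> (1 + pu / N) * (1 + pv / N)" using nn N by (intro mult_mono) auto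
      then show ?thesis using pwN by (simp add: power_divide)
    qed
    show "(ew / N)\<^sup>2 \<le> eu / N * (ev / N)"
      using cs(2) N by (simp add: power_divide power2_eq_square divide_right_mono)
  qed (use nn N in auto)
  then have "(1 + pu / N) * (1 + pv / N) - pw\<^sup>2 / N\<^sup>2
      \<le> (1 + (pu + eu) / N) * (1 + (pv + ev) / N) - (pw + ew)\<^sup>2 / N\<^sup>2"
    by (simp add: power_divide[symmetric] add_divide_distrib add.assoc)
  then show "(1 + (\<Sum>i<n. (p i)\<^sup>2) / N) * (1 + (\<Sum>i<n. (q i)\<^sup>2) / N) - (\<Sum>i<n. p i * q i)\<^sup>2 / N\<^sup>2
      \<le> (1 + (\<Sum>i<n. (f i)\<^sup>2) / N) * (1 + (\<Sum>i<n. (g i)\<^sup>2) / N) - (\<Sum>i<n. f i * g i)\<^sup>2 / N\<^sup>2"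
    unfolding f2 g2 fg by (simp add: d)
  have "1 \<le> (1 + pu / N) * (1 + pv / N) - pu / N * (pv / N)"
    using nn N by (simp add: algebra_simps)
  then have "1 \<le> (1 + pu / N) * (1 + pv / N) - pw\<^sup>2 / N\<^sup>2" using pwN by linarith
  then show "1 \<le> (1 + (\<Sum>i<n. (p i)\<^sup>2) / N) * (1 + (\<Sum>i<n. (q i)\<^sup>2) / N) - (\<Sum>i<n. p i * q i)\<^sup>2 / N\<^sup>2"
    by (simp add: d)
qed

text \<open>The determinants of the effective two-row channel in terms of the Gram matrix \<open>(g11, g12; g12, g22)\<close>
  of the rows and the inner products \<open>u\<close>, \<open>v\<close> of the rows with the signal vectors; \<open>x\<close>, \<open>y\<close> are the
  coordinates of the orthogonal projections.\<close>

lemma two_row_determinants: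
  fixes g11 g12 g22 :: real
  assumes D: "g11 * g22 - g12\<^sup>2 \<noteq> 0" and N: "N \<noteq> 0"
    and u: "u1 = g11 * x1 + g12 * x2" "u2 = g12 * x1 + g22 * x2"
    and v: "v1 = g11 * y1 + g12 * y2" "v2 = g12 * y1 + g22 * y2"
  defines "pu \<equiv> x1 * u1 + x2 * u2" and "pv \<equiv> y1 * v1 + y2 * v2" and "pw \<equiv> x1 * v1 + x2 * v2"
  shows "((u1 * u1 + N * g11) * (u2 * u2 + N * g22) - (u1 * u2 + N * g12) * (u2 * u1 + N * g12))
      / (N * g11 * (N * g22) - N * g12 * (N * g12)) = 1 + pu / N"
    and "((u1 * u1 + v1 * v1 + N * g11) * (u2 * u2 + v2 * v2 + N * g22) - (u1 * u2 + v1 * v2 + N * g12) * (u2 * u1 + v2 * v1 + N * g12))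
      / (N * g11 * (N * g22) - N * g12 * (N * g12)) = (1 + pu / N) * (1 + pv / N) - pw\<^sup>2 / N\<^sup>2"
proof -
  have den: "N * g11 * (N * g22) - N * g12 * (N * g12) = N\<^sup>2 * (g11 * g22 - g12\<^sup>2)"
    by (simp add: power2_eq_square algebra_simps)
  have e1: "1 + pu / N = (N\<^sup>2 + N * pu) / N\<^sup>2" using N by (simp add: power2_eq_square field_simps)
  have e2: "(1 + pu / N) * (1 + pv / N) - pw\<^sup>2 / N\<^sup>2 = ((N + pu) * (N + pv) - pw\<^sup>2) / N\<^sup>2"
    using N by (simp add: power2_eq_square field_simps)
  \<comment> \<open>With \<open>u\<close> and \<open>v\<close> written through the coordinates of
    the projections, each numerator contains the Gram determinant as a factor:
    \<open>det (G X + N G) = det G * det (X + N I)\<close> in coordinates.\<close>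
  have n1: "(u1 * u1 + N * g11) * (u2 * u2 + N * g22) - (u1 * u2 + N * g12) * (u2 * u1 + N * g12)
     = (N\<^sup>2 + N * pu) * (g11 * g22 - g12\<^sup>2)"
    unfolding pu_def u by (simp add: power2_eq_square algebra_simps)
  have n2: "(u1 * u1 + v1 * v1 + N * g11) * (u2 * u2 + v2 * v2 + N * g22) - (u1 * u2 + v1 * v2 + N * g12) * (u2 * u1 + v2 * v1 + N * g12)
     = ((N + pu) * (N + pv) - pw\<^sup>2) * (g11 * g22 - g12\<^sup>2)"
    unfolding pu_def pv_def pw_def u v by (simp add: power2_eq_square algebra_simps)
  show "((u1 * u1 + N * g11) * (u2 * u2 + N * g22) - (u1 * u2 + N * g12) * (u2 * u1 + N * g12))
      / (N * g11 * (N * g22) - N * g12 * (N * g12)) = 1 + pu / N"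
    unfolding den n1 e1 using D by simp
  show "((u1 * u1 + v1 * v1 + N * g11) * (u2 * u2 + v2 * v2 + N * g22) - (u1 * u2 + v1 * v2 + N * g12) * (u2 * u1 + v2 * v1 + N * g12))
      / (N * g11 * (N * g22) - N * g12 * (N * g12)) = (1 + pu / N) * (1 + pv / N) - pw\<^sup>2 / N\<^sup>2"
    unfolding den n2 e2 using D by simp
qed

section \<open>From matrix rates to projected signals\<close>

lemma det_2x2:
  fixes A :: "real mat"
  assumes A: "A \<in> carrier_mat 2 2"
  shows "det A = A $$ (0,0) * A $$ (1,1) - A $$ (0,1) * A $$ (1,0)"
proof -
  have "det A = (\<Sum>i<2. A $$ (i, 0) * cofactor A i 0)"
    by (rule laplace_expansion_column[OF A]) simp
  also have "\<dots> = A $$ (0,0) * cofactor A 0 0 + A $$ (1,0) * cofactor A 1 0"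
    by (simp add: numeral_2_eq_2)
  also have "cofactor A 0 0 = A $$ (1,1)"
  proof -
    have "mat_delete A 0 0 \<in> carrier_mat 1 1" using mat_delete_carrier[OF A] by simp
    then show ?thesis unfolding cofactor_def using A by (subst det_single) (auto simp: mat_delete_def)
  qed
  also have "cofactor A 1 0 = - A $$ (0,1)"
  proof -
    have "mat_delete A 1 0 \<in> carrier_mat 1 1" using mat_delete_carrier[OF A] by simp
    then show ?thesis unfolding cofactor_def using A by (subst det_single) (auto simp: mat_delete_def)
  qed
  finally show ?thesis by (simp add: mult.commute)
qed

lemma gram_index:
  fixes A :: "real mat"
  assumes "A \<in> carrier_mat n k" "i < n" "j < n"
  shows "(A * A\<^sup>T) $$ (i, j) = (\<Sum>s<k. A $$ (i, s) * A $$ (j, s))"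
  using assms by (auto simp: scalar_prod_def lessThan_atLeast0 intro!: sum.cong)

text \<open>Entries are expressed by inner products of rows and signal columns, so that only Gram
  data reach the determinants.\<close>

lemma effective_channel_matrix:
  fixes C M :: "real mat"
  assumes C: "C \<in> carrier_mat k n" and M: "M \<in> carrier_mat n l" and ij: "i < k" "j < k"
  shows "(C * (M * M\<^sup>T + N \<cdot>\<^sub>m 1\<^sub>m n) * C\<^sup>T) $$ (i, j)
    = (\<Sum>s<l. (row C i \<bullet> col M s) * (row C j \<bullet> col M s)) + N * (row C i \<bullet> row C j)"
    and "(N \<cdot>\<^sub>m (C * C\<^sup>T)) $$ (i, j) = N * (row C i \<bullet> row C j)"
proof -
  have CT: "C\<^sup>T \<in> carrier_mat n k" using C by simp
  have MM: "M * M\<^sup>T \<in> carrier_mat n n" using M by (rule gram_carrier)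
  have NI: "N \<cdot>\<^sub>m 1\<^sub>m n \<in> carrier_mat n n" by simp
  have "C * (M * M\<^sup>T + N \<cdot>\<^sub>m 1\<^sub>m n) * C\<^sup>T = C * (M * M\<^sup>T) * C\<^sup>T + C * (N \<cdot>\<^sub>m 1\<^sub>m n) * C\<^sup>T"
    unfolding mult_add_distrib_mat[OF C MM NI]
    by (rule add_mult_distrib_mat[OF mult_carrier_mat[OF C MM] mult_carrier_mat[OF C NI] CT])
  also have "C * (M * M\<^sup>T) * C\<^sup>T = (C * M) * (C * M)\<^sup>T" by (rule mult_gram_transpose[OF C M])
  also have "C * (N \<cdot>\<^sub>m 1\<^sub>m n) * C\<^sup>T = N \<cdot>\<^sub>m (C * C\<^sup>T)"
    unfolding mult_smult_distrib[OF C one_carrier_mat] right_mult_one_mat[OF C] by (rule mult_smult_assoc_mat[OF C CT])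
  finally have eq: "C * (M * M\<^sup>T + N \<cdot>\<^sub>m 1\<^sub>m n) * C\<^sup>T = (C * M) * (C * M)\<^sup>T + N \<cdot>\<^sub>m (C * C\<^sup>T)" .
  have CM: "C * M \<in> carrier_mat k l" by (rule mult_carrier_mat[OF C M])
  have "((C * M) * (C * M)\<^sup>T) $$ (i, j) = (\<Sum>s<l. (C * M) $$ (i, s) * (C * M) $$ (j, s))"
    by (rule gram_index[OF CM ij])
  also have "\<dots> = (\<Sum>s<l. (row C i \<bullet> col M s) * (row C j \<bullet> col M s))"
    using C M ij by (intro sum.cong) auto
  finally have e: "((C * M) * (C * M)\<^sup>T) $$ (i, j) = (\<Sum>s<l. (row C i \<bullet> col M s) * (row C j \<bullet> col M s))" .
  show 2: "(N \<cdot>\<^sub>m (C * C\<^sup>T)) $$ (i, j) = N * (row C i \<bullet> row C j)"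
    using C ij by simp
  have c: "N \<cdot>\<^sub>m (C * C\<^sup>T) \<in> carrier_mat k k" using gram_carrier[OF C] by simp
  have "((C * M) * (C * M)\<^sup>T + N \<cdot>\<^sub>m (C * C\<^sup>T)) $$ (i, j) = ((C * M) * (C * M)\<^sup>T) $$ (i, j) + (N \<cdot>\<^sub>m (C * C\<^sup>T)) $$ (i, j)"
    using c ij by (intro index_add_mat) auto
  then show "(C * (M * M\<^sup>T + N \<cdot>\<^sub>m 1\<^sub>m n) * C\<^sup>T) $$ (i, j)
    = (\<Sum>s<l. (row C i \<bullet> col M s) * (row C j \<bullet> col M s)) + N * (row C i \<bullet> row C j)"
    unfolding eq e 2 .
qed

lemma scalar_prod_sum: "w \<in> carrier_vec n \<Longrightarrow> (v :: real vec) \<bullet> w = (\<Sum>i<n. v $ i * w $ i)"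
  by (simp add: scalar_prod_def lessThan_atLeast0)

text \<open>\<open>p\<close> and \<open>q\<close> are the orthogonal projections of
  \<open>a1\<close> and \<open>a2\<close> to the row space of the effective matrix. With two
  independent rows the coordinates come from Cramer's rule for the Gram matrix; with a single row
  \<open>r\<close> both are multiples of \<open>r\<close>.\<close>

lemma rate_expr_projection:
  assumes N: "0 < N" and C: "C \<in> carrier_mat 2 e" and C0: "C \<noteq> 0\<^sub>m 2 e"
    and a: "a1 \<in> carrier_vec e" "a2 \<in> carrier_vec e"
  shows "\<exists>p q :: nat \<Rightarrow> real.
    (\<Sum>i<e. p i * (a1 $ i - p i)) = 0 \<and> (\<Sum>i<e. q i * (a2 $ i - q i)) = 0 \<and>
    (\<Sum>i<e. p i * (a2 $ i - q i)) = 0 \<and> (\<Sum>i<e. q i * (a1 $ i - p i)) = 0 \<and>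
    rate_expr N e (eff_C e C) (mat_of_cols e [a1] * (mat_of_cols e [a1])\<^sup>T) = ln (1 + (\<Sum>i<e. (p i)\<^sup>2) / N) / (2 * real e) \<and>
    rate_expr N e (eff_C e C) (mat_of_cols e [a2] * (mat_of_cols e [a2])\<^sup>T) = ln (1 + (\<Sum>i<e. (q i)\<^sup>2) / N) / (2 * real e) \<and>
    rate_expr N e (eff_C e C) (mat_of_cols e [a1, a2] * (mat_of_cols e [a1, a2])\<^sup>T)
      = ln ((1 + (\<Sum>i<e. (p i)\<^sup>2) / N) * (1 + (\<Sum>i<e. (q i)\<^sup>2) / N) - (\<Sum>i<e. p i * q i)\<^sup>2 / N\<^sup>2) / (2 * real e)"
proof -
  have mc: "mat_of_cols e [a1] \<in> carrier_mat e 1" "mat_of_cols e [a2] \<in> carrier_mat e 1" "mat_of_cols e [a1, a2] \<in> carrier_mat e 2"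
    using mat_of_cols_carrier(1)[of e "[a1]"] mat_of_cols_carrier(1)[of e "[a2]"] mat_of_cols_carrier(1)[of e "[a1, a2]"]
    by (auto simp: numeral_2_eq_2)
  have cols: "col (mat_of_cols e [a1]) 0 = a1" "col (mat_of_cols e [a2]) 0 = a2"
    "col (mat_of_cols e [a1, a2]) 0 = a1" "col (mat_of_cols e [a1, a2]) (Suc 0) = a2"
    using a by (auto intro!: col_mat_of_cols)
  have sum1: "(\<Sum>s<1. f s) = f 0" and sum2: "(\<Sum>s<2. f s) = f 0 + f (Suc 0)" for f :: "nat \<Rightarrow> real"
    by (simp_all add: numeral_2_eq_2)
  show ?thesis
  proof (cases "det (C * C\<^sup>T) = 0")
    case False
    define r1 r2 where "r1 = row C 0" "r2 = row C 1"
    note r = this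
    have rc: "r1 \<in> carrier_vec e" "r2 \<in> carrier_vec e" using C by (auto simp: r)
    define g11 g12 g22 where "g11 = r1 \<bullet> r1" "g12 = r1 \<bullet> r2" "g22 = r2 \<bullet> r2"
    note g = this
    have g21: "r2 \<bullet> r1 = g12" unfolding g using rc by (rule comm_scalar_prod[symmetric])
    define u1 u2 v1 v2 where "u1 = r1 \<bullet> a1" "u2 = r2 \<bullet> a1" "v1 = r1 \<bullet> a2" "v2 = r2 \<bullet> a2"
    note uv = this
    have Ce: "eff_C e C = C" using False by (simp add: eff_C_def)
    have dG: "det (C * C\<^sup>T) = g11 * g22 - g12\<^sup>2"
      using C g21 by (subst det_2x2) (auto simp: g r power2_eq_square)
    then have D: "g11 * g22 - g12\<^sup>2 \<noteq> 0" using False by simp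
    define d where "d = g11 * g22 - g12\<^sup>2"
    define x1 x2 y1 y2 where "x1 = (g22 * u1 - g12 * u2) / d" "x2 = (g11 * u2 - g12 * u1) / d"
       "y1 = (g22 * v1 - g12 * v2) / d" "y2 = (g11 * v2 - g12 * v1) / d"
    note xy = this
    have solve: "w1 = g11 * ((g22 * w1 - g12 * w2) / d) + g12 * ((g11 * w2 - g12 * w1) / d)"
        "w2 = g12 * ((g22 * w1 - g12 * w2) / d) + g22 * ((g11 * w2 - g12 * w1) / d)" for w1 w2
    proof -
      have "g11 * (g22 * w1 - g12 * w2) + g12 * (g11 * w2 - g12 * w1) = w1 * d"
        "g12 * (g22 * w1 - g12 * w2) + g22 * (g11 * w2 - g12 * w1) = w2 * d"
        by (simp_all add: d_def power2_eq_square algebra_simps)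
      moreover have "d \<noteq> 0" using D by (simp add: d_def)
      ultimately show "w1 = g11 * ((g22 * w1 - g12 * w2) / d) + g12 * ((g11 * w2 - g12 * w1) / d)"
        "w2 = g12 * ((g22 * w1 - g12 * w2) / d) + g22 * ((g11 * w2 - g12 * w1) / d)"
        by (simp_all add: add_divide_distrib[symmetric])
    qed
    have su: "u1 = g11 * x1 + g12 * x2" "u2 = g12 * x1 + g22 * x2" unfolding xy by (rule solve)+
    have sv: "v1 = g11 * y1 + g12 * y2" "v2 = g12 * y1 + g22 * y2" unfolding xy by (rule solve)+
    define p q where "p i = x1 * r1 $ i + x2 * r2 $ i" and "q i = y1 * r1 $ i + y2 * r2 $ i" for i
    have gs: "g11 = (\<Sum>i<e. r1 $ i * r1 $ i)" "g12 = (\<Sum>i<e. r1 $ i * r2 $ i)" "g22 = (\<Sum>i<e. r2 $ i * r2 $ i)"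
      "u1 = (\<Sum>i<e. r1 $ i * a1 $ i)" "u2 = (\<Sum>i<e. r2 $ i * a1 $ i)" "v1 = (\<Sum>i<e. r1 $ i * a2 $ i)" "v2 = (\<Sum>i<e. r2 $ i * a2 $ i)"
      unfolding g uv using rc a by (auto simp: scalar_prod_sum)
    have lin: "(\<Sum>i<e. (s * r1 $ i + t * r2 $ i) * f i) = s * (\<Sum>i<e. r1 $ i * f i) + t * (\<Sum>i<e. r2 $ i * f i)" for s t f
      by (simp add: sum_distrib_left sum.distrib[symmetric] algebra_simps)
    have r1p: "(\<Sum>i<e. r1 $ i * (s * r1 $ i + t * r2 $ i)) = g11 * s + g12 * t"
      "(\<Sum>i<e. r2 $ i * (s * r1 $ i + t * r2 $ i)) = g12 * s + g22 * t" for s t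
      unfolding gs by (simp_all add: sum_distrib_left sum_distrib_right sum.distrib[symmetric] algebra_simps)
    have orth: "(\<Sum>i<e. r1 $ i * (a1 $ i - p i)) = 0" "(\<Sum>i<e. r2 $ i * (a1 $ i - p i)) = 0"
      "(\<Sum>i<e. r1 $ i * (a2 $ i - q i)) = 0" "(\<Sum>i<e. r2 $ i * (a2 $ i - q i)) = 0"
      unfolding right_diff_distrib sum_subtractf p_def q_def r1p gs(4-7)[symmetric] su sv by simp_all
    have pp: "(\<Sum>i<e. (p i)\<^sup>2) = x1 * u1 + x2 * u2" "(\<Sum>i<e. (q i)\<^sup>2) = y1 * v1 + y2 * v2" "(\<Sum>i<e. p i * q i) = x1 * v1 + x2 * v2"
      unfolding power2_eq_square p_def q_def lin r1p su sv by simp_all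
    have C2: "C * (S + N \<cdot>\<^sub>m 1\<^sub>m e) * C\<^sup>T \<in> carrier_mat 2 2" "N \<cdot>\<^sub>m (C * C\<^sup>T) \<in> carrier_mat 2 2" for S
      using C by auto
    have z2: "0 < (2::nat)" and o2: "1 < (2::nat)" by simp_all
    have den: "det (N \<cdot>\<^sub>m (C * C\<^sup>T)) = N * g11 * (N * g22) - N * g12 * (N * g12)"
      unfolding det_2x2[OF C2(2)] effective_channel_matrix(2)[OF C mc(1) z2 z2] effective_channel_matrix(2)[OF C mc(1) z2 o2] effective_channel_matrix(2)[OF C mc(1) o2 z2] effective_channel_matrix(2)[OF C mc(1) o2 o2]
      unfolding r[symmetric] g[symmetric] g21 ..
    have num1: "det (C * (mat_of_cols e [a1] * (mat_of_cols e [a1])\<^sup>T + N \<cdot>\<^sub>m 1\<^sub>m e) * C\<^sup>T)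
       = (u1 * u1 + N * g11) * (u2 * u2 + N * g22) - (u1 * u2 + N * g12) * (u2 * u1 + N * g12)"
      unfolding det_2x2[OF C2(1)] effective_channel_matrix(1)[OF C mc(1) z2 z2] effective_channel_matrix(1)[OF C mc(1) z2 o2] effective_channel_matrix(1)[OF C mc(1) o2 z2] effective_channel_matrix(1)[OF C mc(1) o2 o2]
      unfolding sum1 cols r[symmetric] g[symmetric] g21 uv[symmetric] ..
    have num2: "det (C * (mat_of_cols e [a2] * (mat_of_cols e [a2])\<^sup>T + N \<cdot>\<^sub>m 1\<^sub>m e) * C\<^sup>T)
       = (v1 * v1 + N * g11) * (v2 * v2 + N * g22) - (v1 * v2 + N * g12) * (v2 * v1 + N * g12)"
      unfolding det_2x2[OF C2(1)] effective_channel_matrix(1)[OF C mc(2) z2 z2] effective_channel_matrix(1)[OF C mc(2) z2 o2] effective_channel_matrix(1)[OF C mc(2) o2 z2] effective_channel_matrix(1)[OF C mc(2) o2 o2]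
      unfolding sum1 cols r[symmetric] g[symmetric] g21 uv[symmetric] ..
    have num12: "det (C * (mat_of_cols e [a1, a2] * (mat_of_cols e [a1, a2])\<^sup>T + N \<cdot>\<^sub>m 1\<^sub>m e) * C\<^sup>T)
       = (u1 * u1 + v1 * v1 + N * g11) * (u2 * u2 + v2 * v2 + N * g22) - (u1 * u2 + v1 * v2 + N * g12) * (u2 * u1 + v2 * v1 + N * g12)"
      unfolding det_2x2[OF C2(1)] effective_channel_matrix(1)[OF C mc(3) z2 z2] effective_channel_matrix(1)[OF C mc(3) z2 o2] effective_channel_matrix(1)[OF C mc(3) o2 z2] effective_channel_matrix(1)[OF C mc(3) o2 o2]
      unfolding sum2 cols r[symmetric] g[symmetric] g21 uv[symmetric] ..
    have N0: "N \<noteq> 0" using N by simp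
    have rates: "rate_expr N e (eff_C e C) (mat_of_cols e [a1] * (mat_of_cols e [a1])\<^sup>T) = ln (1 + (\<Sum>i<e. (p i)\<^sup>2) / N) / (2 * real e)"
      "rate_expr N e (eff_C e C) (mat_of_cols e [a2] * (mat_of_cols e [a2])\<^sup>T) = ln (1 + (\<Sum>i<e. (q i)\<^sup>2) / N) / (2 * real e)"
      "rate_expr N e (eff_C e C) (mat_of_cols e [a1, a2] * (mat_of_cols e [a1, a2])\<^sup>T)
        = ln ((1 + (\<Sum>i<e. (p i)\<^sup>2) / N) * (1 + (\<Sum>i<e. (q i)\<^sup>2) / N) - (\<Sum>i<e. p i * q i)\<^sup>2 / N\<^sup>2) / (2 * real e)"
      unfolding rate_expr_def Ce den num1 num2 num12 pp
      by (simp_all only: two_row_determinants(1)[OF D N0 su sv] two_row_determinants(1)[OF D N0 sv su] two_row_determinants(2)[OF D N0 su sv])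
    have o4: "(\<Sum>i<e. p i * (a1 $ i - p i)) = 0" "(\<Sum>i<e. q i * (a2 $ i - q i)) = 0"
      "(\<Sum>i<e. p i * (a2 $ i - q i)) = 0" "(\<Sum>i<e. q i * (a1 $ i - p i)) = 0"
    proof -
      have l: "(\<Sum>i<e. p i * f i) = x1 * (\<Sum>i<e. r1 $ i * f i) + x2 * (\<Sum>i<e. r2 $ i * f i)"
        "(\<Sum>i<e. q i * f i) = y1 * (\<Sum>i<e. r1 $ i * f i) + y2 * (\<Sum>i<e. r2 $ i * f i)" for f
        unfolding p_def q_def by (rule lin)+
      show "(\<Sum>i<e. p i * (a1 $ i - p i)) = 0" "(\<Sum>i<e. q i * (a2 $ i - q i)) = 0"
      "(\<Sum>i<e. p i * (a2 $ i - q i)) = 0" "(\<Sum>i<e. q i * (a1 $ i - p i)) = 0"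
        by (simp_all only: l[of "\<lambda>i. a1 $ i - p i"] l[of "\<lambda>i. a2 $ i - q i"] orth mult_zero_right add_0_left)
    qed
    show ?thesis using o4 rates by blast
  next
    case True
    \<comment> \<open>As \<open>C\<close> is nonzero, the row kept by \<open>eff_C\<close> is
      nonzero, and its squared norm \<open>g\<close> can be divided by.\<close>
    define r where "r = (if row C 0 \<noteq> 0\<^sub>v e then row C 0 else row C 1)"
    have r: "r \<in> carrier_vec e" using C by (auto simp: r_def)
    have r0: "r \<noteq> 0\<^sub>v e"
    proof
      assume "r = 0\<^sub>v e"
      then have rows: "row C 0 = 0\<^sub>v e" "row C 1 = 0\<^sub>v e" by (auto simp: r_def split: if_splits)
      have "C = 0\<^sub>m 2 e"
      proof (rule eq_matI)
        fix i j assume ij: "i < dim_row (0\<^sub>m 2 e :: real mat)" "j < dim_col (0\<^sub>m 2 e :: real mat)"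
        then have "i = 0 \<or> i = 1" by auto
        then have "row C i = 0\<^sub>v e" using rows by auto
        then have "row C i $ j = 0" using ij by simp
        then show "C $$ (i, j) = 0\<^sub>m 2 e $$ (i, j)" using ij C by simp
      qed (use C in auto)
      then show False using C0 by simp
    qed
    define Ce where "Ce = mat_of_rows e [r]"
    have Ce: "eff_C e C = Ce" using True by (simp add: eff_C_def Ce_def r_def)
    have Cec: "Ce \<in> carrier_mat 1 e" unfolding Ce_def using mat_of_rows_carrier(1)[of e "[r]"] by simp
    have row: "row Ce 0 = r" using r by (simp add: Ce_def)
    define g u v where "g = r \<bullet> r" "u = r \<bullet> a1" "v = r \<bullet> a2"
    note guv = this
    have gs: "g = (\<Sum>i<e. r $ i * r $ i)" "u = (\<Sum>i<e. r $ i * a1 $ i)" "v = (\<Sum>i<e. r $ i * a2 $ i)"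
      unfolding guv using r a by (auto simp: scalar_prod_sum)
    have gp: "0 < g"
    proof -
      have "0 \<le> g" unfolding gs by (intro sum_nonneg) simp
      moreover have "g \<noteq> 0"
      proof
        assume "g = 0"
        then have "\<forall>i\<in>{..<e}. r $ i * r $ i = 0" unfolding gs by (subst (asm) sum_nonneg_eq_0_iff) auto
        then have "r = 0\<^sub>v e" using r by (intro eq_vecI) auto
        then show False using r0 by simp
      qed
      ultimately show ?thesis by simp
    qed
    define p q where "p i = u / g * r $ i" and "q i = v / g * r $ i" for i
    have l: "(\<Sum>i<e. p i * f i) = u / g * (\<Sum>i<e. r $ i * f i)" "(\<Sum>i<e. q i * f i) = v / g * (\<Sum>i<e. r $ i * f i)" for f
      unfolding p_def q_def by (simp_all add: sum_distrib_left mult.assoc)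
    have rp: "(\<Sum>i<e. r $ i * p i) = u" "(\<Sum>i<e. r $ i * q i) = v"
    proof -
      have tg: "(\<Sum>i<e. r $ i * (t * r $ i)) = t * g" for t unfolding gs by (simp add: sum_distrib_left mult.left_commute)
      show "(\<Sum>i<e. r $ i * p i) = u" "(\<Sum>i<e. r $ i * q i) = v" unfolding p_def q_def tg using gp by simp_all
    qed
    have orth: "(\<Sum>i<e. r $ i * (a1 $ i - p i)) = 0" "(\<Sum>i<e. r $ i * (a2 $ i - q i)) = 0"
      unfolding right_diff_distrib sum_subtractf rp gs(2,3)[symmetric] by simp_all
    have pp: "(\<Sum>i<e. (p i)\<^sup>2) = u * u / g" "(\<Sum>i<e. (q i)\<^sup>2) = v * v / g" "(\<Sum>i<e. p i * q i) = u * v / g"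
      unfolding power2_eq_square l rp by simp_all
    have C2: "Ce * (S + N \<cdot>\<^sub>m 1\<^sub>m e) * Ce\<^sup>T \<in> carrier_mat 1 1" "N \<cdot>\<^sub>m (Ce * Ce\<^sup>T) \<in> carrier_mat 1 1" for S
      using Cec by auto
    have den: "det (N \<cdot>\<^sub>m (Ce * Ce\<^sup>T)) = N * g"
      unfolding det_single[OF C2(2)] by (simp only: effective_channel_matrix(2)[OF Cec mc(1)] row guv less_one)
    have num: "det (Ce * (mat_of_cols e [a1] * (mat_of_cols e [a1])\<^sup>T + N \<cdot>\<^sub>m 1\<^sub>m e) * Ce\<^sup>T) = u * u + N * g"
      "det (Ce * (mat_of_cols e [a2] * (mat_of_cols e [a2])\<^sup>T + N \<cdot>\<^sub>m 1\<^sub>m e) * Ce\<^sup>T) = v * v + N * g"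
      "det (Ce * (mat_of_cols e [a1, a2] * (mat_of_cols e [a1, a2])\<^sup>T + N \<cdot>\<^sub>m 1\<^sub>m e) * Ce\<^sup>T) = u * u + v * v + N * g"
      unfolding det_single[OF C2(1)]
      by (simp_all only: effective_channel_matrix(1)[OF Cec mc(1)] effective_channel_matrix(1)[OF Cec mc(2)]
          effective_channel_matrix(1)[OF Cec mc(3)] row guv less_one sum1 sum2 cols)
    have q1: "(u * u + N * g) / (N * g) = 1 + u * u / g / N" "(v * v + N * g) / (N * g) = 1 + v * v / g / N"
      "(u * u + v * v + N * g) / (N * g) = (1 + u * u / g / N) * (1 + v * v / g / N) - (u * v / g)\<^sup>2 / N\<^sup>2"
      using N gp by (simp_all add: power2_eq_square field_simps)
    have rates: "rate_expr N e (eff_C e C) (mat_of_cols e [a1] * (mat_of_cols e [a1])\<^sup>T) = ln (1 + (\<Sum>i<e. (p i)\<^sup>2) / N) / (2 * real e)"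
      "rate_expr N e (eff_C e C) (mat_of_cols e [a2] * (mat_of_cols e [a2])\<^sup>T) = ln (1 + (\<Sum>i<e. (q i)\<^sup>2) / N) / (2 * real e)"
      "rate_expr N e (eff_C e C) (mat_of_cols e [a1, a2] * (mat_of_cols e [a1, a2])\<^sup>T)
        = ln ((1 + (\<Sum>i<e. (p i)\<^sup>2) / N) * (1 + (\<Sum>i<e. (q i)\<^sup>2) / N) - (\<Sum>i<e. p i * q i)\<^sup>2 / N\<^sup>2) / (2 * real e)"
      unfolding rate_expr_def Ce den num pp q1 by simp_all
    have "(\<Sum>i<e. p i * (a1 $ i - p i)) = 0" "(\<Sum>i<e. q i * (a2 $ i - q i)) = 0"
      "(\<Sum>i<e. p i * (a2 $ i - q i)) = 0" "(\<Sum>i<e. q i * (a1 $ i - p i)) = 0"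
      by (simp_all only: l[of "\<lambda>i. a1 $ i - p i"] l[of "\<lambda>i. a2 $ i - q i"] orth mult_zero_right add_0_left)
    then show ?thesis using rates by blast
  qed
qed

section \<open>Existence of codes\<close>

text \<open>Given the codewords, the power splits into a symbol part with factor
  \<open>\<tau>\<close> and a noise part \<open>\<nu>\<close>. The bound for the symbol part is
  affine in \<open>power_dev\<close>, so the average over messages puts at most \<open>r\<close> in
  its place, and the total factor \<open>\<tau> * (1 + 4 * \<theta> + r / \<theta>)\<close> is at
  most one. What remains is the trace bound once per block.\<close>

lemma average_power_bound:
  fixes X :: "nat \<Rightarrow> nat \<Rightarrow> nat \<Rightarrow> 'w \<Rightarrow> real" and c1 c2 :: "nat \<Rightarrow> nat \<Rightarrow> real"
  assumes n: "0 < L" "L * \<eta> \<le> n" "0 < n" and k: "0 < k1" "0 < k2" and \<theta>: "0 < \<theta>" and \<tau>: "0 \<le> \<tau>" "\<tau> * (1 + 4 * \<theta> + r / \<theta>) \<le> 1"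
    and idle: "\<And>t m1 m2 \<omega>. \<not> t < L * \<eta> \<Longrightarrow> X t m1 m2 \<omega> = 0"
    and second: "\<And>b i m1 m2. b < L \<Longrightarrow> i < \<eta> \<Longrightarrow> m1 < k1 \<Longrightarrow> m2 < k2 \<Longrightarrow>
       (\<integral>\<^sup>+\<omega>. ennreal ((X (b * \<eta> + i) m1 m2 \<omega>)\<^sup>2) \<partial>M)
         = ennreal ((h1 i * (sqrt \<tau> * c1 m1 b) + h2 i * (sqrt \<tau> * c2 m2 b))\<^sup>2 + \<nu> i)"
    and \<nu>: "\<And>i. 0 \<le> \<nu> i"
    and dev: "1 / (real k1 * real k2) * (\<Sum>m1<k1. \<Sum>m2<k2. power_dev L (c1 m1, c2 m2)) \<le> r"
    and P: "(\<Sum>i<\<eta>. (h1 i)\<^sup>2 + (h2 i)\<^sup>2 + \<nu> i) \<le> real \<eta> * P" "0 \<le> P"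
  shows "ennreal (1 / real n) * (\<Sum>t<n. ennreal (1 / (real k1 * real k2)) *
        (\<Sum>m1<k1. \<Sum>m2<k2. \<integral>\<^sup>+\<omega>. ennreal ((X t m1 m2 \<omega>)\<^sup>2) \<partial>M)) \<le> ennreal P"
proof -
  define V where "V t m1 m2 = (if t < L * \<eta> then
      (h1 (t mod \<eta>) * (sqrt \<tau> * c1 m1 (t div \<eta>)) + h2 (t mod \<eta>) * (sqrt \<tau> * c2 m2 (t div \<eta>)))\<^sup>2 + \<nu> (t mod \<eta>) else 0)" for t m1 m2
  have V0: "0 \<le> V t m1 m2" for t m1 m2 by (simp add: V_def \<nu>)
  have V: "(\<integral>\<^sup>+\<omega>. ennreal ((X t m1 m2 \<omega>)\<^sup>2) \<partial>M) = ennreal (V t m1 m2)" if m: "m1 < k1" "m2 < k2" for t m1 m2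
  proof (cases "t < L * \<eta>")
    case True
    then have "t div \<eta> < L" "t mod \<eta> < \<eta>"
      using less_mult_imp_div_less[of t L \<eta>] by (auto intro!: mod_less_divisor gr0I)
    from second[OF this m] True show ?thesis by (simp add: V_def)
  next
    case False then show ?thesis by (simp add: idle V_def)
  qed
  define kk where "kk = real k1 * real k2"
  have kk: "0 < kk" using k by (simp add: kk_def)
  define H where "H = (\<Sum>i<\<eta>. (h1 i)\<^sup>2 + (h2 i)\<^sup>2)"
  define nu where "nu = (\<Sum>i<\<eta>. \<nu> i)"
  have H0: "0 \<le> H" by (auto simp: H_def intro!: sum_nonneg)
  have VS: "(\<Sum>t<n. V t m1 m2) \<le> real L * (\<tau> * (H * (1 + 4 * \<theta> + power_dev L (c1 m1, c2 m2) / \<theta>)) + nu)" for m1 m2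
  proof -
    have "(\<Sum>t<n. V t m1 m2) = (\<Sum>b<L. \<Sum>i<\<eta>. V (b * \<eta> + i) m1 m2)"
      by (rule sum_blocks[OF n(2)]) (simp add: V_def)
    also have "\<dots> = (\<Sum>b<L. \<Sum>i<\<eta>. \<tau> * (h1 i * c1 m1 b + h2 i * c2 m2 b)\<^sup>2 + \<nu> i)"
    proof (intro sum.cong refl)
      fix b i assume bi: "b \<in> {..<L}" "i \<in> {..<\<eta>}"
      have "(h1 i * (sqrt \<tau> * c1 m1 b) + h2 i * (sqrt \<tau> * c2 m2 b))\<^sup>2 = (sqrt \<tau> * (h1 i * c1 m1 b + h2 i * c2 m2 b))\<^sup>2"
        by (simp add: algebra_simps)
      also have "\<dots> = \<tau> * (h1 i * c1 m1 b + h2 i * c2 m2 b)\<^sup>2" using \<tau> by (simp add: power_mult_distrib)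
      finally show "V (b * \<eta> + i) m1 m2 = \<tau> * (h1 i * c1 m1 b + h2 i * c2 m2 b)\<^sup>2 + \<nu> i"
        using bi block_index_less[of b L i \<eta> "L * \<eta>"] by (simp add: V_def)
    qed
    also have "\<dots> = \<tau> * (\<Sum>b<L. \<Sum>i<\<eta>. (h1 i * c1 m1 b + h2 i * c2 m2 b)\<^sup>2) + real L * nu"
      by (simp add: sum.distrib sum_distrib_left nu_def)
    also have "\<dots> \<le> \<tau> * (real L * (H * (1 + 4 * \<theta> + power_dev L (c1 m1, c2 m2) / \<theta>))) + real L * nu"
      unfolding H_def using block_power_bound[OF n(1) \<theta>] \<tau>(1) by (intro add_right_mono mult_left_mono)
    finally show ?thesis by (simp add: algebra_simps)
  qed
  have "(\<Sum>t<n. 1 / kk * (\<Sum>m1<k1. \<Sum>m2<k2. V t m1 m2)) = 1 / kk * (\<Sum>m1<k1. \<Sum>m2<k2. \<Sum>t<n. V t m1 m2)"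
  proof -
    have "(\<Sum>t<n. \<Sum>m1<k1. \<Sum>m2<k2. V t m1 m2) = (\<Sum>m1<k1. \<Sum>t<n. \<Sum>m2<k2. V t m1 m2)" by (rule sum.swap)
    also have "\<dots> = (\<Sum>m1<k1. \<Sum>m2<k2. \<Sum>t<n. V t m1 m2)" by (intro sum.cong refl sum.swap)
    finally show ?thesis by (simp only: sum_distrib_left[symmetric])
  qed
  also have "\<dots> \<le> 1 / kk * (\<Sum>m1<k1. \<Sum>m2<k2. real L * (\<tau> * (H * (1 + 4 * \<theta> + power_dev L (c1 m1, c2 m2) / \<theta>)) + nu))"
    using kk by (intro mult_left_mono sum_mono VS) auto
  also have "\<dots> = real L * (\<tau> * (H * (1 + 4 * \<theta> + (1 / kk * (\<Sum>m1<k1. \<Sum>m2<k2. power_dev L (c1 m1, c2 m2))) / \<theta>)) + nu)"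
  proof -
    define PD where "PD = (\<Sum>m1<k1. \<Sum>m2<k2. power_dev L (c1 m1, c2 m2))"
    define A B where "A = real L * (\<tau> * (H * (1 + 4 * \<theta>)) + nu)" and "B = real L * \<tau> * H / \<theta>"
    have aff: "real L * (\<tau> * (H * (1 + 4 * \<theta> + x / \<theta>)) + nu) = A + B * x" for x
      by (simp add: A_def B_def algebra_simps)
    have "(\<Sum>m1<k1. \<Sum>m2<k2. A + B * power_dev L (c1 m1, c2 m2)) = kk * A + B * PD"
      by (simp add: sum.distrib sum_distrib_left kk_def PD_def)
    then show ?thesis unfolding aff PD_def[symmetric] using kk by (simp add: distrib_left)
  qed
  also have "\<dots> \<le> real L * (H + nu)"
  proof (intro mult_left_mono add_right_mono)
    have "\<tau> * (1 + 4 * \<theta> + (1 / kk * (\<Sum>m1<k1. \<Sum>m2<k2. power_dev L (c1 m1, c2 m2))) / \<theta>) \<le> \<tau> * (1 + 4 * \<theta> + r / \<theta>)"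
      using \<tau>(1) \<theta> dev by (intro mult_left_mono add_left_mono divide_right_mono) (auto simp: kk_def)
    also have "\<dots> \<le> 1" by (rule \<tau>(2))
    finally have "\<tau> * (1 + 4 * \<theta> + (1 / kk * (\<Sum>m1<k1. \<Sum>m2<k2. power_dev L (c1 m1, c2 m2))) / \<theta>) \<le> 1" .
    from mult_right_mono[OF this H0]
    show "\<tau> * (H * (1 + 4 * \<theta> + (1 / kk * (\<Sum>m1<k1. \<Sum>m2<k2. power_dev L (c1 m1, c2 m2))) / \<theta>)) \<le> H"
      by (simp only: mult_1 mult.assoc mult.commute[of H])
  qed simp
  also have "\<dots> \<le> real L * (real \<eta> * P)"
    using P(1) by (intro mult_left_mono) (auto simp: H_def nu_def sum.distrib)
  also have "\<dots> = real (L * \<eta>) * P" by simp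
  also have "\<dots> \<le> real n * P" using n(2) P(2) by (intro mult_right_mono) (simp_all only: of_nat_le_iff)
  finally have main: "(\<Sum>t<n. 1 / kk * (\<Sum>m1<k1. \<Sum>m2<k2. V t m1 m2)) \<le> real n * P" .
  have "ennreal (1 / real n) * (\<Sum>t<n. ennreal (1 / kk) *
        (\<Sum>m1<k1. \<Sum>m2<k2. \<integral>\<^sup>+\<omega>. ennreal ((X t m1 m2 \<omega>)\<^sup>2) \<partial>M))
     = ennreal (1 / real n) * (\<Sum>t<n. ennreal (1 / kk) * (\<Sum>m1<k1. \<Sum>m2<k2. ennreal (V t m1 m2)))"
    using V by simp
  also have "\<dots> = ennreal (1 / real n * (\<Sum>t<n. 1 / kk * (\<Sum>m1<k1. \<Sum>m2<k2. V t m1 m2)))"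
  proof -
    have "(\<Sum>m1<k1. \<Sum>m2<k2. ennreal (V t m1 m2)) = ennreal (\<Sum>m1<k1. \<Sum>m2<k2. V t m1 m2)" for t
      using V0 by (simp add: sum_ennreal sum_nonneg)
    moreover have "ennreal (1 / kk) * ennreal x = ennreal (1 / kk * x)" for x
      using kk by (intro ennreal_mult'[symmetric]) simp
    moreover have "0 \<le> 1 / kk * (\<Sum>m1<k1. \<Sum>m2<k2. V t m1 m2)" for t
      using V0 kk by (intro mult_nonneg_nonneg sum_nonneg) auto
    then have "(\<Sum>t<n. ennreal (1 / kk * (\<Sum>m1<k1. \<Sum>m2<k2. V t m1 m2))) = ennreal (\<Sum>t<n. 1 / kk * (\<Sum>m1<k1. \<Sum>m2<k2. V t m1 m2))"
      by (rule sum_ennreal)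
    moreover have "ennreal (1 / real n) * ennreal x = ennreal (1 / real n * x)" for x
      by (intro ennreal_mult'[symmetric]) simp
    ultimately show ?thesis by (simp only:)
  qed
  also have "\<dots> \<le> ennreal P"
    using main n(3) by (intro ennreal_leI) (simp only: times_divide_eq_left mult_1 pos_divide_le_eq of_nat_0_less_iff mult.commute)
  finally show ?thesis by (simp add: kk_def)
qed

text \<open>\<open>N + de\<close> is the Schur complement of \<open>N + be\<close> in the Gram
  matrix of the signals with \<open>N\<close> added on the diagonal, so the two chain-rule factors
  multiply to the sum-rate determinant.\<close>

lemma (in gaussian_mac) information_values:
  "I1 = ln (1 + al / N) / 2" "I2 = ln (1 + be / N) / 2"
  "I12 = ln ((1 + al / N) * (1 + be / N) - ka\<^sup>2 / N\<^sup>2) / 2"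
proof -
  have f: "1 + x / N = (N + x) / N" for x
    using N_pos by (simp add: add_divide_distrib)
  have ls: "ln (1 / sqrt (N / (N + x))) = ln (1 + x / N) / 2" if "0 \<le> x" for x
  proof -
    have p: "0 < N + x" "0 < N / (N + x)" using N_pos that by (auto intro: add_pos_nonneg divide_pos_pos)
    have "ln (1 / sqrt (N / (N + x))) = - (ln (N / (N + x)) / 2)"
      using p by (simp add: ln_div ln_sqrt)
    also have "\<dots> = ln ((N + x) / N) / 2" using p N_pos by (simp add: ln_div field_simps)
    finally show ?thesis unfolding f .
  qed
  show "I1 = ln (1 + al / N) / 2" "I2 = ln (1 + be / N) / 2"
    unfolding I1_def I2_def sa_def sb_def by (simp_all add: ls al_nonneg be_nonneg)
  have "I12 = ln (1 + de / N) / 2 + ln (1 + be / N) / 2"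
    unfolding I12_def sd_def sb_def by (simp add: ls de_nonneg be_nonneg)
  also have "\<dots> = ln ((1 + de / N) * (1 + be / N)) / 2"
  proof -
    have "0 < 1 + de / N" "0 < 1 + be / N" using N_pos de_nonneg be_nonneg by (auto intro: add_pos_nonneg)
    then show ?thesis by (simp add: ln_mult)
  qed
  also have "(1 + de / N) * (1 + be / N) = (1 + al / N) * (1 + be / N) - ka\<^sup>2 / N\<^sup>2"
  proof -
    have nb: "N + be \<noteq> 0" using N_pos be_nonneg by simp
    have "de * (N + be) = al * (N + be) - ka\<^sup>2" using nb by (simp add: de_def left_diff_distrib)
    then have "(N + de) * (N + be) = (N + al) * (N + be) - ka\<^sup>2" by (simp add: distrib_right)
    then show ?thesis unfolding f times_divide_times_eq power2_eq_square[of N] by (simp only: diff_divide_distrib)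
  qed
  finally show "I12 = ln ((1 + al / N) * (1 + be / N) - ka\<^sup>2 / N\<^sup>2) / 2" .
qed

lemma decodes_unique:
  "m1 < k1 \<Longrightarrow> m2 < k2 \<Longrightarrow> decodes A k1 k2 c1 c2 y m1 m2 \<Longrightarrow>
   n1 < k1 \<Longrightarrow> n2 < k2 \<Longrightarrow> decodes A k1 k2 c1 c2 y n1 n2 \<Longrightarrow> (m1, m2) = (n1, n2)"
  unfolding decodes_def by blast

text \<open>One number \<open>r\<close> bounds two nonnegative averages, error and power deviation,
  because their sum is below \<open>r\<close>. The factor \<open>sqrt \<tau>\<close> is attributed
  to the signal vectors \<open>a1'\<close>, \<open>a2'\<close> in the decoding analysis and to the
  symbols \<open>d1\<close>, \<open>d2\<close> in the encoders, where the gains belong to the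
  unscaled \<open>a1\<close>, \<open>a2\<close> of the trace condition.\<close>

lemma code_exists:
  fixes a1 a2 :: "real vec" and B1 B2 :: "real mat"
  assumes psd: "psd_mat (KW_mat s1 s2 rho)" and N: "0 < N" and P: "0 \<le> P1" "0 \<le> P2"
    and a: "a1 \<in> carrier_vec \<eta>" "a2 \<in> carrier_vec \<eta>" and B: "strictly_lower \<eta> B1" "strictly_lower \<eta> B2"
    and pw: "power_ok N (KW_mat s1 s2 rho) P1 P2 \<eta> a1 a2 B1 B2"
    and L: "0 < L" "L * \<eta> \<le> n" "0 < n" and k: "0 < k1" "0 < k2" and e: "0 < \<epsilon>"
    and \<theta>: "0 < \<theta>" and \<tau>: "0 \<le> \<tau>" "\<tau> * (1 + 4 * \<theta> + r / \<theta>) \<le> 1"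
  defines "a1' \<equiv> \<lambda>i. sqrt \<tau> * a1 $ i" and "a2' \<equiv> \<lambda>i. sqrt \<tau> * a2 $ i"
  assumes bound: "40 / (\<epsilon>\<^sup>2 * real L) + real (k1 - 1) * exp (- (real L * (gaussian_mac.I1 \<eta> N a1' - \<epsilon>)))
      + real (k2 - 1) * exp (- (real L * (gaussian_mac.I2 \<eta> N a2' - \<epsilon>)))
      + real ((k1 - 1) * (k2 - 1)) * exp (- (real L * (gaussian_mac.I12 \<eta> N a1' a2' - \<epsilon>))) + 8 / real L < r"
  shows "\<exists>f1 f2 g. is_code N (KW_mat s1 s2 rho) P1 P2 n k1 k2 f1 f2 g \<and> err_prob N (KW_mat s1 s2 rho) n k1 k2 f1 f2 g \<le> r"
proof -
  interpret gaussian_mac \<eta> N a1' a2' by standard (rule N)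
  interpret Om: prob_space "noise_space n" by (rule prob_space_noise_space)
  define K where "K = KW_mat s1 s2 rho"
  obtain c1 c2 where cb: "ennreal (1 / (real k1 * real k2)) * (\<Sum>m1<k1. \<Sum>m2<k2.
       emeasure (noise_space n) {\<omega> \<in> space (noise_space n). \<not> decodes (test L \<epsilon>) k1 k2 c1 c2 (obs L (c1 m1, c2 m2, \<omega>)) m1 m2}
       + ennreal (power_dev L (c1 m1, c2 m2))) < ennreal r"
    and c1: "\<And>m. m < k1 \<Longrightarrow> c1 m \<in> space (std_block L)" and c2: "\<And>m. m < k2 \<Longrightarrow> c2 m \<in> space (std_block L)"
    using codebook_exists[OF L(1,2) e k bound] by blast
  define Bad where "Bad m1 m2 = {\<omega> \<in> space (noise_space n). \<not> decodes (test L \<epsilon>) k1 k2 c1 c2 (obs L (c1 m1, c2 m2, \<omega>)) m1 m2}" for m1 m2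
  have PD0: "0 \<le> power_dev L p" for p by (simp add: power_dev_def split_beta')
  define kk where "kk = real k1 * real k2"
  have kk: "0 < kk" using k by (simp add: kk_def)
  have avg: "1 / kk * (\<Sum>m1<k1. \<Sum>m2<k2. measure (noise_space n) (Bad m1 m2) + power_dev L (c1 m1, c2 m2)) < r"
  proof -
    have nn: "0 \<le> measure (noise_space n) (Bad m1 m2) + power_dev L (c1 m1, c2 m2)" for m1 m2 using PD0 by simp
    have "(\<Sum>m1<k1. \<Sum>m2<k2. emeasure (noise_space n) (Bad m1 m2) + ennreal (power_dev L (c1 m1, c2 m2)))
      = (\<Sum>m1<k1. \<Sum>m2<k2. ennreal (measure (noise_space n) (Bad m1 m2) + power_dev L (c1 m1, c2 m2)))"
      using PD0 by (simp add: Om.emeasure_eq_measure)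
    also have "\<dots> = ennreal (\<Sum>m1<k1. \<Sum>m2<k2. measure (noise_space n) (Bad m1 m2) + power_dev L (c1 m1, c2 m2))"
      using nn by (simp only: sum_ennreal sum_nonneg)
    finally have "ennreal (1 / kk) * ennreal (\<Sum>m1<k1. \<Sum>m2<k2. measure (noise_space n) (Bad m1 m2) + power_dev L (c1 m1, c2 m2)) < ennreal r"
      using cb unfolding Bad_def[symmetric] kk_def by (simp only:)
    moreover have "ennreal (1 / kk) * ennreal (\<Sum>m1<k1. \<Sum>m2<k2. measure (noise_space n) (Bad m1 m2) + power_dev L (c1 m1, c2 m2))
       = ennreal (1 / kk * (\<Sum>m1<k1. \<Sum>m2<k2. measure (noise_space n) (Bad m1 m2) + power_dev L (c1 m1, c2 m2)))"
      using kk by (intro ennreal_mult'[symmetric]) simp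
    moreover have "0 \<le> 1 / kk * (\<Sum>m1<k1. \<Sum>m2<k2. measure (noise_space n) (Bad m1 m2) + power_dev L (c1 m1, c2 m2))"
      using kk nn by (intro mult_nonneg_nonneg sum_nonneg) auto
    ultimately show ?thesis by (simp only: ennreal_less_iff)
  qed
  have avgE: "1 / kk * (\<Sum>m1<k1. \<Sum>m2<k2. measure (noise_space n) (Bad m1 m2)) \<le> r"
  proof -
    have "1 / kk * (\<Sum>m1<k1. \<Sum>m2<k2. measure (noise_space n) (Bad m1 m2)) \<le> 1 / kk * (\<Sum>m1<k1. \<Sum>m2<k2. measure (noise_space n) (Bad m1 m2) + power_dev L (c1 m1, c2 m2))"
      using kk PD0 by (intro mult_left_mono sum_mono) auto
    then show ?thesis using avg by linarith
  qed
  have avgP: "1 / (real k1 * real k2) * (\<Sum>m1<k1. \<Sum>m2<k2. power_dev L (c1 m1, c2 m2)) \<le> r"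
  proof -
    have "1 / kk * (\<Sum>m1<k1. \<Sum>m2<k2. power_dev L (c1 m1, c2 m2)) \<le> 1 / kk * (\<Sum>m1<k1. \<Sum>m2<k2. measure (noise_space n) (Bad m1 m2) + power_dev L (c1 m1, c2 m2))"
      using kk by (intro mult_left_mono sum_mono) auto
    then show ?thesis using avg by (simp add: kk_def)
  qed
  define d1 d2 where "d1 m b = sqrt \<tau> * c1 m b" and "d2 m b = sqrt \<tau> * c2 m b" for m b
  define b1 b2 where "b1 i j = B1 $$ (i, j)" and "b2 i j = B2 $$ (i, j)" for i j
  define f1 where "f1 = lin_enc \<eta> L (\<lambda>i. a1 $ i) b1 d1"
  define f2 where "f2 = lin_enc \<eta> L (\<lambda>i. a2 $ i) b2 d2"
  define Q where "Q p d \<longleftrightarrow> fst p < k1 \<and> snd p < k2 \<and> decodes (test L \<epsilon>) k1 k2 c1 c2 (innov \<eta> L b1 b2 d) (fst p) (snd p)" for p d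
  \<comment> \<open>If no message pair decodes, the value is unspecified; such an outcome lies in
    \<open>Bad\<close> for whichever pair was sent.\<close>
  define g where "g d = (THE p. Q p d)" for d
  have Q_unique: "Q p d \<Longrightarrow> Q p' d \<Longrightarrow> p = p'" for p p' d
    unfolding Q_def using decodes_unique[of "fst p" k1 "snd p" k2 "test L \<epsilon>" c1 c2 "innov \<eta> L b1 b2 d" "fst p'" "snd p'"] by (cases p; cases p') auto
  \<comment> \<open>The candidates are finitely many and at most one of them satisfies
    \<open>Q\<close>, as measurability of a definite description requires.\<close>
  have mg: "g \<in> measurable (PiM {..<n} (\<lambda>_. borel)) (count_space UNIV)"
    unfolding g_def
  proof (rule measurable_THE[where I="{..<k1} \<times> {..<k2}"])
    fix p
    show "Measurable.pred (PiM {..<n} (\<lambda>_. borel)) (Q p)"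
    proof (cases "fst p < k1 \<and> snd p < k2")
      case True
      have t: "Measurable.pred (PiM {..<n} (\<lambda>_. borel)) (\<lambda>d. test L \<epsilon> (c1 m1, c2 m2, innov \<eta> L b1 b2 d))" if "m1 < k1" "m2 < k2" for m1 m2
        using c1[OF that(1)] c2[OF that(2)] measurable_innov[OF L(2), of b1 b2]
        by (intro measurable_compose[OF _ measurable_test]) (auto intro!: measurable_Pair)
      then have t': "Measurable.pred (PiM {..<n} (\<lambda>_. borel)) (\<lambda>d. \<not> test L \<epsilon> (c1 m1, c2 m2, innov \<eta> L b1 b2 d))" if "m1 < k1" "m2 < k2" for m1 m2
        using that by (intro pred_intros_logic) auto
      show ?thesis
        unfolding Q_def decodes_def using True
        by (intro pred_intros_logic pred_intros_countable pred_intros_imp' pred_intros_conj1' t t') auto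
    next
      case False
      then have "Q p = (\<lambda>_. False)" by (auto simp: Q_def fun_eq_iff)
      then show ?thesis by simp
    qed
  next
    fix p d assume "Q p d" then show "p \<in> {..<k1} \<times> {..<k2}" by (cases p) (simp add: Q_def)
  next
    fix d p p' assume "Q p d" "Q p' d" then show "p = p'" by (rule Q_unique)
  qed simp
  have io: "innov \<eta> L b1 b2 (\<lambda>t\<in>{..<n}. (chY N K f1 f2 m1 m2 \<omega> t, W1s K \<omega> t, W2s K \<omega> t)) = obs L (c1 m1, c2 m2, \<omega>)" for m1 m2 \<omega>
    unfolding f1_def f2_def innov_output[OF L(2)] obs_def prod.case unfolding a1'_def a2'_def d1_def d2_def by (simp add: mult_ac)
  have err: "err_prob N K n k1 k2 f1 f2 g \<le> r"
  proof -
    have "measure (noise_space n) {\<omega> \<in> space (noise_space n). g (\<lambda>t\<in>{..<n}. (chY N K f1 f2 m1 m2 \<omega> t, W1s K \<omega> t, W2s K \<omega> t)) \<noteq> (m1, m2)}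
       \<le> measure (noise_space n) (Bad m1 m2)" if m: "m1 < k1" "m2 < k2" for m1 m2
    proof (rule Om.finite_measure_mono)
      show "{\<omega> \<in> space (noise_space n). g (\<lambda>t\<in>{..<n}. (chY N K f1 f2 m1 m2 \<omega> t, W1s K \<omega> t, W2s K \<omega> t)) \<noteq> (m1, m2)} \<subseteq> Bad m1 m2"
      proof safe
        fix \<omega> assume \<omega>: "\<omega> \<in> space (noise_space n)" and ne: "g (\<lambda>t\<in>{..<n}. (chY N K f1 f2 m1 m2 \<omega> t, W1s K \<omega> t, W2s K \<omega> t)) \<noteq> (m1, m2)"
        show "\<omega> \<in> Bad m1 m2"
        proof (rule ccontr)
          assume "\<omega> \<notin> Bad m1 m2"
          then have "Q (m1, m2) (\<lambda>t\<in>{..<n}. (chY N K f1 f2 m1 m2 \<omega> t, W1s K \<omega> t, W2s K \<omega> t))"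
            using \<omega> m unfolding Q_def io by (simp add: Bad_def)
          then have "g (\<lambda>t\<in>{..<n}. (chY N K f1 f2 m1 m2 \<omega> t, W1s K \<omega> t, W2s K \<omega> t)) = (m1, m2)"
            unfolding g_def by (intro the_equality) (auto dest: Q_unique)
          then show False using ne by simp
        qed
      qed
      have mo: "(\<lambda>\<omega>. obs L (c1 m1, c2 m2, \<omega>)) \<in> measurable (noise_space n) (obs_space L)"
        using c1[OF m(1)] c2[OF m(2)] by (intro measurable_compose[OF _ measurable_obs[OF L(2)]]) (auto intro!: measurable_Pair)
      have t: "Measurable.pred (noise_space n) (\<lambda>\<omega>. test L \<epsilon> (c1 n1, c2 n2, obs L (c1 m1, c2 m2, \<omega>)))" if "n1 < k1" "n2 < k2" for n1 n2
        using c1[OF that(1)] c2[OF that(2)] mo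
        by (intro measurable_compose[OF _ measurable_test]) (auto intro!: measurable_Pair)
      then have t': "Measurable.pred (noise_space n) (\<lambda>\<omega>. \<not> test L \<epsilon> (c1 n1, c2 n2, obs L (c1 m1, c2 m2, \<omega>)))" if "n1 < k1" "n2 < k2" for n1 n2
        using that by (intro pred_intros_logic) auto
      have "Measurable.pred (noise_space n) (\<lambda>\<omega>. \<not> decodes (test L \<epsilon>) k1 k2 c1 c2 (obs L (c1 m1, c2 m2, \<omega>)) m1 m2)"
        unfolding decodes_def using m
        by (intro pred_intros_logic pred_intros_countable pred_intros_imp' t t') auto
      then show "Bad m1 m2 \<in> sets (noise_space n)" unfolding Bad_def by measurable
    qed
    then have "err_prob N K n k1 k2 f1 f2 g \<le> 1 / kk * (\<Sum>m1<k1. \<Sum>m2<k2. measure (noise_space n) (Bad m1 m2))"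
      unfolding err_prob_def kk_def[symmetric] using kk by (intro mult_left_mono sum_mono) auto
    then show ?thesis using avgE by linarith
  qed
  obtain h1 h2 p q w where S: "\<And>i. i < 2 * \<eta> \<Longrightarrow> Sigma_mat N K \<eta> a1 a2 B1 B2 $$ (i, i) =
        (h1 i)\<^sup>2 + (h2 i)\<^sup>2 + (\<Sum>j<\<eta>. (p i j)\<^sup>2 + (q i j)\<^sup>2 + (w i j)\<^sup>2)"
    and resp: "\<forall>X1 X2 x1 x2 z u1 u2.
       (\<forall>i<\<eta>. X1 i = a1 $ i * x1 + (\<Sum>j<i. B1 $$ (i, j) * (X1 j + X2 j + sqrt N * z j + chol11 K * u1 j))) \<longrightarrow>
       (\<forall>i<\<eta>. X2 i = a2 $ i * x2 + (\<Sum>j<i. B2 $$ (i, j) * (X1 j + X2 j + sqrt N * z j + (chol21 K * u1 j + chol22 K * u2 j)))) \<longrightarrow>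
       (\<forall>i<\<eta>. X1 i = h1 i * x1 + h2 i * x2 + (\<Sum>j<\<eta>. p i j * z j + q i j * u1 j + w i j * u2 j) \<and>
          X2 i = h1 (\<eta> + i) * x1 + h2 (\<eta> + i) * x2 + (\<Sum>j<\<eta>. p (\<eta> + i) j * z j + q (\<eta> + i) j * u1 j + w (\<eta> + i) j * u2 j))"
    using feedback_response[OF psd less_imp_le[OF N] a B] unfolding K_def[symmetric] by blast
  define \<nu> where "\<nu> i = (\<Sum>j<\<eta>. (p i j)\<^sup>2 + (q i j)\<^sup>2 + (w i j)\<^sup>2)" for i
  have \<nu>0: "0 \<le> \<nu> i" for i unfolding \<nu>_def by (intro sum_nonneg) simp
  \<comment> \<open>Within block \<open>b\<close> and for a fixed noise realisation, the encoders
    obey the recursion solved by the gains; the symbols contribute a constant and the noise a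
    centred form.\<close>
  have X12: "fst (chX N K f1 f2 m1 m2 \<omega> (b * \<eta> + i)) = (h1 i * d1 m1 b + h2 i * d2 m2 b)
        + (\<Sum>j<\<eta>. p i j * fst (\<omega> (b * \<eta> + j)) + q i j * fst (snd (\<omega> (b * \<eta> + j))) + w i j * snd (snd (\<omega> (b * \<eta> + j))))
     \<and> snd (chX N K f1 f2 m1 m2 \<omega> (b * \<eta> + i)) = (h1 (\<eta> + i) * d1 m1 b + h2 (\<eta> + i) * d2 m2 b)
        + (\<Sum>j<\<eta>. p (\<eta> + i) j * fst (\<omega> (b * \<eta> + j)) + q (\<eta> + i) j * fst (snd (\<omega> (b * \<eta> + j))) + w (\<eta> + i) j * snd (snd (\<omega> (b * \<eta> + j))))"
    if b: "b < L" and i: "i < \<eta>" for b i m1 m2 \<omega>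
  proof -
    note R = resp[rule_format, of "\<lambda>i. fst (chX N K f1 f2 m1 m2 \<omega> (b * \<eta> + i))" "d1 m1 b"
        "\<lambda>i. snd (chX N K f1 f2 m1 m2 \<omega> (b * \<eta> + i))" "\<lambda>j. fst (\<omega> (b * \<eta> + j))" "\<lambda>j. fst (snd (\<omega> (b * \<eta> + j)))"
        "d2 m2 b" "\<lambda>j. snd (snd (\<omega> (b * \<eta> + j)))" i]
    show ?thesis
    proof (rule R[OF _ _ i])
      fix l assume l: "l < \<eta>"
      show "fst (chX N K f1 f2 m1 m2 \<omega> (b * \<eta> + l)) = a1 $ l * d1 m1 b + (\<Sum>j<l. B1 $$ (l, j) * (fst (chX N K f1 f2 m1 m2 \<omega> (b * \<eta> + j))
          + snd (chX N K f1 f2 m1 m2 \<omega> (b * \<eta> + j)) + sqrt N * fst (\<omega> (b * \<eta> + j)) + chol11 K * fst (snd (\<omega> (b * \<eta> + j)))))"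
        using lin_enc_block_inputs(1)[OF b l] unfolding f1_def f2_def b1_def .
      show "snd (chX N K f1 f2 m1 m2 \<omega> (b * \<eta> + l)) = a2 $ l * d2 m2 b + (\<Sum>j<l. B2 $$ (l, j) * (fst (chX N K f1 f2 m1 m2 \<omega> (b * \<eta> + j))
          + snd (chX N K f1 f2 m1 m2 \<omega> (b * \<eta> + j)) + sqrt N * fst (\<omega> (b * \<eta> + j)) + (chol21 K * fst (snd (\<omega> (b * \<eta> + j))) + chol22 K * snd (snd (\<omega> (b * \<eta> + j))))))"
        using lin_enc_block_inputs(2)[OF b l] unfolding f1_def f2_def b2_def .
    qed
  qed
  have pw1: "(\<Sum>i<\<eta>. (h1 i)\<^sup>2 + (h2 i)\<^sup>2 + \<nu> i) \<le> real \<eta> * P1"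
    using pw S unfolding power_ok_def K_def[symmetric] Let_def \<nu>_def by simp
  have pw2: "(\<Sum>i<\<eta>. (h1 (\<eta> + i))\<^sup>2 + (h2 (\<eta> + i))\<^sup>2 + \<nu> (\<eta> + i)) \<le> real \<eta> * P2"
  proof -
    have "(\<Sum>i\<in>{\<eta>..<2*\<eta>}. Sigma_mat N K \<eta> a1 a2 B1 B2 $$ (i, i)) = (\<Sum>i<\<eta>. Sigma_mat N K \<eta> a1 a2 B1 B2 $$ (\<eta> + i, \<eta> + i))"
      using sum.shift_bounds_nat_ivl[of "\<lambda>i. Sigma_mat N K \<eta> a1 a2 B1 B2 $$ (i, i)" 0 \<eta> \<eta>] by (simp add: mult_2 lessThan_atLeast0 add.commute)
    also have "\<dots> = (\<Sum>i<\<eta>. (h1 (\<eta> + i))\<^sup>2 + (h2 (\<eta> + i))\<^sup>2 + \<nu> (\<eta> + i))"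
      using S by (intro sum.cong) (auto simp: \<nu>_def)
    finally show ?thesis using pw unfolding power_ok_def K_def[symmetric] Let_def by simp
  qed
  have "is_code N K P1 P2 n k1 k2 f1 f2 g"
    unfolding is_code_def
  proof (intro conjI allI impI)
    show "f1 t m \<in> borel_measurable (PiM {..<t} (\<lambda>_. borel))" "f2 t m \<in> borel_measurable (PiM {..<t} (\<lambda>_. borel))" for t m
      unfolding f1_def f2_def by (rule measurable_lin_enc)+
    show "ennreal (1 / real n) * (\<Sum>t<n. ennreal (1 / (real k1 * real k2)) *
        (\<Sum>m1<k1. \<Sum>m2<k2. \<integral>\<^sup>+ \<omega>. ennreal ((fst (chX N K f1 f2 m1 m2 \<omega> t))\<^sup>2) \<partial>noise_space n)) \<le> ennreal P1"
    proof (rule average_power_bound[OF L k \<theta> \<tau> _ _ \<nu>0 avgP pw1 P(1)])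
      show "\<not> t < L * \<eta> \<Longrightarrow> fst (chX N K f1 f2 m1 m2 \<omega> t) = 0" for t m1 m2 \<omega>
        unfolding f1_def f2_def by (rule lin_enc_inputs_idle)
      show "(\<integral>\<^sup>+\<omega>. ennreal ((fst (chX N K f1 f2 m1 m2 \<omega> (b * \<eta> + i)))\<^sup>2) \<partial>noise_space n)
         = ennreal ((h1 i * (sqrt \<tau> * c1 m1 b) + h2 i * (sqrt \<tau> * c2 m2 b))\<^sup>2 + \<nu> i)" if "b < L" "i < \<eta>" for b i m1 m2
        unfolding X12[OF that, THEN conjunct1] \<nu>_def d1_def[symmetric] d2_def[symmetric] by (rule noise_block_second_moment[OF that(1) L(2)])
    qed
    show "ennreal (1 / real n) * (\<Sum>t<n. ennreal (1 / (real k1 * real k2)) *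
        (\<Sum>m1<k1. \<Sum>m2<k2. \<integral>\<^sup>+ \<omega>. ennreal ((snd (chX N K f1 f2 m1 m2 \<omega> t))\<^sup>2) \<partial>noise_space n)) \<le> ennreal P2"
    proof (rule average_power_bound[OF L k \<theta> \<tau> _ _ \<nu>0 avgP pw2 P(2)])
      show "\<not> t < L * \<eta> \<Longrightarrow> snd (chX N K f1 f2 m1 m2 \<omega> t) = 0" for t m1 m2 \<omega>
        unfolding f1_def f2_def by (rule lin_enc_inputs_idle)
      show "(\<integral>\<^sup>+\<omega>. ennreal ((snd (chX N K f1 f2 m1 m2 \<omega> (b * \<eta> + i)))\<^sup>2) \<partial>noise_space n)
         = ennreal ((h1 (\<eta> + i) * (sqrt \<tau> * c1 m1 b) + h2 (\<eta> + i) * (sqrt \<tau> * c2 m2 b))\<^sup>2 + \<nu> (\<eta> + i))" if "b < L" "i < \<eta>" for b i m1 m2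
        unfolding X12[OF that, THEN conjunct2] \<nu>_def d1_def[symmetric] d2_def[symmetric] by (rule noise_block_second_moment[OF that(1) L(2)])
    qed
  qed (use k mg in auto)
  then show ?thesis using err unfolding K_def by blast
qed

section \<open>Achievability\<close>

text \<open>Half of \<open>\<delta>\<close> absorbs the approximation of the rate pair and the other
  half is left to the codes; this is what handles the closure in the region.\<close>

lemma achievable_limit:
  assumes "\<And>d. 0 < d \<Longrightarrow> \<exists>R1' R2'. achievable P1 P2 N K R1' R2' \<and> R1 - d < R1' \<and> R2 - d < R2'"
  shows "achievable P1 P2 N K R1 R2"
  unfolding achievable_def
proof (intro allI impI)
  fix \<delta> :: real assume d: "0 < \<delta>"
  then obtain R1' R2' where R: "achievable P1 P2 N K R1' R2'" "R1 - \<delta> / 2 < R1'" "R2 - \<delta> / 2 < R2'"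
    using assms[of "\<delta> / 2"] by auto
  have d2: "0 < \<delta> / 2" using d by simp
  from R(1)[unfolded achievable_def, THEN spec, of "\<delta> / 2", THEN mp, OF d2] obtain k1 k2 f1 f2 g where code:
    "\<forall>\<^sub>F n in sequentially. is_code N K P1 P2 n (k1 n) (k2 n) (f1 n) (f2 n) (g n) \<and>
        ln (real (k1 n)) / real n > R1' - \<delta> / 2 \<and> ln (real (k2 n)) / real n > R2' - \<delta> / 2"
    "(\<lambda>n. err_prob N K n (k1 n) (k2 n) (f1 n) (f2 n) (g n)) \<longlonglongrightarrow> 0"
    by (elim exE conjE) (rule that)
  have "\<forall>\<^sub>F n in sequentially. is_code N K P1 P2 n (k1 n) (k2 n) (f1 n) (f2 n) (g n) \<and>
        ln (real (k1 n)) / real n > R1 - \<delta> \<and> ln (real (k2 n)) / real n > R2 - \<delta>"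
    using code(1) by (rule eventually_mono) (use R(2,3) in auto)
  then show "\<exists>k1 k2 f1 f2 g. (\<forall>\<^sub>F n in sequentially. is_code N K P1 P2 n (k1 n) (k2 n) (f1 n) (f2 n) (g n) \<and>
        ln (real (k1 n)) / real n > R1 - \<delta> \<and> ln (real (k2 n)) / real n > R2 - \<delta>) \<and>
      (\<lambda>n. err_prob N K n (k1 n) (k2 n) (f1 n) (f2 n) (g n)) \<longlonglongrightarrow> 0"
    using code(2) by blast
qed

lemma err_prob_nonneg: "0 \<le> err_prob N K n k1 k2 f1 f2 g"
  unfolding err_prob_def by (intro mult_nonneg_nonneg sum_nonneg) auto

text \<open>Rounding up secures the rate, while the number \<open>k - 1\<close> of competing
  messages still stays below \<open>exp x\<close>. For negative \<open>x\<close> there is one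
  message and no competitor.\<close>

lemma message_count:
  fixes x :: real
  defines "k \<equiv> nat \<lceil>exp x\<rceil>"
  shows "0 < k" "x \<le> ln (real k)" "real (k - 1) \<le> exp x"
proof -
  have p: "0 < \<lceil>exp x\<rceil>" by simp
  then show k: "0 < k" by (simp add: k_def)
  have rk: "real k = of_int \<lceil>exp x\<rceil>" using p by (simp add: k_def)
  then have "exp x \<le> real k" by simp
  then have "ln (exp x) \<le> ln (real k)" by (intro ln_mono) auto
  then show "x \<le> ln (real k)" by simp
  have "real (k - 1) = real k - 1" using k by simp
  then show "real (k - 1) \<le> exp x" using rk ceiling_correct[of "exp x"] by linarith
qed

lemma exp_decay: "0 < d \<Longrightarrow> (\<lambda>n. exp (c - real n * d)) \<longlonglongrightarrow> 0"
proof -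
  assume "0 < d"
  then have "(\<lambda>n. exp c * exp (- d) ^ n) \<longlonglongrightarrow> exp c * 0"
    by (intro tendsto_mult tendsto_const LIMSEQ_realpow_zero) auto
  moreover have "exp c * exp (- d) ^ n = exp (c - real n * d)" for n
    by (simp add: exp_of_nat_mult[symmetric] exp_add[symmetric])
  ultimately show ?thesis by simp
qed

text \<open>The rate is backed off by at least \<open>\<delta> / 2\<close> and the information by
  \<open>\<delta> / 4\<close>, which leaves \<open>\<delta> / 4\<close> as exponent; up to
  \<open>\<eta>\<close> idle times cost the constant \<open>\<eta> * R\<close>. The factor
  \<open>c\<close> is \<open>1 / 2\<close> for one user and 1 for both together.\<close>

lemma exponent_bound:
  fixes R I \<delta> :: real
  assumes n: "L * \<eta> \<le> n" "n \<le> L * \<eta> + \<eta>" and R: "0 \<le> R" and I: "real \<eta> * (R - \<delta> / 4) \<le> I" and d: "0 \<le> \<delta>" and c: "1 / 2 \<le> c"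
  shows "real n * (R - c * \<delta>) - real L * I \<le> real \<eta> * R - real n * (\<delta> / 4)"
proof -
  have "real L * (real \<eta> * (R - \<delta> / 4)) \<le> real L * I" using I by (intro mult_left_mono) auto
  moreover have "real L * (real \<eta> * (R - \<delta> / 4)) = real (L * \<eta>) * R - real (L * \<eta>) * (\<delta> / 4)" by (simp add: algebra_simps)
  moreover have "real (L * \<eta>) * (\<delta> / 4) \<le> real n * (\<delta> / 4)" using n d by (intro mult_right_mono) (simp_all only: of_nat_le_iff)
  moreover have "real n * R \<le> real (L * \<eta> + \<eta>) * R" using n R by (intro mult_right_mono) (simp_all only: of_nat_le_iff)
  moreover have "real n * (1 / 2 * \<delta>) \<le> real n * (c * \<delta>)" using c d by (intro mult_left_mono mult_right_mono) auto
  ultimately show ?thesis by (simp add: algebra_simps)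
qed

lemma region_point_achievable:
  fixes a1 a2 :: "real vec" and B1 B2 :: "real mat"
  assumes psd: "psd_mat (KW_mat s1 s2 rho)" and N: "0 < N" and P: "0 \<le> P1" "0 \<le> P2" and eta: "0 < \<eta>"
    and a: "a1 \<in> carrier_vec \<eta>" "a2 \<in> carrier_vec \<eta>" and B: "strictly_lower \<eta> B1" "strictly_lower \<eta> B2"
    and pw: "power_ok N (KW_mat s1 s2 rho) P1 P2 \<eta> a1 a2 B1 B2"
    and R: "0 \<le> R1" "0 \<le> R2"
  defines "al \<equiv> (\<Sum>i<\<eta>. (a1 $ i)\<^sup>2)" and "be \<equiv> (\<Sum>i<\<eta>. (a2 $ i)\<^sup>2)" and "ka \<equiv> (\<Sum>i<\<eta>. a1 $ i * a2 $ i)"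
  assumes R1: "R1 \<le> ln (1 + al / N) / (2 * real \<eta>)" and R2: "R2 \<le> ln (1 + be / N) / (2 * real \<eta>)"
    and R12: "R1 + R2 \<le> ln ((1 + al / N) * (1 + be / N) - ka\<^sup>2 / N\<^sup>2) / (2 * real \<eta>)"
  shows "achievable P1 P2 N (KW_mat s1 s2 rho) R1 R2"
  unfolding achievable_def
proof (intro allI impI)
  fix \<delta> :: real assume d: "0 < \<delta>"
  define K where "K = KW_mat s1 s2 rho"
  \<comment> \<open>There are two losses of \<open>\<epsilon>\<close>, from the thresholds and from
    the scaling; together they make up \<open>\<eta> * \<delta> / 4\<close>.\<close>
  define \<epsilon> where "\<epsilon> = real \<eta> * \<delta> / 8"
  have e: "0 < \<epsilon>" using d eta by (simp add: \<epsilon>_def)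
  have nn: "0 \<le> al" "0 \<le> be" by (auto simp: al_def be_def intro!: sum_nonneg)
  have one: "1 \<le> (1 + al / N) * (1 + be / N) - ka\<^sup>2 / N\<^sup>2"
    unfolding al_def be_def ka_def by (rule projection_gram(3)[OF N, where f="\<lambda>i. a1 $ i" and g="\<lambda>i. a2 $ i"]) simp_all
  \<comment> \<open>The informations as functions of the scaling. Continuity at 1 from the left
    supplies a \<open>\<tau> < 1\<close> that costs less than \<open>\<epsilon>\<close> in all
    three.\<close>
  define F1 where "F1 \<tau> = ln (1 + \<tau> * al / N) / 2" for \<tau>
  define F2 where "F2 \<tau> = ln (1 + \<tau> * be / N) / 2" for \<tau>
  define F12 where "F12 \<tau> = ln ((1 + \<tau> * al / N) * (1 + \<tau> * be / N) - (\<tau> * ka)\<^sup>2 / N\<^sup>2) / 2" for \<tau>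
  have "\<forall>\<^sub>F \<tau> in at_left 1. F1 1 - \<epsilon> < F1 \<tau>" "\<forall>\<^sub>F \<tau> in at_left 1. F2 1 - \<epsilon> < F2 \<tau>" "\<forall>\<^sub>F \<tau> in at_left 1. F12 1 - \<epsilon> < F12 \<tau>"
  proof -
    have "0 < 1 + 1 * al / N" "0 < 1 + 1 * be / N"
      using nn N by (auto intro!: add_pos_nonneg)
    then have "(F1 \<longlongrightarrow> F1 1) (at_left 1)" "(F2 \<longlongrightarrow> F2 1) (at_left 1)"
      unfolding F1_def F2_def using N by (intro tendsto_intros; simp)+
    moreover have "(F12 \<longlongrightarrow> F12 1) (at_left 1)"
      unfolding F12_def using N one by (intro tendsto_intros) auto
    ultimately show "\<forall>\<^sub>F \<tau> in at_left 1. F1 1 - \<epsilon> < F1 \<tau>" "\<forall>\<^sub>F \<tau> in at_left 1. F2 1 - \<epsilon> < F2 \<tau>" "\<forall>\<^sub>F \<tau> in at_left 1. F12 1 - \<epsilon> < F12 \<tau>"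
      using e by (auto dest!: order_tendstoD(1))
  qed
  moreover have "\<forall>\<^sub>F \<tau> in at_left (1::real). 0 < \<tau> \<and> \<tau> < 1"
    by (auto simp: eventually_at_left[of 0 1] intro!: exI[of _ 0])
  ultimately have "\<forall>\<^sub>F \<tau> in at_left (1::real). F1 1 - \<epsilon> < F1 \<tau> \<and> F2 1 - \<epsilon> < F2 \<tau> \<and> F12 1 - \<epsilon> < F12 \<tau> \<and> 0 < \<tau> \<and> \<tau> < 1"
    by eventually_elim auto
  then obtain \<tau> where F: "F1 1 - \<epsilon> < F1 \<tau>" "F2 1 - \<epsilon> < F2 \<tau>" "F12 1 - \<epsilon> < F12 \<tau>" and \<tau>: "0 < \<tau>" "\<tau> < 1"
    using eventually_happens[of _ "at_left (1::real)"] by (auto simp: trivial_limit_at_left_real)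
  \<comment> \<open>Solves \<open>\<tau> * (1 + 5 * \<theta>) = 1\<close>. Four parts cover
    \<open>4 * \<theta>\<close>, and the fifth covers \<open>r / \<theta>\<close> as soon as
    \<open>r \<le> \<theta>^2\<close>.\<close>
  define \<theta> where "\<theta> = (1 / \<tau> - 1) / 5"
  have \<theta>: "0 < \<theta>" using \<tau> by (simp add: \<theta>_def)
  have \<tau>\<theta>: "\<tau> * (1 + 5 * \<theta>) = 1" using \<tau> by (simp add: \<theta>_def field_simps)
  define a1' a2' where "a1' = (\<lambda>i. sqrt \<tau> * a1 $ i)" and "a2' = (\<lambda>i. sqrt \<tau> * a2 $ i)"
  interpret G: gaussian_mac \<eta> N a1' a2' by standard (rule N)
  have "G.al = \<tau> * al" "G.be = \<tau> * be" "G.ka = \<tau> * ka"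
    unfolding G.al_def G.be_def G.ka_def unfolding a1'_def a2'_def al_def be_def ka_def sum_distrib_left using \<tau>
    by (auto simp: power_mult_distrib intro!: sum.cong)
  then have I: "G.I1 = F1 \<tau>" "G.I2 = F2 \<tau>" "G.I12 = F12 \<tau>"
    unfolding G.information_values F1_def F2_def F12_def by simp_all
  have I_ge: "real \<eta> * (R1 - \<delta> / 4) \<le> G.I1 - \<epsilon>" "real \<eta> * (R2 - \<delta> / 4) \<le> G.I2 - \<epsilon>" "real \<eta> * (R1 + R2 - \<delta> / 4) \<le> G.I12 - \<epsilon>"
  proof -
    have "real \<eta> * R1 \<le> F1 1" "real \<eta> * R2 \<le> F2 1" "real \<eta> * (R1 + R2) \<le> F12 1"
    proof -
      have "real \<eta> * x \<le> y / 2" if "x \<le> y / (2 * real \<eta>)" for x y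
        using that eta by (simp add: pos_le_divide_eq mult_ac)
      from this[OF R1] this[OF R2] this[OF R12] show "real \<eta> * R1 \<le> F1 1" "real \<eta> * R2 \<le> F2 1" "real \<eta> * (R1 + R2) \<le> F12 1"
        unfolding F1_def F2_def F12_def mult_1 .
    qed
    then show "real \<eta> * (R1 - \<delta> / 4) \<le> G.I1 - \<epsilon>" "real \<eta> * (R2 - \<delta> / 4) \<le> G.I2 - \<epsilon>" "real \<eta> * (R1 + R2 - \<delta> / 4) \<le> G.I12 - \<epsilon>"
      unfolding I using F by (auto simp: \<epsilon>_def right_diff_distrib)
  qed
  define k1 where "k1 n = nat \<lceil>exp (real n * (R1 - \<delta> / 2))\<rceil>" for n
  define k2 where "k2 n = nat \<lceil>exp (real n * (R2 - \<delta> / 2))\<rceil>" for n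
  have k: "0 < k1 n" "0 < k2 n" for n by (simp_all add: k1_def k2_def message_count(1))
  \<comment> \<open>Test failure and power deviation, the three kinds of wrong codewords, and
    \<open>1 / n\<close>, which makes the bound strict. The factor \<open>2 * \<eta> / n\<close>
    stands for \<open>1 / L\<close>.\<close>
  define r where "r n = (40 / \<epsilon>\<^sup>2 + 8) * (2 * real \<eta> / real n) + exp (real \<eta> * R1 - real n * (\<delta> / 4))
    + exp (real \<eta> * R2 - real n * (\<delta> / 4)) + exp (real \<eta> * (R1 + R2) - real n * (\<delta> / 4)) + 1 / real n" for n
  have r_lim: "r \<longlonglongrightarrow> 0"
  proof -
    have "r \<longlonglongrightarrow> (40 / \<epsilon>\<^sup>2 + 8) * 0 + 0 + 0 + 0 + 0"
      unfolding r_def using d by (intro tendsto_add tendsto_mult tendsto_const exp_decay lim_const_over_n) auto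
    then show ?thesis by simp
  qed
  define L where "L n = n div \<eta>" for n
  have codes: "\<exists>f1 f2 g. is_code N K P1 P2 n (k1 n) (k2 n) f1 f2 g \<and> err_prob N K n (k1 n) (k2 n) f1 f2 g \<le> r n"
    if n: "\<eta> \<le> n" "r n \<le> \<theta>\<^sup>2" for n
  proof -
    have n0: "0 < n" using n eta by simp
    have L0: "0 < L n" using n eta by (simp add: L_def div_greater_zero_iff)
    have Ln: "L n * \<eta> \<le> n" by (simp add: L_def)
    have nL: "n \<le> L n * \<eta> + \<eta>" unfolding L_def using div_mult_mod_eq[of n \<eta>] mod_less_divisor[OF eta, of n] by linarith
    \<comment> \<open>At least one full block exists, so the idle tail at most doubles the length;
      hence the 2 in \<open>r\<close>.\<close>
    have nL2: "n \<le> 2 * (L n * \<eta>)"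
    proof -
      have "\<eta> \<le> L n * \<eta>" using L0 by simp
      then show ?thesis using nL by linarith
    qed
    have inv: "1 / real (L n) \<le> 2 * real \<eta> / real n"
    proof -
      have "real n \<le> real (2 * (L n * \<eta>))" using nL2 by (simp only: of_nat_le_iff)
      then have "real n / real (L n) \<le> 2 * real \<eta>" using L0 by (simp add: pos_divide_le_eq mult_ac)
      then show ?thesis using n0 by (simp add: pos_le_divide_eq)
    qed
    have x1: "real (k1 n - 1) * exp (- (real (L n) * (G.I1 - \<epsilon>))) \<le> exp (real \<eta> * R1 - real n * (\<delta> / 4))"
    proof -
      have "real (k1 n - 1) * exp (- (real (L n) * (G.I1 - \<epsilon>))) \<le> exp (real n * (R1 - \<delta> / 2)) * exp (- (real (L n) * (G.I1 - \<epsilon>)))"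
        unfolding k1_def by (intro mult_right_mono message_count(3)) simp
      also have "\<dots> = exp (real n * (R1 - 1 / 2 * \<delta>) - real (L n) * (G.I1 - \<epsilon>))" by (simp add: exp_add[symmetric])
      also have "\<dots> \<le> exp (real \<eta> * R1 - real n * (\<delta> / 4))"
        unfolding exp_le_cancel_iff by (rule exponent_bound[OF Ln nL R(1) I_ge(1)]) (use d in auto)
      finally show ?thesis .
    qed
    have x2: "real (k2 n - 1) * exp (- (real (L n) * (G.I2 - \<epsilon>))) \<le> exp (real \<eta> * R2 - real n * (\<delta> / 4))"
    proof -
      have "real (k2 n - 1) * exp (- (real (L n) * (G.I2 - \<epsilon>))) \<le> exp (real n * (R2 - \<delta> / 2)) * exp (- (real (L n) * (G.I2 - \<epsilon>)))"
        unfolding k2_def by (intro mult_right_mono message_count(3)) simp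
      also have "\<dots> = exp (real n * (R2 - 1 / 2 * \<delta>) - real (L n) * (G.I2 - \<epsilon>))" by (simp add: exp_add[symmetric])
      also have "\<dots> \<le> exp (real \<eta> * R2 - real n * (\<delta> / 4))"
        unfolding exp_le_cancel_iff by (rule exponent_bound[OF Ln nL R(2) I_ge(2)]) (use d in auto)
      finally show ?thesis .
    qed
    have x12: "real ((k1 n - 1) * (k2 n - 1)) * exp (- (real (L n) * (G.I12 - \<epsilon>))) \<le> exp (real \<eta> * (R1 + R2) - real n * (\<delta> / 4))"
    proof -
      have "real ((k1 n - 1) * (k2 n - 1)) * exp (- (real (L n) * (G.I12 - \<epsilon>)))
         \<le> (exp (real n * (R1 - \<delta> / 2)) * exp (real n * (R2 - \<delta> / 2))) * exp (- (real (L n) * (G.I12 - \<epsilon>)))"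
        unfolding of_nat_mult k1_def k2_def by (intro mult_right_mono mult_mono message_count(3)) auto
      also have "\<dots> = exp (real n * (R1 + R2 - 1 * \<delta>) - real (L n) * (G.I12 - \<epsilon>))"
        by (simp add: exp_add[symmetric]) (simp add: algebra_simps)
      also have "\<dots> \<le> exp (real \<eta> * (R1 + R2) - real n * (\<delta> / 4))"
        unfolding exp_le_cancel_iff by (rule exponent_bound[OF Ln nL _ I_ge(3)]) (use d R in auto)
      finally show ?thesis .
    qed
    have "40 / (\<epsilon>\<^sup>2 * real (L n)) + 8 / real (L n) = (40 / \<epsilon>\<^sup>2 + 8) * (1 / real (L n))"
      by (simp add: add_divide_distrib distrib_right)
    also have "\<dots> \<le> (40 / \<epsilon>\<^sup>2 + 8) * (2 * real \<eta> / real n)"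
      by (intro mult_left_mono inv) simp
    finally have x0: "40 / (\<epsilon>\<^sup>2 * real (L n)) + 8 / real (L n) \<le> (40 / \<epsilon>\<^sup>2 + 8) * (2 * real \<eta> / real n)" .
    have bnd: "40 / (\<epsilon>\<^sup>2 * real (L n)) + real (k1 n - 1) * exp (- (real (L n) * (G.I1 - \<epsilon>)))
      + real (k2 n - 1) * exp (- (real (L n) * (G.I2 - \<epsilon>)))
      + real ((k1 n - 1) * (k2 n - 1)) * exp (- (real (L n) * (G.I12 - \<epsilon>))) + 8 / real (L n) < r n"
    proof -
      have "0 < 1 / real n" using n0 by simp
      then show ?thesis using x0 x1 x2 x12 unfolding r_def by linarith
    qed
    have "r n / \<theta> \<le> \<theta>" using n(2) \<theta> by (simp add: pos_divide_le_eq power2_eq_square)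
    then have "\<tau> * (1 + 4 * \<theta> + r n / \<theta>) \<le> \<tau> * (1 + 5 * \<theta>)" using \<tau> by (intro mult_left_mono) auto
    then have \<tau>r: "\<tau> * (1 + 4 * \<theta> + r n / \<theta>) \<le> 1" using \<tau>\<theta> by simp
    show ?thesis
      unfolding K_def
      by (rule code_exists[OF psd N P a B pw L0 Ln n0 k e \<theta> less_imp_le[OF \<tau>(1)] \<tau>r bnd[unfolded a1'_def a2'_def]])
  qed
  have "\<forall>n. \<exists>fs. \<eta> \<le> n \<and> r n \<le> \<theta>\<^sup>2 \<longrightarrow>
      is_code N K P1 P2 n (k1 n) (k2 n) (fst fs) (fst (snd fs)) (snd (snd fs)) \<and>
      err_prob N K n (k1 n) (k2 n) (fst fs) (fst (snd fs)) (snd (snd fs)) \<le> r n"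
  proof
    fix n
    show "\<exists>fs. \<eta> \<le> n \<and> r n \<le> \<theta>\<^sup>2 \<longrightarrow>
      is_code N K P1 P2 n (k1 n) (k2 n) (fst fs) (fst (snd fs)) (snd (snd fs)) \<and>
      err_prob N K n (k1 n) (k2 n) (fst fs) (fst (snd fs)) (snd (snd fs)) \<le> r n"
    proof (cases "\<eta> \<le> n \<and> r n \<le> \<theta>\<^sup>2")
      case True
      then obtain f1 f2 g where "is_code N K P1 P2 n (k1 n) (k2 n) f1 f2 g \<and> err_prob N K n (k1 n) (k2 n) f1 f2 g \<le> r n"
        using codes by blast
      then show ?thesis by (intro exI[of _ "(f1, f2, g)"]) simp
    qed auto
  qed
  from choice[OF this] obtain fs where fs: "\<And>n. \<eta> \<le> n \<Longrightarrow> r n \<le> \<theta>\<^sup>2 \<Longrightarrow>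
      is_code N K P1 P2 n (k1 n) (k2 n) (fst (fs n)) (fst (snd (fs n))) (snd (snd (fs n))) \<and>
      err_prob N K n (k1 n) (k2 n) (fst (fs n)) (fst (snd (fs n))) (snd (snd (fs n))) \<le> r n" by blast
  have "\<forall>\<^sub>F n in sequentially. r n < \<theta>\<^sup>2" using r_lim \<theta> by (intro order_tendstoD(2)) auto
  moreover have "\<forall>\<^sub>F n in sequentially. \<eta> \<le> n" by (rule eventually_ge_at_top)
  ultimately have ev: "\<forall>\<^sub>F n in sequentially. \<eta> \<le> n \<and> r n \<le> \<theta>\<^sup>2" by eventually_elim simp
  have "\<forall>\<^sub>F n in sequentially. is_code N K P1 P2 n (k1 n) (k2 n) (fst (fs n)) (fst (snd (fs n))) (snd (snd (fs n))) \<and>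
        ln (real (k1 n)) / real n > R1 - \<delta> \<and> ln (real (k2 n)) / real n > R2 - \<delta>"
    using ev
  proof (rule eventually_mono)
    fix n assume n: "\<eta> \<le> n \<and> r n \<le> \<theta>\<^sup>2"
    have n0: "0 < real n" using n eta by simp
    have "real n * (R1 - \<delta> / 2) \<le> ln (real (k1 n))" "real n * (R2 - \<delta> / 2) \<le> ln (real (k2 n))"
      unfolding k1_def k2_def by (rule message_count(2))+
    then have "R1 - \<delta> / 2 \<le> ln (real (k1 n)) / real n" "R2 - \<delta> / 2 \<le> ln (real (k2 n)) / real n"
      using n0 by (simp_all add: pos_le_divide_eq mult.commute)
    then show "is_code N K P1 P2 n (k1 n) (k2 n) (fst (fs n)) (fst (snd (fs n))) (snd (snd (fs n))) \<and>
        ln (real (k1 n)) / real n > R1 - \<delta> \<and> ln (real (k2 n)) / real n > R2 - \<delta>"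
      using fs[of n] n d by (intro conjI) (blast, linarith+)
  qed
  moreover have "(\<lambda>n. err_prob N K n (k1 n) (k2 n) (fst (fs n)) (fst (snd (fs n))) (snd (snd (fs n)))) \<longlonglongrightarrow> 0"
  proof (rule tendsto_sandwich[OF _ _ tendsto_const r_lim])
    show "\<forall>\<^sub>F n in sequentially. 0 \<le> err_prob N K n (k1 n) (k2 n) (fst (fs n)) (fst (snd (fs n))) (snd (snd (fs n)))"
      by (intro always_eventually allI err_prob_nonneg)
    show "\<forall>\<^sub>F n in sequentially. err_prob N K n (k1 n) (k2 n) (fst (fs n)) (fst (snd (fs n))) (snd (snd (fs n))) \<le> r n"
      using ev
    proof (rule eventually_mono)
      fix n assume "\<eta> \<le> n \<and> r n \<le> \<theta>\<^sup>2"
      then show "err_prob N K n (k1 n) (k2 n) (fst (fs n)) (fst (snd (fs n))) (snd (snd (fs n))) \<le> r n"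
        using fs[of n] by simp
    qed
  qed
  ultimately show "\<exists>k1 k2 f1 f2 g. (\<forall>\<^sub>F n in sequentially. is_code N (KW_mat s1 s2 rho) P1 P2 n (k1 n) (k2 n) (f1 n) (f2 n) (g n) \<and>
        ln (real (k1 n)) / real n > R1 - \<delta> \<and> ln (real (k2 n)) / real n > R2 - \<delta>) \<and>
      (\<lambda>n. err_prob N (KW_mat s1 s2 rho) n (k1 n) (k2 n) (f1 n) (f2 n) (g n)) \<longlonglongrightarrow> 0"
    unfolding K_def
    by (intro exI[of _ k1] exI[of _ k2] exI[of _ "\<lambda>n. fst (fs n)"] exI[of _ "\<lambda>n. fst (snd (fs n))"] exI[of _ "\<lambda>n. snd (snd (fs n))"] conjI)
qed

text \<open>Monotonicity under projection carries the bounds to the full signal vectors. For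
  \<open>C = 0\<close> the only point is the origin, and the right-hand sides are
  nonnegative.\<close>

lemma region_params_bounds:
  assumes N: "0 < N" and a: "a1 \<in> carrier_vec \<eta>" "a2 \<in> carrier_vec \<eta>" and C: "C \<in> carrier_mat 2 \<eta>"
    and mem: "(R1, R2) \<in> region_params N \<eta> a1 a2 C"
  shows "0 \<le> R1" "0 \<le> R2" "R1 \<le> ln (1 + (\<Sum>i<\<eta>. (a1 $ i)\<^sup>2) / N) / (2 * real \<eta>)"
    "R2 \<le> ln (1 + (\<Sum>i<\<eta>. (a2 $ i)\<^sup>2) / N) / (2 * real \<eta>)"
    "R1 + R2 \<le> ln ((1 + (\<Sum>i<\<eta>. (a1 $ i)\<^sup>2) / N) * (1 + (\<Sum>i<\<eta>. (a2 $ i)\<^sup>2) / N) - (\<Sum>i<\<eta>. a1 $ i * a2 $ i)\<^sup>2 / N\<^sup>2) / (2 * real \<eta>)"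
proof -
  have "0 \<le> R1 \<and> 0 \<le> R2 \<and> R1 \<le> ln (1 + (\<Sum>i<\<eta>. (a1 $ i)\<^sup>2) / N) / (2 * real \<eta>) \<and>
    R2 \<le> ln (1 + (\<Sum>i<\<eta>. (a2 $ i)\<^sup>2) / N) / (2 * real \<eta>) \<and>
    R1 + R2 \<le> ln ((1 + (\<Sum>i<\<eta>. (a1 $ i)\<^sup>2) / N) * (1 + (\<Sum>i<\<eta>. (a2 $ i)\<^sup>2) / N) - (\<Sum>i<\<eta>. a1 $ i * a2 $ i)\<^sup>2 / N\<^sup>2) / (2 * real \<eta>)"
  proof (cases "C = 0\<^sub>m 2 \<eta>")
    case True
    have "1 \<le> (1 + (\<Sum>i<\<eta>. (a1 $ i)\<^sup>2) / N) * (1 + (\<Sum>i<\<eta>. (a2 $ i)\<^sup>2) / N) - (\<Sum>i<\<eta>. a1 $ i * a2 $ i)\<^sup>2 / N\<^sup>2"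
      by (rule projection_gram(3)[OF N, where f="\<lambda>i. a1 $ i" and g="\<lambda>i. a2 $ i"]) simp_all
    moreover have "0 \<le> (\<Sum>i<\<eta>. (a1 $ i)\<^sup>2) / N" "0 \<le> (\<Sum>i<\<eta>. (a2 $ i)\<^sup>2) / N"
      using N by (auto intro!: divide_nonneg_pos sum_nonneg)
    ultimately show ?thesis using mem True by (auto simp: region_params_def intro!: divide_nonneg_nonneg ln_ge_zero)
  next
    case False
    obtain p q where pq: "(\<Sum>i<\<eta>. p i * (a1 $ i - p i)) = 0" "(\<Sum>i<\<eta>. q i * (a2 $ i - q i)) = 0"
      "(\<Sum>i<\<eta>. p i * (a2 $ i - q i)) = 0" "(\<Sum>i<\<eta>. q i * (a1 $ i - p i)) = 0"
      and rates: "rate_expr N \<eta> (eff_C \<eta> C) (mat_of_cols \<eta> [a1] * (mat_of_cols \<eta> [a1])\<^sup>T) = ln (1 + (\<Sum>i<\<eta>. (p i)\<^sup>2) / N) / (2 * real \<eta>)"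
      "rate_expr N \<eta> (eff_C \<eta> C) (mat_of_cols \<eta> [a2] * (mat_of_cols \<eta> [a2])\<^sup>T) = ln (1 + (\<Sum>i<\<eta>. (q i)\<^sup>2) / N) / (2 * real \<eta>)"
      "rate_expr N \<eta> (eff_C \<eta> C) (mat_of_cols \<eta> [a1, a2] * (mat_of_cols \<eta> [a1, a2])\<^sup>T)
        = ln ((1 + (\<Sum>i<\<eta>. (p i)\<^sup>2) / N) * (1 + (\<Sum>i<\<eta>. (q i)\<^sup>2) / N) - (\<Sum>i<\<eta>. p i * q i)\<^sup>2 / N\<^sup>2) / (2 * real \<eta>)"
      using rate_expr_projection[OF N C False a] by blast
    have R: "0 \<le> R1" "0 \<le> R2" "R1 \<le> ln (1 + (\<Sum>i<\<eta>. (p i)\<^sup>2) / N) / (2 * real \<eta>)" "R2 \<le> ln (1 + (\<Sum>i<\<eta>. (q i)\<^sup>2) / N) / (2 * real \<eta>)"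
      "R1 + R2 \<le> ln ((1 + (\<Sum>i<\<eta>. (p i)\<^sup>2) / N) * (1 + (\<Sum>i<\<eta>. (q i)\<^sup>2) / N) - (\<Sum>i<\<eta>. p i * q i)\<^sup>2 / N\<^sup>2) / (2 * real \<eta>)"
      using mem False unfolding region_params_def Let_def rates[symmetric] by auto
    have mono: "ln x / (2 * real \<eta>) \<le> ln y / (2 * real \<eta>)" if "0 < x" "x \<le> y" for x y :: real
      using that by (intro divide_right_mono ln_mono) auto
    have pos: "0 < 1 + (\<Sum>i<\<eta>. (f i)\<^sup>2) / N" for f :: "nat \<Rightarrow> real"
      using N by (intro add_pos_nonneg divide_nonneg_pos sum_nonneg) auto
    note pg = projection_gram[OF N pq]
    note pg' = projection_gram(1)[OF N pq(2,1,4,3)]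
    have "ln (1 + (\<Sum>i<\<eta>. (p i)\<^sup>2) / N) / (2 * real \<eta>) \<le> ln (1 + (\<Sum>i<\<eta>. (a1 $ i)\<^sup>2) / N) / (2 * real \<eta>)"
      using pg(1) N by (intro mono pos) (simp add: divide_right_mono)
    moreover have "ln (1 + (\<Sum>i<\<eta>. (q i)\<^sup>2) / N) / (2 * real \<eta>) \<le> ln (1 + (\<Sum>i<\<eta>. (a2 $ i)\<^sup>2) / N) / (2 * real \<eta>)"
      using pg' N by (intro mono pos) (simp add: divide_right_mono)
    moreover have "ln ((1 + (\<Sum>i<\<eta>. (p i)\<^sup>2) / N) * (1 + (\<Sum>i<\<eta>. (q i)\<^sup>2) / N) - (\<Sum>i<\<eta>. p i * q i)\<^sup>2 / N\<^sup>2) / (2 * real \<eta>)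
      \<le> ln ((1 + (\<Sum>i<\<eta>. (a1 $ i)\<^sup>2) / N) * (1 + (\<Sum>i<\<eta>. (a2 $ i)\<^sup>2) / N) - (\<Sum>i<\<eta>. a1 $ i * a2 $ i)\<^sup>2 / N\<^sup>2) / (2 * real \<eta>)"
      using pg(3) by (intro mono pg(2)) linarith
    ultimately show ?thesis using R by linarith
  qed
  then show "0 \<le> R1" "0 \<le> R2" "R1 \<le> ln (1 + (\<Sum>i<\<eta>. (a1 $ i)\<^sup>2) / N) / (2 * real \<eta>)"
    "R2 \<le> ln (1 + (\<Sum>i<\<eta>. (a2 $ i)\<^sup>2) / N) / (2 * real \<eta>)"
    "R1 + R2 \<le> ln ((1 + (\<Sum>i<\<eta>. (a1 $ i)\<^sup>2) / N) * (1 + (\<Sum>i<\<eta>. (a2 $ i)\<^sup>2) / N) - (\<Sum>i<\<eta>. a1 $ i * a2 $ i)\<^sup>2 / N\<^sup>2) / (2 * real \<eta>)"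
    by blast+
qed

theorem mainTheorem16:
  fixes P1 P2 N s1 s2 rho :: real
  assumes "0 < P1" and "0 < P2" and "0 < N"
    and "psd_mat (KW_mat s1 s2 rho)"
  shows "R_SI P1 P2 N (KW_mat s1 s2 rho) \<subseteq> C_NoisyFBSI P1 P2 N (KW_mat s1 s2 rho)"
proof
  fix x assume x: "x \<in> R_SI P1 P2 N (KW_mat s1 s2 rho)"
  obtain R1 R2 where xR: "x = (R1, R2)" by force
  have "achievable P1 P2 N (KW_mat s1 s2 rho) R1 R2"
  \<comment> \<open>A point of the closure has points of the union arbitrarily near, and a small
    distance bounds both coordinate gaps.\<close>
  proof (rule achievable_limit)
    fix d :: real assume d: "0 < d"
    from x[unfolded R_SI_def closure_approachable, THEN spec, THEN mp, OF d]
    obtain y where y: "y \<in> \<Union> {region_params N \<eta> a1 a2 C | \<eta> a1 a2 B1 B2 C.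
       0 < \<eta> \<and> a1 \<in> carrier_vec \<eta> \<and> a2 \<in> carrier_vec \<eta> \<and>
       strictly_lower \<eta> B1 \<and> strictly_lower \<eta> B2 \<and> C \<in> carrier_mat 2 \<eta> \<and>
       power_ok N (KW_mat s1 s2 rho) P1 P2 \<eta> a1 a2 B1 B2}" and yd: "dist y x < d"
      by (elim bexE) (rule that)
    then obtain \<eta> a1 a2 B1 B2 C where par: "0 < \<eta>" "a1 \<in> carrier_vec \<eta>" "a2 \<in> carrier_vec \<eta>"
       "strictly_lower \<eta> B1" "strictly_lower \<eta> B2" "C \<in> carrier_mat 2 \<eta>"
       "power_ok N (KW_mat s1 s2 rho) P1 P2 \<eta> a1 a2 B1 B2" and mem: "y \<in> region_params N \<eta> a1 a2 C" by blast
    obtain R1' R2' where yR: "y = (R1', R2')" by force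
    note b = region_params_bounds[OF assms(3) par(2,3,6) mem[unfolded yR]]
    have "achievable P1 P2 N (KW_mat s1 s2 rho) R1' R2'"
      using assms by (intro region_point_achievable[OF _ _ _ _ par(1-5,7) b]) auto
    moreover have "\<bar>R1' - R1\<bar> < d" "\<bar>R2' - R2\<bar> < d"
      using yd dist_fst_le[of y x] dist_snd_le[of y x] by (auto simp: xR yR dist_real_def)
    then have "R1 - d < R1'" "R2 - d < R2'" by auto
    ultimately show "\<exists>R1' R2'. achievable P1 P2 N (KW_mat s1 s2 rho) R1' R2' \<and> R1 - d < R1' \<and> R2 - d < R2'" by blast
  qed
  then show "x \<in> C_NoisyFBSI P1 P2 N (KW_mat s1 s2 rho)" by (simp add: C_NoisyFBSI_def xR)
qed

end
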